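(* Let $\Omega\subset\mathbb R^d$ be an open connected bounded domain with sufficiently smooth boundary and outward unit normal $\nu$. Suppose that $f$ satisfies: - $f\in C^2(\overline\Omega\times(0,\infty))\cap L^1_{\mathrm{loc}}(\overline\Omega\times[0,\infty))$; - $uf,\ uf_x\in C(\overline\Omega\times[0,\infty))$; - $f_u<0$; - $|f(x,u)|\le g_1(u)$ for a.a. $u>0$, with some $g_1\in L^1_{\mathrm{loc}}[0,\infty)$; - $u|f_u(x,u)|+u|f_{xu}(x,u)|\le g_2(u)$ for a.a. $u>0$, with some $g_2\in L^1_{\mathrm{loc}}[0,\infty)$; - $f(x,m(x))=0$ for all $x\in\overline\Omega$, where $m:\overline\Omega\to(0,\infty)$ is a $C^2$-smooth probability density; - $\lim_{u\to\infty}f(x,u)=-\infty$ uniformly with respect to $x$. Let $u$ be a weak solution on $[0,\infty)$ of $$\partial_tu=-\operatorname{div}(u\nabla f)+u\Big(f-\int_\Omega uf\,dx\Big)\ \text{in }\Omega\times(0,\infty),\qquad u\frac{\partial f}{\partial\nu}=0\ \text{on }\partial\Omega\times(0,\infty),$$ $$u=u^0\ \text{at }t=0,\qquad u\ge0,\ \int_\Omega u\,dx=1,$$ with initial data $u^0\in L^\infty_+(\Omega)$, $\int_\Omega u^0\,dx=1$. Suppose that $u$ satisfies the entropy dissipation inequality $\partial_t\mathcal E(u)\le-D\mathcal E(u)$ in the sense of measures and $\operatorname{ess\,sup}_{t>0}\mathcal E(u(t))\le\mathcal E(u^0)$. Then $u$ exponentially converges to $m$ in the sense of entropy: $$\mathcal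 E(u(t))\le\mathcal E(u^0)\,e^{-\gamma t}\qquad\text{for a.a. }t>0,$$ where, given any $C>0$, $\gamma>0$ can be chosen uniformly over initial data satisfying $\mathcal E(u^0)\le C$.
   Context: $f_x$ denotes the gradient of $f(x,u)$ in $x$; in the problem bare $f$ means $f(x,u(x,t))$ and $\nabla f$ its full gradient in $x$. $L^\infty_+$ denotes nonnegative functions in $L^\infty$. Notation: $\Phi(x,u)=-\int_0^u\xi f_u(x,\xi)\,d\xi$, $\Phi_x(x,u)=-\int_0^u\xi f_{xu}(x,\xi)\,d\xi$, $E(x,u)=-\int_{m(x)}^uf(x,\xi)\,d\xi$. Relative entropy: $\mathcal E(u)=\int_\Omega E(x,u(x))\,dx$. When $u$ is given, $\Phi$, $\Phi_x$, $uf$, $uf_x$ stand for superpositions with $u$, $\nabla\Phi$ is the full spatial gradient of the superposition, and $\bar f=\int_\Omega uf\,dx$. Entropy production, for $u\in L^\infty_+(\Omega)$ with $\Phi(\cdot,u(\cdot))\in H^1(\Omega)$: $$D\mathcal E(u)=\int_\Omega u(f-\bar f)^2\,dx+\int_{[u>0]}\frac1u|-\nabla\Phi+\Phi_x+uf_x|^2\,dx,$$ where the second integral may be infinite and the first integrand is understood as $0$ where $u=0$. Weak solution: let $Q_T=\Omega\times(0,T)$ and let $u^0\in L^\infty(\Omega)$ be a probability density. $u\in L^\infty_+(Q_T)$ is a weak solution on $[0,T]$ if $\int_\Omega u(x,t)\,dx=1$ for a.a. $t\in(0,T)$, $\Phi(\cdot,u(\cdot))\in L^2(0,T;H^1(\Omega))$,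 and $$\int_0^T\!\!\int_\Omega\big(u\,\partial_t\varphi+(-\nabla\Phi+\Phi_x+uf_x)\cdot\nabla\varphi+(f-\bar f)u\varphi\big)\,dx\,dt=-\int_\Omega u^0(x)\varphi(x,0)\,dx$$ for every $\varphi\in C^1(\overline\Omega\times[0,T])$ with $\varphi(x,T)=0$. $u\in L^\infty_{\mathrm{loc}}([0,\infty);L^\infty_+(\Omega))$ is a weak solution on $[0,\infty)$ if it is a weak solution on $[0,T]$ for every $T>0$. An inequality $\partial_tA\le B$ holds in the sense of measures if $-\int_0^\infty A(t)\chi'(t)\,dt\le\int_0^\infty B(t)\chi(t)\,dt$ for all smooth nonnegative compactly supported test functions $\chi$ on $(0,\infty)$. *)

theory Defs
  imports "HOL-Analysis.Analysis" "HOL-Probability.Essential_Supremum"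
begin

definition grad :: "('b::euclidean_space \<Rightarrow> real) \<Rightarrow> 'b \<Rightarrow> 'b" where
  "grad g x = (THE D. GDERIV g x :> D)"

text \<open>
  For \<open>U\<close> open and \<open>U \<subseteq> S \<subseteq> closure U\<close>: \<open>g\<close> is in \<open>C\<^sup>k(S)\<close>, i.e. \<open>g\<close> is \<open>k\<close> times
  continuously differentiable in \<open>U\<close>, and \<open>g\<close> and its derivatives up to order \<open>k\<close> extend
  continuously to \<open>S\<close>.  Here \<open>D\<close> is the gradient on \<open>U\<close>, and on \<open>S - U\<close> its continuous extension.
\<close>

primrec Ck_upto :: "nat \<Rightarrow> 'b::euclidean_space set \<Rightarrow> 'b set \<Rightarrow> ('b \<Rightarrow> real) \<Rightarrow> bool" where
  "Ck_upto 0 U S g \<longleftrightarrow> continuous_on S g"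
| "Ck_upto (Suc k) U S g \<longleftrightarrow> continuous_on S g \<and>
     (\<exists>D. (\<forall>x\<in>U. GDERIV g x :> D x) \<and> (\<forall>b\<in>Basis. Ck_upto k U S (\<lambda>x. D x \<bullet> b)))"

text \<open>
  Boundary of class \<open>C\<^sup>k\<close>, given by local defining functions; the domain lies locally on one side
  of its boundary, and the outward unit normal is the normalised gradient of \<open>\<psi>\<close>.
\<close>

definition Ck_boundary :: "nat \<Rightarrow> 'a::euclidean_space set \<Rightarrow> bool" where
  "Ck_boundary k \<Omega> \<longleftrightarrow>
     (\<forall>p\<in>frontier \<Omega>. \<exists>V \<psi>. open V \<and> p \<in> V \<and> Ck_upto k V V \<psi> \<and>
        (\<forall>x\<in>V. grad \<psi> x \<noteq> 0) \<and> \<Omega> \<inter> V = {x\<in>V. \<psi> x < 0})"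

text \<open>A function given on \<open>D\<close> belongs to \<open>C(S)\<close> after extension by continuity.\<close>

definition extends_continuously ::
    "'b::topological_space set \<Rightarrow> 'b set \<Rightarrow> ('b \<Rightarrow> 'c::topological_space) \<Rightarrow> bool" where
  "extends_continuously D S g \<longleftrightarrow> (\<exists>h. continuous_on S h \<and> (\<forall>z\<in>D. h z = g z))"

definition test_function :: "'b::euclidean_space set \<Rightarrow> ('b \<Rightarrow> real) \<Rightarrow> bool" where
  "test_function U \<phi> \<longleftrightarrow> (\<forall>k. Ck_upto k UNIV UNIV \<phi>) \<and>
     compact (closure {x. \<phi> x \<noteq> 0}) \<and> closure {x. \<phi> x \<noteq> 0} \<subseteq> U"

definition L1_loc :: "'b::euclidean_space set \<Rightarrow> ('b \<Rightarrow> real) \<Rightarrow> bool" where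
  "L1_loc S g \<longleftrightarrow> (\<forall>K. compact K \<and> K \<subseteq> S \<longrightarrow> g absolutely_integrable_on K)"

definition Linf_nonneg :: "'b::euclidean_space set \<Rightarrow> ('b \<Rightarrow> real) \<Rightarrow> bool" where
  "Linf_nonneg S w \<longleftrightarrow> w \<in> borel_measurable (lebesgue_on S) \<and>
     (\<exists>c. AE z in lebesgue_on S. 0 \<le> w z \<and> w z \<le> c)"

definition L2 :: "'b::euclidean_space set \<Rightarrow> ('b \<Rightarrow> 'c::euclidean_space) \<Rightarrow> bool" where
  "L2 S w \<longleftrightarrow> w \<in> borel_measurable (lebesgue_on S) \<and>
     integrable (lebesgue_on S) (\<lambda>z. (norm (w z))\<^sup>2)"

text \<open>\<open>w \<in> H\<^sup>1(\<Omega>)\<close> with weak gradient \<open>G\<close>.\<close>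

definition H1_with_grad ::
    "'a::euclidean_space set \<Rightarrow> ('a \<Rightarrow> real) \<Rightarrow> ('a \<Rightarrow> 'a) \<Rightarrow> bool" where
  "H1_with_grad \<Omega> w G \<longleftrightarrow> L2 \<Omega> w \<and> L2 \<Omega> G \<and>
     (\<forall>\<phi>. test_function \<Omega> \<phi> \<longrightarrow>
        (LINT x|lebesgue_on \<Omega>. w x *\<^sub>R grad \<phi> x) = - (LINT x|lebesgue_on \<Omega>. \<phi> x *\<^sub>R G x))"

text \<open>Determined up to null sets when \<open>w \<in> H\<^sup>1(\<Omega>)\<close>, and only used under integrals over \<open>\<Omega>\<close>.\<close>

definition weak_grad :: "'a::euclidean_space set \<Rightarrow> ('a \<Rightarrow> real) \<Rightarrow> 'a \<Rightarrow> 'a" where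
  "weak_grad \<Omega> w = (SOME G. H1_with_grad \<Omega> w G)"

text \<open>
  \<open>w \<in> L\<^sup>2(0,T;H\<^sup>1(\<Omega>))\<close> with spatial weak gradient \<open>G\<close>, using the usual identification of
  \<open>L\<^sup>2(0,T;L\<^sup>2(\<Omega>))\<close> with \<open>L\<^sup>2(\<Omega> \<times> (0,T))\<close>.  The gradient is an argument rather than chosen slice by
  slice through \<open>weak_grad\<close>, since it has to be jointly measurable in space and time.
\<close>

definition L2_H1_with_grad :: "real \<Rightarrow> 'a::euclidean_space set \<Rightarrow>
    (real \<Rightarrow> 'a \<Rightarrow> real) \<Rightarrow> (real \<Rightarrow> 'a \<Rightarrow> 'a) \<Rightarrow> bool" where
  "L2_H1_with_grad T \<Omega> w G \<longleftrightarrow>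
     L2 (\<Omega> \<times> {0<..<T}) (\<lambda>(x, t). w t x) \<and> L2 (\<Omega> \<times> {0<..<T}) (\<lambda>(x, t). G t x) \<and>
     (AE t in lebesgue_on {0<..<T}. H1_with_grad \<Omega> (w t) (G t))"

text \<open>
  The nonlinearity \<open>f x u\<close> is meaningful for \<open>x \<in> closure \<Omega>\<close>, \<open>u > 0\<close>.  The functions below involving
  derivatives in \<open>x\<close> are used for \<open>x \<in> \<Omega>\<close>.  The (arbitrary) values at \<open>u = 0\<close> are harmless: they
  only occur multiplied by \<open>u\<close> or at an endpoint of an integral.
\<close>

definition f_u :: "('a::euclidean_space \<Rightarrow> real \<Rightarrow> real) \<Rightarrow> 'a \<Rightarrow> real \<Rightarrow> real" where
  "f_u f x u = deriv (f x) u"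

definition f_x :: "('a::euclidean_space \<Rightarrow> real \<Rightarrow> real) \<Rightarrow> 'a \<Rightarrow> real \<Rightarrow> 'a" where
  "f_x f x u = grad (\<lambda>y. f y u) x"

definition f_xu :: "('a::euclidean_space \<Rightarrow> real \<Rightarrow> real) \<Rightarrow> 'a \<Rightarrow> real \<Rightarrow> 'a" where
  "f_xu f x u = vector_derivative (f_x f x) (at u)"

definition Phi :: "('a::euclidean_space \<Rightarrow> real \<Rightarrow> real) \<Rightarrow> 'a \<Rightarrow> real \<Rightarrow> real" where
  "Phi f x u = - (LBINT \<xi>=0..u. \<xi> * f_u f x \<xi>)"

definition Phi_x :: "('a::euclidean_space \<Rightarrow> real \<Rightarrow> real) \<Rightarrow> 'a \<Rightarrow> real \<Rightarrow> 'a" where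
  "Phi_x f x u = - (LBINT \<xi>=0..u. \<xi> *\<^sub>R f_xu f x \<xi>)"

definition E_density ::
    "('a::euclidean_space \<Rightarrow> real \<Rightarrow> real) \<Rightarrow> ('a \<Rightarrow> real) \<Rightarrow> 'a \<Rightarrow> real \<Rightarrow> real" where
  "E_density f m x u = - (LBINT \<xi>=m x..u. f x \<xi>)"

definition entropy :: "('a::euclidean_space \<Rightarrow> real \<Rightarrow> real) \<Rightarrow> ('a \<Rightarrow> real) \<Rightarrow> 'a set \<Rightarrow>
    ('a \<Rightarrow> real) \<Rightarrow> real" where
  "entropy f m \<Omega> v = (LINT x|lebesgue_on \<Omega>. E_density f m x (v x))"

definition f_bar :: "('a::euclidean_space \<Rightarrow> real \<Rightarrow> real) \<Rightarrow> 'a set \<Rightarrow> ('a \<Rightarrow> real) \<Rightarrow> real" where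
  "f_bar f \<Omega> v = (LINT x|lebesgue_on \<Omega>. v x * f x (v x))"

text \<open>The vector field \<open>-\<nabla>\<Phi> + \<Phi>\<^sub>x + u f\<^sub>x\<close> for \<open>u = v\<close>, where \<open>G\<close> stands for \<open>\<nabla>\<Phi>\<close>.\<close>

definition flux :: "('a::euclidean_space \<Rightarrow> real \<Rightarrow> real) \<Rightarrow> ('a \<Rightarrow> 'a) \<Rightarrow> ('a \<Rightarrow> real) \<Rightarrow>
    'a \<Rightarrow> 'a" where
  "flux f G v x = - G x + Phi_x f x (v x) + v x *\<^sub>R f_x f x (v x)"

definition entropy_production :: "('a::euclidean_space \<Rightarrow> real \<Rightarrow> real) \<Rightarrow> 'a set \<Rightarrow>
    ('a \<Rightarrow> real) \<Rightarrow> ennreal" where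
  "entropy_production f \<Omega> v =
     (\<integral>\<^sup>+x. ennreal (v x * (f x (v x) - f_bar f \<Omega> v)\<^sup>2) \<partial>lebesgue_on \<Omega>) +
     (\<integral>\<^sup>+x. ennreal (1 / v x * (norm (flux f (weak_grad \<Omega> (\<lambda>y. Phi f y (v y))) v x))\<^sup>2)
        \<partial>lebesgue_on {x\<in>\<Omega>. v x > 0})"

text \<open>
  The inequality \<open>\<partial>\<^sub>t A \<le> - D\<close> on \<open>(0,\<infinity>)\<close> in the sense of measures; \<open>D\<close> may take the value \<open>\<infinity>\<close>.
\<close>

definition ddt_le_minus :: "(real \<Rightarrow> real) \<Rightarrow> (real \<Rightarrow> ennreal) \<Rightarrow> bool" where
  "ddt_le_minus A D \<longleftrightarrow>
     (\<forall>\<eta>. test_function {0<..} \<eta> \<and> (\<forall>t. \<eta> t \<ge> 0) \<longrightarrow>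
        ereal (- (LINT t|lebesgue_on {0<..}. A t * deriv \<eta> t))
          \<le> - enn2ereal (\<integral>\<^sup>+t. D t * ennreal (\<eta> t) \<partial>lebesgue_on {0<..}))"

definition weak_solution_on :: "real \<Rightarrow> ('a::euclidean_space \<Rightarrow> real \<Rightarrow> real) \<Rightarrow> 'a set \<Rightarrow>
    ('a \<Rightarrow> real) \<Rightarrow> (real \<Rightarrow> 'a \<Rightarrow> real) \<Rightarrow> bool" where
  "weak_solution_on T f \<Omega> u0 u \<longleftrightarrow>
     Linf_nonneg (\<Omega> \<times> {0<..<T}) (\<lambda>(x, t). u t x) \<and>
     (AE t in lebesgue_on {0<..<T}. (LINT x|lebesgue_on \<Omega>. u t x) = 1) \<and>
     (\<exists>G. L2_H1_with_grad T \<Omega> (\<lambda>t x. Phi f x (u t x)) G \<and>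
        (\<forall>\<phi> :: 'a \<times> real \<Rightarrow> real.
           Ck_upto 1 (\<Omega> \<times> {0<..<T}) (closure \<Omega> \<times> {0..T}) \<phi> \<and>
           (\<forall>x\<in>closure \<Omega>. \<phi> (x, T) = 0) \<longrightarrow>
           (LINT t|lebesgue_on {0<..<T}. LINT x|lebesgue_on \<Omega>.
              u t x * deriv (\<lambda>s. \<phi> (x, s)) t
              + flux f (G t) (u t) x \<bullet> grad (\<lambda>y. \<phi> (y, t)) x
              + (f x (u t x) - f_bar f \<Omega> (u t)) * u t x * \<phi> (x, t))
           = - (LINT x|lebesgue_on \<Omega>. u0 x * \<phi> (x, 0))))"

text \<open>
  Membership in \<open>L\<^sup>\<infinity>\<^sub>l\<^sub>o\<^sub>c([0,\<infinity>); L\<^sup>\<infinity>\<^sub>+(\<Omega>))\<close> amounts to the first clause of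
  \<open>weak_solution_on\<close> for all \<open>T > 0\<close>.
\<close>

definition weak_solution :: "('a::euclidean_space \<Rightarrow> real \<Rightarrow> real) \<Rightarrow> 'a set \<Rightarrow>
    ('a \<Rightarrow> real) \<Rightarrow> (real \<Rightarrow> 'a \<Rightarrow> real) \<Rightarrow> bool" where
  "weak_solution f \<Omega> u0 u \<longleftrightarrow> (\<forall>T>0. weak_solution_on T f \<Omega> u0 u)"

text \<open>
  In the continuity assumptions on \<open>u f\<close> and \<open>u f\<^sub>x\<close> the values at \<open>u = 0\<close> are those of the
  continuous extension.  They are necessarily \<open>0\<close>: by monotonicity of \<open>f\<close> in \<open>u\<close> and the bound
  \<open>g1\<close>, respectively by the bound \<open>g2\<close> on \<open>u f\<^sub>x\<^sub>u\<close>.  So they agree with the products in HOL.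

  The bounds by \<open>g2\<close>, and the function \<open>u f\<^sub>x\<close>, are stated for \<open>x \<in> \<Omega>\<close>, where \<open>f_x\<close> is the ordinary
  gradient; by continuity the bounds then hold for the extended derivatives on \<open>closure \<Omega>\<close>.
\<close>

definition admissible :: "'a::euclidean_space set \<Rightarrow> ('a \<Rightarrow> real \<Rightarrow> real) \<Rightarrow> ('a \<Rightarrow> real) \<Rightarrow> bool" where
  "admissible \<Omega> f m \<longleftrightarrow>
     Ck_upto 2 (\<Omega> \<times> {0<..}) (closure \<Omega> \<times> {0<..}) (\<lambda>(x, u). f x u) \<and>
     L1_loc (closure \<Omega> \<times> {0..}) (\<lambda>(x, u). f x u) \<and>
     extends_continuously (closure \<Omega> \<times> {0<..}) (closure \<Omega> \<times> {0..}) (\<lambda>(x, u). u * f x u) \<and>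
     extends_continuously (\<Omega> \<times> {0<..}) (closure \<Omega> \<times> {0..}) (\<lambda>(x, u). u *\<^sub>R f_x f x u) \<and>
     (\<forall>x\<in>closure \<Omega>. \<forall>u>0. f_u f x u < 0) \<and>
     (\<exists>g1. L1_loc {0..} g1 \<and>
        (\<forall>x\<in>closure \<Omega>. AE u in lebesgue_on {0<..}. \<bar>f x u\<bar> \<le> g1 u)) \<and>
     (\<exists>g2. L1_loc {0..} g2 \<and>
        (\<forall>x\<in>\<Omega>. AE u in lebesgue_on {0<..}. u * \<bar>f_u f x u\<bar> + u * norm (f_xu f x u) \<le> g2 u)) \<and>
     Ck_upto 2 \<Omega> (closure \<Omega>) m \<and>
     (\<forall>x\<in>closure \<Omega>. m x > 0) \<and>
     (LINT x|lebesgue_on \<Omega>. m x) = 1 \<and>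
     (\<forall>x\<in>closure \<Omega>. f x (m x) = 0) \<and>
     (\<forall>c. \<forall>\<^sub>F u in at_top. \<forall>x\<in>closure \<Omega>. f x u \<le> c)"

end

theory Submission
  imports Defs
begin

text \<open>
  The rate comes from a functional inequality at a fixed time: there is \<open>\<gamma> > 0\<close>, depending on \<open>C\<close>
  only, with \<open>\<gamma> E(v) \<le> DE(v)\<close> for every probability density \<open>v\<close> such that \<open>\<Phi>(\<cdot>, v)\<close> is in \<open>H\<^sup>1\<close> and
  \<open>E(v) \<le> C\<close> (\<open>entropy_production_inequality\<close>).  Almost every time slice of a solution is such a
  density (\<open>weak_solution_slices\<close>), so the entropy satisfies \<open>\<partial>\<^sub>t E \<le> - \<gamma> E\<close> in the sense of measures,
  and \<open>distributional_Gronwall\<close> gives the exponential decay.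

  For the functional inequality write \<open>\<mu>\<close> for the mean value \<open>f_bar\<close>.  As \<open>v\<close> and \<open>m\<close> have the same
  mass, \<open>\<mu> (v - m)\<close> can be added to the entropy density without changing the entropy.  Convexity
  of the density gives \<open>E(x, v) + \<mu> (v - m) \<le> (f - \<mu>) (m - v)\<close>, and as \<open>- f_u\<close> is bounded below on
  compact sets, the right-hand side is controlled by \<open>v (f - \<mu>)\<^sup>2\<close>, the density of the reaction
  part of the production, wherever \<open>v \<ge> \<delta>\<close> (\<open>pointwise_entropy_bound\<close>).  This needs a bound on \<open>\<mu>\<close>:
  if \<open>\<mu>\<close> is very negative, or positive and not small, then \<open>f\<close> is far from \<open>\<mu>\<close> on a definite part of
  the mass, and the reaction part exceeds a constant, which dominates \<open>E(v) \<le> C\<close>.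

  The set \<open>{v < \<delta>}\<close> remains, where the reaction part may vanish altogether.  Its measure is
  controlled by the transport part.  On it \<open>\<Phi>(x, v) \<le> a/2\<close>, whereas \<open>\<Phi>(x, v) \<ge> a\<close> on \<open>{v \<ge> b}\<close>, a set
  of measure bounded below because the entropy bound prevents concentration of mass.  By
  \<open>level_set_estimate\<close>, a form of the Poincare inequality in \<open>L\<^sup>1\<close>, the product of the two measures is
  at most a constant times the integral of \<open>\<bar>\<nabla>\<Phi>\<bar>\<close> over \<open>{a/2 < \<Phi> < a}\<close>.  There \<open>\<delta> < v < b\<close>, so that
  \<open>\<nabla>\<Phi>\<close> is the flux up to a bounded term, \<open>\<bar>flux\<bar> \<le> \<bar>flux\<bar>\<^sup>2/v + v\<close>, and \<open>v\<close> is bounded by a multiple of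
  \<open>v (f - \<mu>)\<^sup>2\<close>, since \<open>f\<close> exceeds \<open>\<mu>\<close> by a fixed amount where \<open>v \<le> b\<close>.

  The Poincare inequality is proved by comparing function values along segments.  If all segments
  between two sets lie in \<open>\<Omega>\<close>, integration over pairs of end points gives the inequality for this
  pair of sets; pairs are then chained.  Small balls in \<open>\<Omega>\<close> are chained by connectedness, and a
  neighbourhood of a boundary point sees a whole ball of \<open>\<Omega>\<close> along segments
  (\<open>boundary_segments\<close>).  Functions with a weak gradient are reached by mollification.
\<close>

section \<open>A smooth mollifier\<close>

lemma grad_eqI: "GDERIV g x :> D \<Longrightarrow> grad g x = D"
  unfolding grad_def
proof (rule the_equality)
  fix D' assume "GDERIV g x :> D" "GDERIV g x :> D'"
  then have "(\<lambda>h. inner h D) = (\<lambda>h. inner h D')"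
    unfolding gderiv_def by (rule has_derivative_unique)
  then have "inner (D - D') D = inner (D - D') D'" by (rule fun_cong)
  then have "inner (D - D') (D - D') = 0" by (simp add: inner_diff_right)
  then show "D' = D" by simp
qed

lemma GDERIV_continuous_on: "(\<And>x. x \<in> S \<Longrightarrow> GDERIV g x :> D x) \<Longrightarrow> continuous_on S g"
  unfolding gderiv_def
  using has_derivative_continuous continuous_at_imp_continuous_on by blast

text \<open>
  Dividing by powers of \<open>s\<close> makes the family closed under differentiation up to linear combinations,
  so that \<open>flat 0\<close> is seen to be smooth without computing higher derivatives.
\<close>

definition flat :: "nat \<Rightarrow> real \<Rightarrow> real" where
  "flat n s = (if s > 0 then exp (- 1 / s) / s ^ n else 0)"

lemma flat_nonneg: "flat n s \<ge> 0"
  by (simp add: flat_def)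

lemma flat_tendsto_0: "(flat n \<longlongrightarrow> 0) (at 0)"
proof -
  have "((\<lambda>s. exp (- 1 / s) / s ^ n) \<longlongrightarrow> 0) (at_right (0::real))"
    unfolding filterlim_at_right_to_top
    using tendsto_power_div_exp_0[of n]
    by (simp add: field_simps exp_minus)
  moreover have "\<forall>\<^sub>F s in at_right (0::real). flat n s = exp (- 1 / s) / s ^ n"
    by (rule eventually_at_rightI[of 0 1]) (auto simp: flat_def)
  ultimately have r: "(flat n \<longlongrightarrow> 0) (at_right 0)"
    by (simp add: tendsto_cong)
  have "\<forall>\<^sub>F s in at_left (0::real). flat n s = 0"
    by (rule eventually_at_leftI[of "-1" 0]) (auto simp: flat_def)
  then have l: "(flat n \<longlongrightarrow> 0) (at_left 0)"
    by (simp add: tendsto_eventually)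
  show ?thesis using l r by (simp add: filterlim_split_at)
qed

lemma flat_has_derivative: "DERIV (flat n) s :> flat (n + 2) s - n * flat (n + 1) s"
proof -
  consider "s > 0" | "s < 0" | "s = 0" by linarith
  then show ?thesis
  proof cases
    case 1
    have "DERIV (\<lambda>s. exp (- 1 / s) / s ^ n) s :>
        (exp (- 1 / s) * (1 / s\<^sup>2) * s ^ n - exp (- 1 / s) * (n * s ^ (n - 1))) / (s ^ n * s ^ n)"
      using 1 by (auto intro!: derivative_eq_intros simp: power2_eq_square)
    also have "(exp (- 1 / s) * (1 / s\<^sup>2) * s ^ n - exp (- 1 / s) * (n * s ^ (n - 1))) / (s ^ n * s ^ n)
        = flat (n + 2) s - n * flat (n + 1) s"
      using 1 by (cases n) (simp_all add: flat_def field_simps power2_eq_square)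
    finally show ?thesis
      by (rule has_field_derivative_transform_within_open[where S="{0<..}"])
        (use 1 in \<open>auto simp: flat_def\<close>)
  next
    case 2
    have "DERIV (flat n) s :> 0"
      by (rule has_field_derivative_transform_within_open[where S="{..<0}" and f="\<lambda>_. 0"])
        (use 2 in \<open>auto simp: flat_def\<close>)
    then show ?thesis using 2 by (simp add: flat_def)
  next
    case 3
    have "(\<lambda>h. (flat n (0 + h) - flat n 0) / h) = flat (Suc n)"
      by (auto simp: flat_def fun_eq_iff)
    then have "DERIV (flat n) 0 :> 0"
      unfolding DERIV_def using flat_tendsto_0[of "Suc n"] by (simp only:)
    then show ?thesis using 3 by (simp add: flat_def)
  qed
qed

text \<open>
  A class of functions vanishing outside \<open>ball c r\<close> that is closed under partial derivatives; its
  members are therefore of class \<open>C\<^sup>k\<close> for all \<open>k\<close>.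
\<close>

inductive_set bump_alg :: "'a::euclidean_space \<Rightarrow> real \<Rightarrow> ('a \<Rightarrow> real) set" for c r where
  base: "(\<lambda>x. flat n (r\<^sup>2 - (x - c) \<bullet> (x - c))) \<in> bump_alg c r"
| times: "g \<in> bump_alg c r \<Longrightarrow> (\<lambda>x. ((x - c) \<bullet> b) * g x) \<in> bump_alg c r"
| scale: "g \<in> bump_alg c r \<Longrightarrow> (\<lambda>x. k * g x) \<in> bump_alg c r"
| plus: "g \<in> bump_alg c r \<Longrightarrow> h \<in> bump_alg c r \<Longrightarrow> (\<lambda>x. g x + h x) \<in> bump_alg c r"

lemma bump_alg_gradient:
  assumes "g \<in> bump_alg c r"
  shows "\<exists>D. (\<forall>x. GDERIV g x :> D x) \<and> (\<forall>b. (\<lambda>x. D x \<bullet> b) \<in> bump_alg c r)"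
  using assms
proof induction
  case (base n)
  let ?q = "\<lambda>x. r\<^sup>2 - (x - c) \<bullet> (x - c)"
  have q: "GDERIV ?q x :> (-2) *\<^sub>R (x - c)" for x
    unfolding gderiv_def
    by (auto intro!: derivative_eq_intros simp: inner_commute algebra_simps)
  let ?d = "\<lambda>x. flat (n + 2) (?q x) - n * flat (n + 1) (?q x)"
  have "GDERIV (\<lambda>x. flat n (?q x)) x :> ?d x *\<^sub>R ((-2) *\<^sub>R (x - c))" for x
    by (rule GDERIV_DERIV_compose[OF q flat_has_derivative])
  moreover have "(\<lambda>x. (?d x *\<^sub>R ((-2) *\<^sub>R (x - c))) \<bullet> b) \<in> bump_alg c r" for b
  proof -
    have "(\<lambda>x. ((x - c) \<bullet> b) * (-2 * (flat (n + 2) (?q x) + (- real n) * flat (n + 1) (?q x))))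
       \<in> bump_alg c r"
      by (intro bump_alg.intros)
    then show ?thesis by (simp add: algebra_simps)
  qed
  ultimately show ?case by (intro exI[of _ "\<lambda>x. ?d x *\<^sub>R ((-2) *\<^sub>R (x - c))"]) blast
next
  case (times g b)
  then obtain D where D: "\<And>x. GDERIV g x :> D x" "\<And>b. (\<lambda>x. D x \<bullet> b) \<in> bump_alg c r" by auto
  have l: "GDERIV (\<lambda>x. (x - c) \<bullet> b) x :> b" for x
    unfolding gderiv_def by (auto intro!: derivative_eq_intros)
  have "GDERIV (\<lambda>x. ((x - c) \<bullet> b) * g x) x :> ((x - c) \<bullet> b) *\<^sub>R D x + g x *\<^sub>R b" for x
    by (rule GDERIV_mult[OF l D(1)])
  moreover have "(\<lambda>x. (((x - c) \<bullet> b) *\<^sub>R D x + g x *\<^sub>R b) \<bullet> b') \<in> bump_alg c r" for b'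
  proof -
    have "(\<lambda>x. ((x - c) \<bullet> b) * (D x \<bullet> b') + (b \<bullet> b') * g x) \<in> bump_alg c r"
      by (intro bump_alg.plus bump_alg.times bump_alg.scale D times)
    then show ?thesis by (simp add: inner_add_left mult.commute)
  qed
  ultimately show ?case by (intro exI[of _ "\<lambda>x. ((x - c) \<bullet> b) *\<^sub>R D x + g x *\<^sub>R b"]) blast
next
  case (scale g k)
  then obtain D where D: "\<And>x. GDERIV g x :> D x" "\<And>b. (\<lambda>x. D x \<bullet> b) \<in> bump_alg c r" by auto
  have "GDERIV (\<lambda>x. k * g x) x :> k *\<^sub>R D x" for x
    using GDERIV_mult[OF GDERIV_const[of k] D(1)] by simp
  moreover have "(\<lambda>x. (k *\<^sub>R D x) \<bullet> b') \<in> bump_alg c r" for b'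
    using bump_alg.scale[OF D(2)] by simp
  ultimately show ?case by (intro exI[of _ "\<lambda>x. k *\<^sub>R D x"]) blast
next
  case (plus g h)
  then obtain D D' where D: "\<And>x. GDERIV g x :> D x" "\<And>b. (\<lambda>x. D x \<bullet> b) \<in> bump_alg c r"
    and D': "\<And>x. GDERIV h x :> D' x" "\<And>b. (\<lambda>x. D' x \<bullet> b) \<in> bump_alg c r" by auto
  have "GDERIV (\<lambda>x. g x + h x) x :> D x + D' x" for x
    by (rule GDERIV_add[OF D(1) D'(1)])
  moreover have "(\<lambda>x. (D x + D' x) \<bullet> b') \<in> bump_alg c r" for b'
    using bump_alg.plus[OF D(2) D'(2)] by (simp add: inner_add_left)
  ultimately show ?case by (intro exI[of _ "\<lambda>x. D x + D' x"]) blast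
qed

lemma bump_alg_continuous: "g \<in> bump_alg c r \<Longrightarrow> continuous_on UNIV g"
  using bump_alg_gradient[of g c r] GDERIV_continuous_on[of UNIV g] by blast

lemma bump_alg_Ck: "g \<in> bump_alg c r \<Longrightarrow> Ck_upto k UNIV UNIV g"
proof (induction k arbitrary: g)
  case 0 then show ?case by (simp add: bump_alg_continuous)
next
  case (Suc k)
  obtain D where "\<forall>x. GDERIV g x :> D x" "\<forall>b. (\<lambda>x. D x \<bullet> b) \<in> bump_alg c r"
    using bump_alg_gradient[OF Suc.prems] by blast
  then show ?case using Suc.IH bump_alg_continuous[OF Suc.prems] by auto
qed

lemma bump_alg_support:
  "g \<in> bump_alg c r \<Longrightarrow> 0 \<le> r \<Longrightarrow> r \<le> dist c x \<Longrightarrow> g x = 0"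
proof (induction rule: bump_alg.induct)
  case (base n)
  then have "r\<^sup>2 \<le> (dist c x)\<^sup>2" by (simp add: power_mono)
  then show ?case
    by (simp add: flat_def dist_norm norm_minus_commute flip: power2_norm_eq_inner)
qed auto

definition moll :: "real \<Rightarrow> 'a::euclidean_space \<Rightarrow> real" where
  "moll r z = flat 0 (r\<^sup>2 - z \<bullet> z) / (LINT y|lborel. flat 0 (r\<^sup>2 - (y::'a) \<bullet> y))"

definition moll_grad :: "real \<Rightarrow> 'a::euclidean_space \<Rightarrow> 'a" where
  "moll_grad r z = grad (moll r) z"

lemma moll_in_bump_alg: "(\<lambda>y. moll r (c - y)) \<in> bump_alg c r"
proof -
  have "(\<lambda>y. (1 / (LINT y|lborel. flat 0 (r\<^sup>2 - (y::'a) \<bullet> y))) * flat 0 (r\<^sup>2 - (y - c) \<bullet> (y - c))) \<in> bump_alg c r"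
    by (intro bump_alg.intros)
  moreover have "(y - c) \<bullet> (y - c) = (c - y) \<bullet> (c - y)" for y
    by (simp flip: power2_norm_eq_inner add: norm_minus_commute)
  ultimately show ?thesis by (simp add: moll_def)
qed

lemma moll_minus: "moll r (- z) = moll r z"
  by (simp add: moll_def)

lemma moll_eq_0: "0 \<le> r \<Longrightarrow> r \<le> norm z \<Longrightarrow> moll r z = 0"
  using bump_alg_support[OF moll_in_bump_alg[of r 0], of "-z"] by simp

lemma moll_bump_alg0: "moll r \<in> bump_alg 0 r"
  using moll_in_bump_alg[of r 0] by (simp add: moll_minus)

lemma moll_continuous: "continuous_on UNIV (moll r)"
  by (rule bump_alg_continuous[OF moll_bump_alg0])

lemma moll_has_grad: "GDERIV (moll r) (z::'a::euclidean_space) :> moll_grad r z"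
proof -
  obtain D :: "'a \<Rightarrow> 'a" where "\<And>x. GDERIV (moll r) x :> D x"
    using bump_alg_gradient[OF moll_bump_alg0[of r, where 'a='a]] by blast
  then have "GDERIV (moll r) z :> D z" by blast
  with grad_eqI[OF this] show ?thesis unfolding moll_grad_def by simp
qed

lemma moll_grad_component: "(\<lambda>x. moll_grad r x \<bullet> b) \<in> bump_alg (0::'a::euclidean_space) r"
proof -
  obtain D where D: "\<forall>x. GDERIV (moll r) x :> D x" "\<forall>b. (\<lambda>x. D x \<bullet> b) \<in> bump_alg (0::'a) r"
    using bump_alg_gradient[OF moll_bump_alg0[of r]] by blast
  then have "moll_grad r = D"
    unfolding moll_grad_def[abs_def] using grad_eqI by blast
  with D show ?thesis by simp
qed

lemma moll_grad_continuous: "continuous_on UNIV (moll_grad r)"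
proof (rule continuous_on_componentwise[THEN iffD2], safe)
  fix i :: 'a
  show "continuous_on UNIV (\<lambda>x. moll_grad r x \<bullet> i)"
    by (rule bump_alg_continuous[OF moll_grad_component])
qed

lemma moll_grad_eq_0:
  assumes "0 \<le> r" "r \<le> norm z" shows "moll_grad r z = 0"
proof (rule euclidean_eqI)
  fix b
  show "moll_grad r z \<bullet> b = 0 \<bullet> b"
    using bump_alg_support[OF moll_grad_component[of r b], of z] assms by (simp add: dist_norm)
qed

lemma moll_grad_bounded: "0 \<le> r \<Longrightarrow> \<exists>B>0. \<forall>z::'a::euclidean_space. norm (moll_grad r z) \<le> B"
proof -
  assume r: "0 \<le> r"
  have "bounded (moll_grad r ` cball (0::'a) r)"
    by (intro compact_imp_bounded compact_continuous_image continuous_on_subset[OF moll_grad_continuous]) auto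
  then obtain B where B: "B > 0" "\<And>z. z \<in> cball (0::'a) r \<Longrightarrow> norm (moll_grad r z) \<le> B"
    by (auto simp: bounded_pos)
  have "norm (moll_grad r z) \<le> B" for z :: 'a
    using B moll_grad_eq_0[OF r, of z] by (cases "norm z \<le> r") auto
  with B show ?thesis by blast
qed

lemma moll_bounded: "0 \<le> r \<Longrightarrow> \<exists>B>0. \<forall>z::'a::euclidean_space. \<bar>moll r z\<bar> \<le> B"
proof -
  assume r: "0 \<le> r"
  have "bounded (moll r ` cball (0::'a) r)"
    by (intro compact_imp_bounded compact_continuous_image continuous_on_subset[OF moll_continuous]) auto
  then obtain B where B: "B > 0" "\<And>z. z \<in> cball (0::'a) r \<Longrightarrow> norm (moll r z) \<le> B"
    by (auto simp: bounded_pos)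
  have "\<bar>moll r z\<bar> \<le> B" for z :: 'a
    using B moll_eq_0[OF r, of z] by (cases "norm z \<le> r") auto
  with B show ?thesis by blast
qed

lemma integrable_bounded_support:
  fixes g :: "'a::euclidean_space \<Rightarrow> real"
  assumes "continuous_on UNIV g" "\<And>z. r \<le> norm z \<Longrightarrow> g z = 0"
  shows "integrable lborel g"
proof -
  have "integrable lborel (\<lambda>x. indicator (cball 0 r) x *\<^sub>R g x)"
    by (intro borel_integrable_compact continuous_on_subset[OF assms(1)]) auto
  also have "(\<lambda>x. indicator (cball 0 r) x *\<^sub>R g x) = g"
  proof
    fix x show "indicator (cball 0 r) x *\<^sub>R g x = g x"
      using assms(2)[of x] by (cases "norm x \<le> r") auto
  qed
  finally show ?thesis .
qed

lemma moll_raw_integral_pos: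
  assumes "r > 0" shows "(LINT y|lborel. flat 0 (r\<^sup>2 - (y::'a::euclidean_space) \<bullet> y)) > 0"
proof -
  let ?g = "\<lambda>y::'a. flat 0 (r\<^sup>2 - y \<bullet> y)"
  have a: "?g \<in> bump_alg 0 r" using bump_alg.base[of 0 r "0::'a"] by simp
  have i: "integrable lborel ?g"
    by (rule integrable_bounded_support[OF bump_alg_continuous[OF a], of r])
      (use bump_alg_support[OF a] assms in \<open>auto simp: dist_norm\<close>)
  have "(LINT y|lborel. ?g y) \<ge> 0" by (simp add: flat_nonneg)
  moreover have "(LINT y|lborel. ?g y) \<noteq> 0"
  proof
    assume "(LINT y|lborel. ?g y) = 0"
    then have "AE y in lborel. ?g y = 0"
      using integral_nonneg_eq_0_iff_AE[OF i] flat_nonneg by blast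
    then have "AE y in lborel. y \<notin> ball (0::'a) r"
    proof eventually_elim
      case (elim y)
      show ?case
      proof
        assume "y \<in> ball 0 r"
        then have "(norm y)\<^sup>2 < r\<^sup>2" by (intro power_strict_mono) auto
        then show False using elim by (simp add: flat_def power2_norm_eq_inner)
      qed
    qed
    then have "emeasure lborel (ball (0::'a) r) = 0"
      using AE_iff_measurable[of "ball (0::'a) r" lborel "\<lambda>y. y \<notin> ball 0 r"] by (simp add: ball_def)
    then show False using content_ball_pos[OF assms, of "0::'a"]
      by (simp add: measure_def)
  qed
  ultimately show ?thesis by simp
qed

lemma moll_nonneg: "0 < r \<Longrightarrow> moll r (z::'a::euclidean_space) \<ge> 0"
  using moll_raw_integral_pos[of r, where 'a='a] by (simp add: moll_def flat_nonneg)

lemma moll_integrable: "0 \<le> r \<Longrightarrow> integrable lborel (moll r)"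
  by (rule integrable_bounded_support[OF moll_continuous, of r]) (simp add: moll_eq_0)

lemma moll_integral: "0 < r \<Longrightarrow> (LINT z|lborel. moll r (z::'a::euclidean_space)) = 1"
  using moll_raw_integral_pos[of r, where 'a='a] by (simp add: moll_def)

lemma test_function_moll:
  assumes "0 < r" "cball x r \<subseteq> U"
  shows "test_function U (\<lambda>y. moll r (x - y))"
proof -
  have "{y. moll r (x - y) \<noteq> 0} \<subseteq> cball x r"
    using moll_eq_0[of r] assms by (force simp: dist_norm)
  then have s: "closure {y. moll r (x - y) \<noteq> 0} \<subseteq> cball x r"
    by (simp add: closure_minimal)
  then have "compact (closure {y. moll r (x - y) \<noteq> 0})"
    unfolding compact_eq_bounded_closed using bounded_subset[OF bounded_cball] by auto
  then show ?thesis
    using s assms bump_alg_Ck[OF moll_in_bump_alg[of r x]] unfolding test_function_def by auto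
qed

lemma grad_moll_shift: "grad (\<lambda>y. moll r (x - y)) y = - moll_grad r (x - y)"
proof (rule grad_eqI, unfold gderiv_def)
  have "(moll r has_derivative (\<lambda>h. h \<bullet> moll_grad r (x - y))) (at (x - y))"
    using moll_has_grad[of r "x - y"] by (simp add: gderiv_def)
  moreover have "((\<lambda>y. x - y) has_derivative (\<lambda>h. - h)) (at y)"
    by (auto intro!: derivative_eq_intros)
  ultimately show "((\<lambda>y. moll r (x - y)) has_derivative (\<lambda>h. h \<bullet> - moll_grad r (x - y))) (at y)"
    using has_derivative_compose[of "\<lambda>y. x - y" "\<lambda>h. - h" y UNIV "moll r"
        "\<lambda>h. h \<bullet> moll_grad r (x - y)"] by simp
qed

section \<open>Mollification\<close>

lemma nn_integral_lborel_translate: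
  fixes H :: "'a::euclidean_space \<Rightarrow> ennreal"
  assumes [measurable]: "H \<in> borel_measurable borel"
  shows "(\<integral>\<^sup>+x. H (x - z) \<partial>lborel) = (\<integral>\<^sup>+x. H x \<partial>lborel)"
proof -
  have "(\<integral>\<^sup>+x. H x \<partial>lborel) = (\<integral>\<^sup>+x. H x \<partial>distr lborel borel ((+) (- z)))"
    by (simp add: lborel_distr_plus)
  also have "\<dots> = (\<integral>\<^sup>+x. H (- z + x) \<partial>lborel)"
    by (subst nn_integral_distr) auto
  finally show ?thesis by (simp add: add.commute)
qed

lemma lborel_distr_reflect: "distr lborel borel (\<lambda>y. x - y) = (lborel :: 'a::euclidean_space measure)"
  using lborel_affine[of "-1" x] by (simp add: density_1)

lemma integral_lborel_reflect:
  fixes H :: "'a::euclidean_space \<Rightarrow> 'b::{banach, second_countable_topology}"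
  assumes [measurable]: "H \<in> borel_measurable borel"
  shows "(LINT y|lborel. H (x - y)) = (LINT y|lborel. H y)"
proof -
  have "(LINT y|lborel. H y) = (LINT y|distr lborel borel (\<lambda>y. x - y). H y)"
    by (simp add: lborel_distr_reflect)
  also have "\<dots> = (LINT y|lborel. H (x - y))"
    by (subst integral_distr) auto
  finally show ?thesis by simp
qed

lemma compact_open_sandwich:
  fixes A :: "'a::euclidean_space set"
  assumes A: "A \<in> sets borel" "emeasure lborel A < \<infinity>" and e: "e > (0::real)"
  obtains K U where "compact K" "open U" "K \<subseteq> A" "A \<subseteq> U" "emeasure lborel (U - K) < ennreal e"
proof -
  have Al: "A \<in> sets lebesgue" using A by simp
  have e2: "e / 2 > 0" using e by simp
  obtain U where U: "open U" "A \<subseteq> U" "emeasure lebesgue (U - A) < ennreal (e/2)"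
    using sets_lebesgue_outer_open[OF Al e2] .
  obtain T where T: "closed T" "T \<subseteq> A" "emeasure lebesgue (A - T) < ennreal (e/2)"
    using sets_lebesgue_inner_closed[OF Al e2] .
  have [measurable]: "U \<in> sets borel" "T \<in> sets borel" using U T by auto
  note [measurable] = A(1)
  have U': "emeasure lborel (U - A) < ennreal (e/2)" using U A by (simp add: emeasure_completion)
  have T': "emeasure lborel (A - T) < ennreal (e/2)" using T A by (simp add: emeasure_completion)
  have fin: "emeasure lborel (A - T \<inter> cball 0 (real n)) \<noteq> \<infinity>" for n
  proof -
    have "emeasure lborel (A - T \<inter> cball 0 (real n)) \<le> emeasure lborel A"
      by (rule emeasure_mono) auto
    then show ?thesis using A(2) by (auto simp: top_unique)
  qed
  have "(\<lambda>n. emeasure lborel (A - T \<inter> cball 0 (real n)))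
      \<longlonglongrightarrow> emeasure lborel (\<Inter>n. A - T \<inter> cball 0 (real n))"
    by (rule Lim_emeasure_decseq) (auto simp: decseq_def fin[simplified])
  also have "(\<Inter>n. A - T \<inter> cball 0 (real n)) = A - T"
    using real_arch_simple[of "norm x" for x] by auto
  finally have "\<forall>\<^sub>F n in sequentially. emeasure lborel (A - T \<inter> cball 0 (real n)) < ennreal (e/2)"
    using T' by (rule order_tendstoD(2))
  then obtain n where n: "emeasure lborel (A - T \<inter> cball 0 (real n)) < ennreal (e/2)"
    by (auto simp: eventually_sequentially)
  let ?K = "T \<inter> cball 0 (real n)"
  have "emeasure lborel (U - ?K) \<le> emeasure lborel ((U - A) \<union> (A - ?K))"
    by (rule emeasure_mono) auto
  also have "\<dots> \<le> emeasure lborel (U - A) + emeasure lborel (A - ?K)"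
    by (rule emeasure_subadditive) auto
  also have "\<dots> < ennreal (e/2) + ennreal (e/2)"
    by (rule add_strict_mono[OF U' n])
  also have "\<dots> = ennreal e" using e by (simp flip: ennreal_plus)
  finally show ?thesis using that[of ?K U] U T by (auto simp: closed_Int_compact)
qed

text \<open>
  By density it suffices to treat the indicator function of a set \<open>A\<close> of finite measure.  With \<open>K\<close> compact,
  \<open>U\<close> open, \<open>K \<subseteq> A \<subseteq> U\<close> and \<open>U - K\<close> small, a shift by less than the distance of \<open>K\<close> to the complement of \<open>U\<close>
  changes it only on \<open>U - K\<close> and on the translate of \<open>U - K\<close>.
\<close>

lemma translation_L1_continuous:
  fixes F :: "'a::euclidean_space \<Rightarrow> 'b::{banach, second_countable_topology}"
  assumes "integrable lborel F" "e > (0::real)"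
  shows "\<exists>\<delta>>0. \<forall>z. norm z < \<delta> \<longrightarrow> (\<integral>\<^sup>+x. ennreal (norm (F (x - z) - F x)) \<partial>lborel) \<le> ennreal e"
  using assms
proof (induction arbitrary: e rule: integrable_induct)
  case (base A c)
  define e' where "e' = e / (2 * (norm c + 1))"
  have e': "e' > 0" using base.prems unfolding e'_def
    by (intro divide_pos_pos) (auto intro: add_nonneg_pos)
  obtain K U where KU: "compact K" "open U" "K \<subseteq> A" "A \<subseteq> U" "emeasure lborel (U - K) < ennreal e'"
    using compact_open_sandwich[of A e'] base e' by auto
  obtain \<delta> where \<delta>: "\<delta> > 0" "(\<Union>x\<in>K. ball x \<delta>) \<subseteq> U"
    using compact_subset_open_imp_ball_epsilon_subset[of K U] KU by auto
  have [measurable]: "A \<in> sets borel" "K \<in> sets borel" "U \<in> sets borel"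
    using base KU borel_closed[OF compact_imp_closed[OF KU(1)]] by auto
  show ?case
  proof (intro exI[of _ \<delta>] conjI allI impI \<delta>)
    fix z :: 'a assume z: "norm z < \<delta>"
    have "x - z \<in> ball x \<delta>" "x + z \<in> ball x \<delta>" for x
      using z by (auto simp: dist_norm)
    then have U: "x - z \<in> U \<and> x + z \<in> U" if "x \<in> K" for x
      using \<delta>(2) that by blast
    then have s: "x \<in> K \<Longrightarrow> x - z \<in> U" "x - z \<in> K \<Longrightarrow> x \<in> U" for x
      using U[of x] U[of "x - z"] by auto
    have "ennreal (norm (indicator A (x - z) *\<^sub>R c - indicator A x *\<^sub>R c))
      \<le> ennreal (norm c) * (indicator (U - K) x + indicator (U - K) (x - z))" for x
    proof -
      have "x \<in> K \<Longrightarrow> x \<in> A" "x - z \<in> K \<Longrightarrow> x - z \<in> A" "x \<in> A \<Longrightarrow> x \<in> U" "x - z \<in> A \<Longrightarrow> x - z \<in> U"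
        using KU(3,4) by auto
      then show ?thesis using s[of x]
        by (cases "x \<in> A"; cases "x - z \<in> A"; cases "x \<in> K"; cases "x - z \<in> K")
          (auto simp: indicator_def mult_2_right)
    qed
    then have "(\<integral>\<^sup>+x. ennreal (norm (indicator A (x - z) *\<^sub>R c - indicator A x *\<^sub>R c)) \<partial>lborel)
      \<le> (\<integral>\<^sup>+x. ennreal (norm c) * (indicator (U - K) x + indicator (U - K) (x - z)) \<partial>lborel)"
      by (intro nn_integral_mono)
    also have "\<dots> = ennreal (norm c) * ((\<integral>\<^sup>+x. indicator (U - K) x \<partial>lborel) + (\<integral>\<^sup>+x. indicator (U - K) (x - z) \<partial>lborel))"
      by (simp add: nn_integral_cmult nn_integral_add)
    also have "(\<integral>\<^sup>+x. indicator (U - K) (x - z) \<partial>lborel) = (\<integral>\<^sup>+x. indicator (U - K) x \<partial>lborel)"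
      by (rule nn_integral_lborel_translate) auto
    also have "(\<integral>\<^sup>+x. indicator (U - K) x \<partial>lborel) = emeasure lborel (U - K)" by simp
    also have "ennreal (norm c) * (emeasure lborel (U - K) + emeasure lborel (U - K))
       \<le> ennreal (norm c) * (ennreal e' + ennreal e')"
      using KU(5) by (intro mult_left_mono add_mono) auto
    also have "\<dots> = ennreal (norm c * (2 * e'))"
      using e' by (simp add: ennreal_mult flip: ennreal_plus)
    also have "\<dots> \<le> ennreal e"
    proof -
      have "norm c + 1 > 0" by (simp add: add_nonneg_pos)
      then have "2 * (norm c + 1) * e' = e" unfolding e'_def by simp
      then have "norm c * (2 * e') = e - 2 * e'" by (simp add: algebra_simps)
      then show ?thesis using e' by (intro ennreal_leI) simp
    qed
    finally show "(\<integral>\<^sup>+x. ennreal (norm (indicator A (x - z) *\<^sub>R c - indicator A x *\<^sub>R c)) \<partial>lborel) \<le> ennreal e" .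
  qed
next
  case (add f g)
  then have e2: "e/2 > 0" by simp
  obtain \<delta>1 where d1: "\<delta>1 > 0" "\<And>z. norm z < \<delta>1 \<Longrightarrow> (\<integral>\<^sup>+x. ennreal (norm (f (x - z) - f x)) \<partial>lborel) \<le> ennreal (e/2)"
    using add.IH(1)[OF e2] by blast
  obtain \<delta>2 where d2: "\<delta>2 > 0" "\<And>z. norm z < \<delta>2 \<Longrightarrow> (\<integral>\<^sup>+x. ennreal (norm (g (x - z) - g x)) \<partial>lborel) \<le> ennreal (e/2)"
    using add.IH(2)[OF e2] by blast
  have [measurable]: "f \<in> borel_measurable borel" "g \<in> borel_measurable borel"
    using add.hyps by auto
  show ?case
  proof (intro exI[of _ "min \<delta>1 \<delta>2"] conjI allI impI)
    fix z :: 'a assume z: "norm z < min \<delta>1 \<delta>2"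
    have "(\<integral>\<^sup>+x. ennreal (norm (f (x - z) + g (x - z) - (f x + g x))) \<partial>lborel)
      \<le> (\<integral>\<^sup>+x. ennreal (norm (f (x - z) - f x)) + ennreal (norm (g (x - z) - g x)) \<partial>lborel)"
      by (intro nn_integral_mono)
        (simp flip: ennreal_plus add: ennreal_leI norm_diff_triangle_ineq)
    also have "\<dots> = (\<integral>\<^sup>+x. ennreal (norm (f (x - z) - f x)) \<partial>lborel) + (\<integral>\<^sup>+x. ennreal (norm (g (x - z) - g x)) \<partial>lborel)"
      by (rule nn_integral_add) auto
    also have "\<dots> \<le> ennreal (e/2) + ennreal (e/2)"
      using z by (intro add_mono d1 d2) auto
    also have "\<dots> = ennreal e" using e2 by (simp flip: ennreal_plus)
    finally show "(\<integral>\<^sup>+x. ennreal (norm (f (x - z) + g (x - z) - (f x + g x))) \<partial>lborel) \<le> ennreal e" .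
  qed (use d1 d2 in auto)
next
  case (lim f s)
  have [measurable]: "f \<in> borel_measurable borel" "\<And>i. s i \<in> borel_measurable borel"
    using lim.hyps by auto
  have "(\<lambda>i. \<integral>\<^sup>+x. ennreal (norm (f x - s i x)) \<partial>lborel) \<longlonglongrightarrow> 0"
  proof (rule nn_integral_dominated_convergence_norm[where w="\<lambda>x. 2 * norm (f x)"])
    have "integrable lborel (\<lambda>x. 2 * norm (f x))" using lim.hyps by auto
    then show "(\<integral>\<^sup>+ x. ennreal (2 * norm (f x)) \<partial>lborel) < \<infinity>"
      unfolding integrable_iff_bounded by simp
  qed (use lim.hyps in auto)
  moreover have e3: "e/3 > 0" using lim.prems by simp
  ultimately obtain i where i: "(\<integral>\<^sup>+x. ennreal (norm (f x - s i x)) \<partial>lborel) < ennreal (e/3)"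
    using order_tendstoD(2)[of _ 0 sequentially "ennreal (e/3)"] by (auto simp: eventually_sequentially)
  obtain \<delta> where d: "\<delta> > 0" "\<And>z. norm z < \<delta> \<Longrightarrow> (\<integral>\<^sup>+x. ennreal (norm (s i (x - z) - s i x)) \<partial>lborel) \<le> ennreal (e/3)"
    using lim.IH[OF e3] by blast
  show ?case
  proof (intro exI[of _ \<delta>] conjI allI impI)
    fix z :: 'a assume z: "norm z < \<delta>"
    let ?h = "\<lambda>x. ennreal (norm (f x - s i x))"
    have "(\<integral>\<^sup>+x. ennreal (norm (f (x - z) - f x)) \<partial>lborel)
      \<le> (\<integral>\<^sup>+x. ?h (x - z) + (ennreal (norm (s i (x - z) - s i x)) + ?h x) \<partial>lborel)"
    proof (intro nn_integral_mono)
      fix x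
      have "norm (f (x - z) - f x) \<le> norm (f (x - z) - s i (x - z)) + (norm (s i (x - z) - s i x) + norm (f x - s i x))"
      proof -
        have "f (x - z) - f x = (f (x - z) - s i (x - z)) + ((s i (x - z) - s i x) - (f x - s i x))" by simp
        also have "norm \<dots> \<le> norm (f (x - z) - s i (x - z)) + norm ((s i (x - z) - s i x) - (f x - s i x))"
          by (rule norm_triangle_ineq)
        finally show ?thesis
          using norm_triangle_ineq4[of "s i (x - z) - s i x" "f x - s i x"] by linarith
      qed
      then show "ennreal (norm (f (x - z) - f x)) \<le> ?h (x - z) + (ennreal (norm (s i (x - z) - s i x)) + ?h x)"
        by (simp flip: ennreal_plus add: ennreal_leI)
    qed
    also have "\<dots> = (\<integral>\<^sup>+x. ?h (x - z) \<partial>lborel) + ((\<integral>\<^sup>+x. ennreal (norm (s i (x - z) - s i x)) \<partial>lborel) + (\<integral>\<^sup>+x. ?h x \<partial>lborel))"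
      by (simp add: nn_integral_add)
    also have "(\<integral>\<^sup>+x. ?h (x - z) \<partial>lborel) = (\<integral>\<^sup>+x. ?h x \<partial>lborel)"
      by (rule nn_integral_lborel_translate) auto
    also have "\<dots> + ((\<integral>\<^sup>+x. ennreal (norm (s i (x - z) - s i x)) \<partial>lborel) + (\<integral>\<^sup>+x. ?h x \<partial>lborel))
       \<le> ennreal (e/3) + (ennreal (e/3) + ennreal (e/3))"
      using z i by (intro add_mono d) auto
    also have "\<dots> = ennreal e" using e3 by (simp flip: ennreal_plus)
    finally show "(\<integral>\<^sup>+x. ennreal (norm (f (x - z) - f x)) \<partial>lborel) \<le> ennreal e" .
  qed (rule d)
qed

definition mollify :: "real \<Rightarrow> ('a::euclidean_space \<Rightarrow> 'b::euclidean_space) \<Rightarrow> 'a \<Rightarrow> 'b" where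
  "mollify r F x = (LINT y|lborel. moll r (x - y) *\<^sub>R F y)"

lemma moll_measurable [measurable]: "moll r \<in> borel_measurable borel"
  using moll_continuous by (rule borel_measurable_continuous_onI)

lemma moll_grad_measurable [measurable]: "moll_grad r \<in> borel_measurable borel"
  using moll_grad_continuous by (rule borel_measurable_continuous_onI)

lemma moll_scaleR_integrable:
  fixes F :: "'a::euclidean_space \<Rightarrow> 'b::euclidean_space"
  assumes "integrable lborel F" "0 \<le> r"
  shows "integrable lborel (\<lambda>y. moll r (x - y) *\<^sub>R F y)"
proof -
  obtain B where B: "B > 0" "\<And>z::'a. \<bar>moll r z\<bar> \<le> B" using moll_bounded[OF assms(2)] by blast
  have [measurable]: "F \<in> borel_measurable borel" using assms by auto
  show ?thesis
    by (rule Bochner_Integration.integrable_bound[of lborel "\<lambda>y. B * norm (F y)"])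
      (use assms B in \<open>auto intro!: mult_right_mono\<close>)
qed

lemma mollify_continuous:
  fixes F :: "'a::euclidean_space \<Rightarrow> 'b::euclidean_space"
  assumes "integrable lborel F" "0 \<le> r"
  shows "continuous_on UNIV (mollify r F)"
proof (rule continuous_at_imp_continuous_on, safe)
  fix x :: 'a
  obtain B where B: "B > 0" "\<And>z::'a. \<bar>moll r z\<bar> \<le> B" using moll_bounded[OF assms(2)] by blast
  have [measurable]: "F \<in> borel_measurable borel" using assms by auto
  show "isCont (mollify r F) x"
    unfolding continuous_at_sequentially comp_def mollify_def
  proof safe
    fix X :: "nat \<Rightarrow> 'a" assume X: "X \<longlonglongrightarrow> x"
    show "(\<lambda>n. LINT y|lborel. moll r (X n - y) *\<^sub>R F y) \<longlonglongrightarrow> (LINT y|lborel. moll r (x - y) *\<^sub>R F y)"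
    proof (rule integral_dominated_convergence[where w="\<lambda>y. B * norm (F y)"])
      show "AE y in lborel. (\<lambda>n. moll r (X n - y) *\<^sub>R F y) \<longlonglongrightarrow> moll r (x - y) *\<^sub>R F y"
      proof (intro AE_I2 tendsto_scaleR tendsto_const)
        fix y
        have "isCont (moll r) (x - y)"
          using moll_continuous[of r, where 'a='a] by (simp add: continuous_on_eq_continuous_at)
        then show "(\<lambda>n. moll r (X n - y)) \<longlonglongrightarrow> moll r (x - y)"
          by (rule isCont_tendsto_compose) (intro tendsto_diff X tendsto_const)
      qed
    qed (use assms B in \<open>auto intro!: mult_right_mono\<close>)
  qed
qed

lemma moll_Lipschitz:
  assumes "0 \<le> r" shows "\<exists>B>0. \<forall>x y::'a::euclidean_space. \<bar>moll r x - moll r y\<bar> \<le> B * norm (x - y)"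
proof -
  obtain B where B: "B > 0" "\<And>z::'a. norm (moll_grad r z) \<le> B" using moll_grad_bounded[OF assms] by blast
  have "norm (moll r x - moll r y) \<le> B * norm (x - y)" for x y :: 'a
  proof (rule differentiable_bound[of UNIV "moll r" "\<lambda>z h. h \<bullet> moll_grad r z"])
    fix z :: 'a
    show "(moll r has_derivative (\<lambda>h. h \<bullet> moll_grad r z)) (at z)"
      using moll_has_grad[of r z] by (simp add: gderiv_def)
    show "onorm (\<lambda>h. h \<bullet> moll_grad r z) \<le> B"
    proof (rule onorm_le)
      fix h
      have "norm (h \<bullet> moll_grad r z) \<le> norm h * norm (moll_grad r z)" using Cauchy_Schwarz_ineq2[of h "moll_grad r z"] by simp
      also have "\<dots> \<le> norm h * B" by (intro mult_left_mono B) auto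
      finally show "norm (h \<bullet> moll_grad r z) \<le> B * norm h" by (simp add: mult.commute)
    qed
  qed auto
  with B show ?thesis by auto
qed

text \<open>
  Differentiation under the integral sign: the difference quotients are dominated because the
  mollifier is Lipschitz.  Derivatives along lines are what the comparison along segments needs.
\<close>

lemma mollify_line_derivative:
  fixes g :: "'a::euclidean_space \<Rightarrow> real"
  assumes g: "integrable lborel g" and r: "0 \<le> r"
  shows "((\<lambda>s. mollify r g (x + s *\<^sub>R v)) has_real_derivative
     (LINT y|lborel. (v \<bullet> moll_grad r (x + s *\<^sub>R v - y)) * g y)) (at s)"
proof -
  obtain B where B: "B > 0" "\<And>x y::'a. \<bar>moll r x - moll r y\<bar> \<le> B * norm (x - y)" using moll_Lipschitz[OF r] by blast
  have [measurable]: "g \<in> borel_measurable borel" using g by auto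
  let ?p = "x + s *\<^sub>R v"
  have line: "((\<lambda>h. (moll r (?p + h *\<^sub>R v - y) - moll r (?p - y)) / h) \<longlongrightarrow> v \<bullet> moll_grad r (?p - y)) (at 0)" for y
  proof -
    have "((\<lambda>h. ?p + h *\<^sub>R v - y) has_derivative (\<lambda>h. h *\<^sub>R v)) (at 0)"
      by (auto intro!: derivative_eq_intros)
    moreover have "(moll r has_derivative (\<lambda>h. h \<bullet> moll_grad r (?p - y))) (at (?p + 0 *\<^sub>R v - y))"
      using moll_has_grad[of r "?p - y"] by (simp add: gderiv_def)
    ultimately have "((\<lambda>h. moll r (?p + h *\<^sub>R v - y)) has_derivative (\<lambda>h. (h *\<^sub>R v) \<bullet> moll_grad r (?p - y))) (at 0)"
      using has_derivative_compose[of "\<lambda>h. ?p + h *\<^sub>R v - y" "\<lambda>h. h *\<^sub>R v" 0 UNIV "moll r" "\<lambda>h. h \<bullet> moll_grad r (?p - y)"] by blast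
    then have "((\<lambda>h. moll r (?p + h *\<^sub>R v - y)) has_real_derivative (v \<bullet> moll_grad r (?p - y))) (at 0)"
      unfolding has_field_derivative_def
      by (rule has_derivative_eq_rhs) (simp add: fun_eq_iff)
    then show ?thesis by (simp add: DERIV_def)
  qed
  show ?thesis
    unfolding DERIV_def tendsto_at_iff_sequentially comp_def
  proof safe
    fix h :: "nat \<Rightarrow> real" assume h: "\<forall>i. h i \<in> UNIV - {0}" "h \<longlonglongrightarrow> 0"
    have eq: "(mollify r g (x + (s + h n) *\<^sub>R v) - mollify r g ?p) / h n
       = (LINT y|lborel. ((moll r (?p + h n *\<^sub>R v - y) - moll r (?p - y)) / h n) * g y)" for n
    proof -
      have "(LINT y|lborel. ((moll r (?p + h n *\<^sub>R v - y) - moll r (?p - y)) / h n) * g y)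
        = (LINT y|lborel. (moll r (?p + h n *\<^sub>R v - y) *\<^sub>R g y - moll r (?p - y) *\<^sub>R g y) / h n)"
        by (intro Bochner_Integration.integral_cong) (auto simp: field_simps)
      also have "\<dots> = (mollify r g (?p + h n *\<^sub>R v) - mollify r g ?p) / h n"
        unfolding mollify_def
        using Bochner_Integration.integral_diff[OF moll_scaleR_integrable[OF g r] moll_scaleR_integrable[OF g r],
          of "?p + h n *\<^sub>R v" "?p"] by simp
      finally have "(mollify r g (?p + h n *\<^sub>R v) - mollify r g ?p) / h n
        = (LINT y|lborel. ((moll r (?p + h n *\<^sub>R v - y) - moll r (?p - y)) / h n) * g y)" by (rule sym)
      then show ?thesis by (simp only: scaleR_add_left add.assoc)
    qed
    show "(\<lambda>n. (mollify r g (x + (s + h n) *\<^sub>R v) - mollify r g (x + s *\<^sub>R v)) / h n)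
      \<longlonglongrightarrow> (LINT y|lborel. (v \<bullet> moll_grad r (x + s *\<^sub>R v - y)) * g y)"
      unfolding eq
    proof (rule integral_dominated_convergence[where w="\<lambda>y. B * norm v * \<bar>g y\<bar>"])
      show "AE y in lborel. (\<lambda>n. (moll r (?p + h n *\<^sub>R v - y) - moll r (?p - y)) / h n * g y)
         \<longlonglongrightarrow> (v \<bullet> moll_grad r (?p - y)) * g y"
      proof (intro AE_I2 tendsto_mult tendsto_const)
        fix y
        have "((\<lambda>h. (moll r (?p + h *\<^sub>R v - y) - moll r (?p - y)) / h) \<circ> h) \<longlonglongrightarrow> v \<bullet> moll_grad r (?p - y)"
          using line[of y, unfolded tendsto_at_iff_sequentially, rule_format, of h] h by simp
        then show "(\<lambda>n. (moll r (?p + h n *\<^sub>R v - y) - moll r (?p - y)) / h n) \<longlonglongrightarrow> v \<bullet> moll_grad r (?p - y)"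
          by (simp add: comp_def)
      qed
      show "AE y in lborel. norm ((moll r (?p + h n *\<^sub>R v - y) - moll r (?p - y)) / h n * g y) \<le> B * norm v * \<bar>g y\<bar>" for n
      proof (intro AE_I2)
        fix y
        have "\<bar>moll r (?p + h n *\<^sub>R v - y) - moll r (?p - y)\<bar> \<le> B * norm (?p + h n *\<^sub>R v - y - (?p - y))"
          by (rule B)
        also have "?p + h n *\<^sub>R v - y - (?p - y) = h n *\<^sub>R v" by simp
        also have "B * norm (h n *\<^sub>R v) = B * (\<bar>h n\<bar> * norm v)" by simp
        finally have "\<bar>moll r (?p + h n *\<^sub>R v - y) - moll r (?p - y)\<bar> \<le> B * norm v * \<bar>h n\<bar>"
          by (simp add: ac_simps)
        moreover have "\<bar>h n\<bar> > 0" using h(1) by auto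
        ultimately have "\<bar>moll r (?p + h n *\<^sub>R v - y) - moll r (?p - y)\<bar> / \<bar>h n\<bar> \<le> B * norm v"
          by (subst pos_divide_le_eq)
        from mult_right_mono[OF this, of "\<bar>g y\<bar>"]
        show "norm ((moll r (?p + h n *\<^sub>R v - y) - moll r (?p - y)) / h n * g y) \<le> B * norm v * \<bar>g y\<bar>"
          by (simp only: real_norm_def abs_mult abs_divide abs_ge_zero)
      qed
    qed (use g in auto)
  qed
qed

text \<open>
  The difference is an average of \<open>F (x - z) - F x\<close> over \<open>norm z < r\<close>, so continuity of translations in
  \<open>L\<^sup>1\<close> and Fubini give the claim.
\<close>

lemma mollify_L1_convergence:
  fixes F :: "'a::euclidean_space \<Rightarrow> 'b::euclidean_space"
  assumes F: "integrable lborel F" and e: "e > (0::real)"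
  shows "\<exists>\<delta>>0. \<forall>r. 0 < r \<and> r < \<delta> \<longrightarrow> (\<integral>\<^sup>+x. ennreal (norm (mollify r F x - F x)) \<partial>lborel) \<le> ennreal e"
proof -
  obtain \<delta> where d: "\<delta> > 0" "\<And>z. norm z < \<delta> \<Longrightarrow> (\<integral>\<^sup>+x. ennreal (norm (F (x - z) - F x)) \<partial>lborel) \<le> ennreal e"
    using translation_L1_continuous[OF F e] by blast
  have [measurable]: "F \<in> borel_measurable borel" using F by auto
  have "(\<integral>\<^sup>+x. ennreal (norm (mollify r F x - F x)) \<partial>lborel) \<le> ennreal e" if r: "0 < r" "r < \<delta>" for r
  proof -
    have pw: "ennreal (norm (mollify r F x - F x)) \<le> (\<integral>\<^sup>+z. ennreal (moll r z) * ennreal (norm (F (x - z) - F x)) \<partial>lborel)" for x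
    proof -
      have i: "integrable lborel (\<lambda>z. moll r z *\<^sub>R F (x - z))"
      proof -
        have "integrable (distr lborel borel (\<lambda>y. x - y)) (\<lambda>y. moll r (x - y) *\<^sub>R F y)"
          using moll_scaleR_integrable[OF F, of r x] r by (simp add: lborel_distr_reflect)
        then show ?thesis by (subst (asm) integrable_distr_eq) auto
      qed
      have i2: "integrable lborel (\<lambda>z::'a. moll r z *\<^sub>R F x)"
        using moll_integrable[of r] r by auto
      have "mollify r F x = (LINT z|lborel. moll r z *\<^sub>R F (x - z))"
        unfolding mollify_def
        by (subst integral_lborel_reflect[of "\<lambda>y. moll r (x - y) *\<^sub>R F y" x, symmetric]) auto
      moreover have "(LINT z|lborel. moll r (z::'a) *\<^sub>R F x) = F x"
        using moll_integral[OF r(1), where 'a='a] moll_integrable[of r, where 'a='a] r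
        by (subst integral_scaleR_left) auto
      ultimately have "mollify r F x - F x = (LINT z|lborel. moll r z *\<^sub>R (F (x - z) - F x))"
        using i i2 by (simp add: scaleR_diff_right Bochner_Integration.integral_diff)
      moreover have "ennreal (norm (LINT z|lborel. moll r z *\<^sub>R (F (x - z) - F x)))
          \<le> (\<integral>\<^sup>+z. ennreal (norm (moll r z *\<^sub>R (F (x - z) - F x))) \<partial>lborel)"
        using i i2 by (intro integral_norm_bound_ennreal) (simp add: scaleR_diff_right)
      ultimately show ?thesis
        using moll_nonneg[OF r(1), where 'a='a] by (simp add: ennreal_mult')
    qed
    have "(\<integral>\<^sup>+x. ennreal (norm (mollify r F x - F x)) \<partial>lborel)
       \<le> (\<integral>\<^sup>+x. \<integral>\<^sup>+z. ennreal (moll r z) * ennreal (norm (F (x - z) - F x)) \<partial>lborel \<partial>lborel)"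
      by (intro nn_integral_mono pw)
    also have "\<dots> = (\<integral>\<^sup>+z. \<integral>\<^sup>+x. ennreal (moll r z) * ennreal (norm (F (x - z) - F x)) \<partial>lborel \<partial>lborel)"
      by (rule lborel_pair.Fubini') measurable
    also have "\<dots> = (\<integral>\<^sup>+z. ennreal (moll r z) * (\<integral>\<^sup>+x. ennreal (norm (F (x - z) - F x)) \<partial>lborel) \<partial>lborel)"
      by (intro nn_integral_cong nn_integral_cmult) auto
    also have "\<dots> \<le> (\<integral>\<^sup>+z. ennreal (moll r (z::'a)) * ennreal e \<partial>lborel)"
    proof (intro nn_integral_mono)
      fix z :: 'a
      show "ennreal (moll r z) * (\<integral>\<^sup>+x. ennreal (norm (F (x - z) - F x)) \<partial>lborel) \<le> ennreal (moll r z) * ennreal e"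
        using d(2)[of z] r moll_eq_0[of r z] by (cases "norm z < r") (auto intro!: mult_left_mono)
    qed
    also have "\<dots> = (\<integral>\<^sup>+z. ennreal (moll r (z::'a)) \<partial>lborel) * ennreal e"
      by (rule nn_integral_multc) auto
    also have "(\<integral>\<^sup>+z. ennreal (moll r (z::'a)) \<partial>lborel) = 1"
      using moll_integrable[of r] moll_integral[OF r(1), where 'a='a] moll_nonneg[OF r(1), where 'a='a] r
      by (subst nn_integral_eq_integral) auto
    finally show ?thesis by simp
  qed
  with d show ?thesis by blast
qed

text \<open>
  A function and its gradient are mollified with the same radii, hence the two functions.
\<close>

lemma mollify_AE_subsequence:
  fixes F :: "'a::euclidean_space \<Rightarrow> 'b::euclidean_space" and G :: "'a \<Rightarrow> 'c::euclidean_space"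
  assumes F: "integrable lborel F" and G: "integrable lborel G" and \<epsilon>: "0 < \<epsilon>"
  obtains r \<delta> where "\<And>n. 0 < r n" "\<And>n. r n < \<epsilon>" "r \<longlonglongrightarrow> 0" "\<delta> \<longlonglongrightarrow> 0"
    "\<And>n. (\<integral>\<^sup>+x. ennreal (norm (mollify (r n) F x - F x)) \<partial>lborel) \<le> ennreal (\<delta> n)"
    "\<And>n. (\<integral>\<^sup>+x. ennreal (norm (mollify (r n) G x - G x)) \<partial>lborel) \<le> ennreal (\<delta> n)"
    "AE x in lborel. (\<lambda>n. mollify (r n) F x) \<longlonglongrightarrow> F x"
proof -
  have [measurable]: "F \<in> borel_measurable borel" using F by auto
  define p where "p n = 1 / (real n + 1)" for n
  have p: "0 < p n" for n by (simp add: p_def)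
  have p0: "p \<longlonglongrightarrow> 0" using LIMSEQ_inverse_real_of_nat by (simp add: p_def[abs_def] inverse_eq_divide add.commute)
  have "\<exists>r. 0 < r \<and> r < \<epsilon> \<and> r < p n \<and> (\<integral>\<^sup>+x. ennreal (norm (mollify r F x - F x)) \<partial>lborel) \<le> ennreal (p n)
     \<and> (\<integral>\<^sup>+x. ennreal (norm (mollify r G x - G x)) \<partial>lborel) \<le> ennreal (p n)" for n
  proof -
    obtain d1 where d1: "d1 > 0" "\<And>r. 0 < r \<and> r < d1 \<Longrightarrow> (\<integral>\<^sup>+x. ennreal (norm (mollify r F x - F x)) \<partial>lborel) \<le> ennreal (p n)"
      using mollify_L1_convergence[OF F p] by blast
    obtain d2 where d2: "d2 > 0" "\<And>r. 0 < r \<and> r < d2 \<Longrightarrow> (\<integral>\<^sup>+x. ennreal (norm (mollify r G x - G x)) \<partial>lborel) \<le> ennreal (p n)"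
      using mollify_L1_convergence[OF G p] by blast
    define r where "r = min (min \<epsilon> (p n)) (min d1 d2) / 2"
    have "0 < r" "r < \<epsilon>" "r < p n" "r < d1" "r < d2" using \<epsilon> p[of n] d1(1) d2(1) by (auto simp: r_def min_def)
    then show ?thesis using d1(2)[of r] d2(2)[of r] by (intro exI[of _ r]) simp
  qed
  then have "\<forall>n. \<exists>r. 0 < r \<and> r < \<epsilon> \<and> r < p n \<and> (\<integral>\<^sup>+x. ennreal (norm (mollify r F x - F x)) \<partial>lborel) \<le> ennreal (p n)
     \<and> (\<integral>\<^sup>+x. ennreal (norm (mollify r G x - G x)) \<partial>lborel) \<le> ennreal (p n)" ..
  from choice[OF this] obtain r0 where r0: "\<And>n. 0 < r0 n" "\<And>n. r0 n < \<epsilon>" "\<And>n. r0 n < p n"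
    "\<And>n. (\<integral>\<^sup>+x. ennreal (norm (mollify (r0 n) F x - F x)) \<partial>lborel) \<le> ennreal (p n)"
    "\<And>n. (\<integral>\<^sup>+x. ennreal (norm (mollify (r0 n) G x - G x)) \<partial>lborel) \<le> ennreal (p n)" by blast
  have mc: "mollify (r0 n) F \<in> borel_measurable borel" for n
    using mollify_continuous[OF F, of "r0 n"] r0(1)[of n] by (auto intro!: borel_measurable_continuous_onI)
  have ui: "integrable lborel (\<lambda>x. mollify (r0 n) F x - F x)" for n
    unfolding integrable_iff_bounded using r0(4)[of n] mc[of n] by (auto intro: order_le_less_trans)
  have "(\<lambda>n. LINT x|lborel. norm (mollify (r0 n) F x - F x)) \<longlonglongrightarrow> 0"
  proof (rule tendsto_sandwich[OF _ _ tendsto_const p0])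
    have "(LINT x|lborel. norm (mollify (r0 n) F x - F x)) \<le> p n" for n
    proof -
      have "ennreal (LINT x|lborel. norm (mollify (r0 n) F x - F x)) = (\<integral>\<^sup>+x. ennreal (norm (mollify (r0 n) F x - F x)) \<partial>lborel)"
        using ui[of n] by (intro nn_integral_eq_integral[symmetric]) auto
      also have "\<dots> \<le> ennreal (p n)" by (rule r0)
      finally show ?thesis using p[of n] by (subst (asm) ennreal_le_iff) auto
    qed
    then show "\<forall>\<^sub>F n in sequentially. (LINT x|lborel. norm (mollify (r0 n) F x - F x)) \<le> p n" by simp
  qed auto
  then obtain \<sigma> where \<sigma>: "strict_mono \<sigma>" "AE x in lborel. (\<lambda>n. mollify (r0 (\<sigma> n)) F x - F x) \<longlonglongrightarrow> 0"
    using tendsto_L1_AE_subseq[of lborel "\<lambda>n x. mollify (r0 n) F x - F x"] ui by blast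
  show ?thesis
  proof (rule that[of "\<lambda>n. r0 (\<sigma> n)" "\<lambda>n. p (\<sigma> n)"])
    have "r0 \<longlonglongrightarrow> 0"
      by (rule tendsto_sandwich[OF _ _ tendsto_const p0]) (use r0(1,3) in \<open>auto intro!: always_eventually less_imp_le\<close>)
    from LIMSEQ_subseq_LIMSEQ[OF this \<sigma>(1)] show "(\<lambda>n. r0 (\<sigma> n)) \<longlonglongrightarrow> 0" by (simp add: comp_def)
    from LIMSEQ_subseq_LIMSEQ[OF p0 \<sigma>(1)] show "(\<lambda>n. p (\<sigma> n)) \<longlonglongrightarrow> 0" by (simp add: comp_def)
    show "AE x in lborel. (\<lambda>n. mollify (r0 (\<sigma> n)) F x) \<longlonglongrightarrow> F x"
      using \<sigma>(2) by eventually_elim (simp add: LIM_zero_iff)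
  qed (rule r0)+
qed

section \<open>Chains of segments in a domain\<close>

text \<open>
  The integral of \<open>\<bar>h x - h y\<bar>\<close> over \<open>X \<times> Y\<close>.  As a measure of the product set it is monotone, subadditive
  and continuous along increasing sequences of sets.
\<close>

definition osc :: "('a::euclidean_space \<Rightarrow> real) \<Rightarrow> 'a set \<Rightarrow> 'a set \<Rightarrow> ennreal" where
  "osc h X Y = emeasure (density lborel (\<lambda>z. ennreal \<bar>h (fst z) - h (snd z)\<bar>)) (X \<times> Y)"

lemma osc_mono:
  fixes h :: "'a::euclidean_space \<Rightarrow> real"
  shows "X \<subseteq> X' \<Longrightarrow> Y \<subseteq> Y' \<Longrightarrow> X' \<in> sets borel \<Longrightarrow> Y' \<in> sets borel \<Longrightarrow> osc h X Y \<le> osc h X' Y'"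
  unfolding osc_def by (rule emeasure_mono) (auto simp: borel_prod[symmetric] sets_lborel)

lemma osc_Un:
  fixes h :: "'a::euclidean_space \<Rightarrow> real"
  shows "X \<in> sets borel \<Longrightarrow> X' \<in> sets borel \<Longrightarrow> Y \<in> sets borel \<Longrightarrow> osc h (X \<union> X') Y \<le> osc h X Y + osc h X' Y"
  unfolding osc_def Sigma_Un_distrib1
  by (rule emeasure_subadditive) (auto simp: borel_prod[symmetric] sets_lborel)

lemma osc_iterated:
  fixes h :: "'a::euclidean_space \<Rightarrow> real"
  assumes [measurable]: "h \<in> borel_measurable borel" "X \<in> sets borel" "Y \<in> sets borel"
  shows "osc h X Y = (\<integral>\<^sup>+x. indicator X x * (\<integral>\<^sup>+y. indicator Y y * ennreal \<bar>h x - h y\<bar> \<partial>lborel) \<partial>lborel)"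
proof -
  have XY: "X \<times> Y \<in> sets (borel :: ('a \<times> 'a) measure)"
    by (simp add: borel_prod[symmetric])
  have "osc h X Y = (\<integral>\<^sup>+z. ennreal \<bar>h (fst z) - h (snd z)\<bar> * indicator (X \<times> Y) z \<partial>(lborel :: ('a \<times> 'a) measure))"
    unfolding osc_def using XY by (subst emeasure_density) (auto simp: borel_prod[symmetric])
  also have "\<dots> = (\<integral>\<^sup>+z. ennreal \<bar>h (fst z) - h (snd z)\<bar> * indicator (X \<times> Y) z \<partial>(lborel \<Otimes>\<^sub>M lborel))"
    by (simp add: lborel_prod)
  also have "\<dots> = (\<integral>\<^sup>+x. \<integral>\<^sup>+y. ennreal \<bar>h x - h y\<bar> * indicator (X \<times> Y) (x, y) \<partial>lborel \<partial>lborel)"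
    by (subst lborel.nn_integral_fst[symmetric]) auto
  also have "\<dots> = (\<integral>\<^sup>+x. indicator X x * (\<integral>\<^sup>+y. indicator Y y * ennreal \<bar>h x - h y\<bar> \<partial>lborel) \<partial>lborel)"
    by (subst nn_integral_cmult[symmetric])
      (auto simp: indicator_times ac_simps intro!: nn_integral_cong)
  finally show ?thesis .
qed

lemma osc_sym:
  fixes h :: "'a::euclidean_space \<Rightarrow> real"
  assumes [measurable]: "h \<in> borel_measurable borel" "X \<in> sets borel" "Y \<in> sets borel"
  shows "osc h X Y = osc h Y X"
proof -
  have "osc h X Y = (\<integral>\<^sup>+x. \<integral>\<^sup>+y. indicator X x * (indicator Y y * ennreal \<bar>h x - h y\<bar>) \<partial>lborel \<partial>lborel)"
    by (simp add: osc_iterated nn_integral_cmult)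
  also have "\<dots> = (\<integral>\<^sup>+y. \<integral>\<^sup>+x. indicator X x * (indicator Y y * ennreal \<bar>h x - h y\<bar>) \<partial>lborel \<partial>lborel)"
    by (rule lborel_pair.Fubini') measurable
  also have "\<dots> = (\<integral>\<^sup>+y. \<integral>\<^sup>+x. indicator Y y * (indicator X x * ennreal \<bar>h y - h x\<bar>) \<partial>lborel \<partial>lborel)"
    by (simp add: ac_simps abs_minus_commute)
  also have "\<dots> = osc h Y X"
    by (simp add: osc_iterated nn_integral_cmult)
  finally show ?thesis .
qed

text \<open>
  The triangle inequality through an intermediate point, integrated over \<open>X \<times> Y \<times> Z\<close>.
\<close>

lemma osc_trans:
  fixes h :: "'a::euclidean_space \<Rightarrow> real"
  assumes [measurable]: "h \<in> borel_measurable borel" "X \<in> sets borel" "Y \<in> sets borel" "Z \<in> sets borel"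
  shows "emeasure lborel Y * osc h X Z \<le> emeasure lborel Z * osc h X Y + emeasure lborel X * osc h Y Z"
proof -
  let ?d = "\<lambda>x y. ennreal \<bar>h x - h y\<bar>"
  let ?i = "\<lambda>A x. indicator A x :: ennreal"
  have "emeasure lborel Y * osc h X Z
     = (\<integral>\<^sup>+x. \<integral>\<^sup>+z. \<integral>\<^sup>+y. ?i X x * (?i Z z * (?i Y y * ?d x z)) \<partial>lborel \<partial>lborel \<partial>lborel)"
  proof -
    have "(\<integral>\<^sup>+y. ?i X x * (?i Z z * (?i Y y * ?d x z)) \<partial>lborel) = emeasure lborel Y * (?i X x * (?i Z z * ?d x z))" for x z
    proof -
      have "(\<integral>\<^sup>+y. ?i X x * (?i Z z * (?i Y y * ?d x z)) \<partial>lborel) = (\<integral>\<^sup>+y. (?i X x * (?i Z z * ?d x z)) * ?i Y y \<partial>lborel)"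
        by (intro nn_integral_cong) (simp add: ac_simps)
      also have "\<dots> = (?i X x * (?i Z z * ?d x z)) * emeasure lborel Y"
        by (rule nn_integral_cmult_indicator) simp
      finally show ?thesis by (simp add: ac_simps)
    qed
    then show ?thesis by (simp add: osc_iterated nn_integral_cmult)
  qed
  also have "\<dots> \<le> (\<integral>\<^sup>+x. \<integral>\<^sup>+z. \<integral>\<^sup>+y. ?i X x * (?i Z z * (?i Y y * ?d x y)) + ?i X x * (?i Z z * (?i Y y * ?d y z)) \<partial>lborel \<partial>lborel \<partial>lborel)"
  proof (intro nn_integral_mono)
    fix x y z
    have "?d x z \<le> ?d x y + ?d y z"
      by (simp flip: ennreal_plus add: ennreal_leI)
    from mult_left_mono[OF this, of "?i X x * (?i Z z * ?i Y y)"]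
    show "?i X x * (?i Z z * (?i Y y * ?d x z)) \<le> ?i X x * (?i Z z * (?i Y y * ?d x y)) + ?i X x * (?i Z z * (?i Y y * ?d y z))"
      by (simp add: distrib_left ac_simps)
  qed
  also have "\<dots> = (\<integral>\<^sup>+x. \<integral>\<^sup>+z. \<integral>\<^sup>+y. ?i X x * (?i Z z * (?i Y y * ?d x y)) \<partial>lborel \<partial>lborel \<partial>lborel)
      + (\<integral>\<^sup>+x. \<integral>\<^sup>+z. \<integral>\<^sup>+y. ?i X x * (?i Z z * (?i Y y * ?d y z)) \<partial>lborel \<partial>lborel \<partial>lborel)"
    by (simp add: nn_integral_add)
  also have "(\<integral>\<^sup>+x. \<integral>\<^sup>+z. \<integral>\<^sup>+y. ?i X x * (?i Z z * (?i Y y * ?d x y)) \<partial>lborel \<partial>lborel \<partial>lborel) = emeasure lborel Z * osc h X Y"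
  proof -
    have "(\<integral>\<^sup>+z. \<integral>\<^sup>+y. ?i X x * (?i Z z * (?i Y y * ?d x y)) \<partial>lborel \<partial>lborel)
       = emeasure lborel Z * (?i X x * (\<integral>\<^sup>+y. ?i Y y * ?d x y \<partial>lborel))" for x
    proof -
      have "(\<integral>\<^sup>+z. \<integral>\<^sup>+y. ?i X x * (?i Z z * (?i Y y * ?d x y)) \<partial>lborel \<partial>lborel)
        = (\<integral>\<^sup>+z. ?i X x * (?i Z z * (\<integral>\<^sup>+y. ?i Y y * ?d x y \<partial>lborel)) \<partial>lborel)"
        by (intro nn_integral_cong) (simp add: nn_integral_cmult)
      also have "\<dots> = (\<integral>\<^sup>+z. (?i X x * (\<integral>\<^sup>+y. ?i Y y * ?d x y \<partial>lborel)) * ?i Z z \<partial>lborel)"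
        by (simp add: ac_simps)
      also have "\<dots> = (?i X x * (\<integral>\<^sup>+y. ?i Y y * ?d x y \<partial>lborel)) * emeasure lborel Z"
        by (rule nn_integral_cmult_indicator) simp
      finally show ?thesis by (simp add: ac_simps)
    qed
    then show ?thesis by (simp add: osc_iterated nn_integral_cmult)
  qed
  also have "(\<integral>\<^sup>+x. \<integral>\<^sup>+z. \<integral>\<^sup>+y. ?i X x * (?i Z z * (?i Y y * ?d y z)) \<partial>lborel \<partial>lborel \<partial>lborel) = emeasure lborel X * osc h Z Y"
  proof -
    have "(\<integral>\<^sup>+z. \<integral>\<^sup>+y. ?i X x * (?i Z z * (?i Y y * ?d y z)) \<partial>lborel \<partial>lborel) = osc h Z Y * ?i X x" for x
    proof -
      have "(\<integral>\<^sup>+z. \<integral>\<^sup>+y. ?i X x * (?i Z z * (?i Y y * ?d y z)) \<partial>lborel \<partial>lborel)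
        = (\<integral>\<^sup>+z. ?i X x * (?i Z z * (\<integral>\<^sup>+y. ?i Y y * ?d z y \<partial>lborel)) \<partial>lborel)"
        by (intro nn_integral_cong) (simp add: nn_integral_cmult abs_minus_commute)
      also have "\<dots> = ?i X x * osc h Z Y"
        by (simp add: osc_iterated nn_integral_cmult)
      finally show ?thesis by (simp add: ac_simps)
    qed
    then have "(\<integral>\<^sup>+x. \<integral>\<^sup>+z. \<integral>\<^sup>+y. ?i X x * (?i Z z * (?i Y y * ?d y z)) \<partial>lborel \<partial>lborel \<partial>lborel)
      = (\<integral>\<^sup>+x. osc h Z Y * ?i X x \<partial>lborel)" by simp
    also have "\<dots> = osc h Z Y * emeasure lborel X" by (rule nn_integral_cmult_indicator) simp
    finally show ?thesis by (simp only: mult.commute)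
  qed
  also have "osc h Z Y = osc h Y Z" by (rule osc_sym) auto
  finally show ?thesis .
qed

text \<open>
  For a function with an integrable gradient this holds with \<open>N\<close> a multiple of the \<open>L\<^sup>1\<close> norm of the
  gradient, and it is the only property of the function that the chaining argument uses.
\<close>

definition seg_bound :: "'a::euclidean_space set \<Rightarrow> ('a \<Rightarrow> real) \<Rightarrow> ennreal \<Rightarrow> bool" where
  "seg_bound \<Omega> h N \<longleftrightarrow> h \<in> borel_measurable borel \<and>
    (\<forall>X Y. open X \<and> open Y \<and> (\<forall>x\<in>X. \<forall>y\<in>Y. closed_segment x y \<subseteq> \<Omega>) \<longrightarrow> osc h X Y \<le> N)"

text \<open>
  A Poincare inequality between \<open>X\<close> and \<open>Y\<close>, with a constant that does not depend on the function.
\<close>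

definition linked :: "'a::euclidean_space set \<Rightarrow> 'a set \<Rightarrow> 'a set \<Rightarrow> bool" where
  "linked \<Omega> X Y \<longleftrightarrow> (\<exists>C\<ge>0. \<forall>h N. seg_bound \<Omega> h N \<longrightarrow> osc h X Y \<le> ennreal C * N)"

lemma linked_segments:
  "open X \<Longrightarrow> open Y \<Longrightarrow> (\<And>x y. x \<in> X \<Longrightarrow> y \<in> Y \<Longrightarrow> closed_segment x y \<subseteq> \<Omega>) \<Longrightarrow> linked \<Omega> X Y"
  unfolding linked_def seg_bound_def by (intro exI[of _ 1]) auto

lemma linked_subset:
  assumes "linked \<Omega> X Y" "X' \<subseteq> X" "X \<in> sets borel" "Y \<in> sets borel"
  shows "linked \<Omega> X' Y"
proof -
  obtain C where C: "C \<ge> 0" "\<And>h N. seg_bound \<Omega> h N \<Longrightarrow> osc h X Y \<le> ennreal C * N"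
    using assms unfolding linked_def by blast
  have "osc h X' Y \<le> ennreal C * N" if "seg_bound \<Omega> h N" for h N
    using order_trans[OF osc_mono[of X' X Y Y h] C(2)[OF that]] assms by simp
  with C show ?thesis unfolding linked_def by blast
qed

lemma linked_sym:
  assumes "linked \<Omega> X Y" "X \<in> sets borel" "Y \<in> sets borel"
  shows "linked \<Omega> Y X"
  using assms osc_sym[of _ X Y] unfolding linked_def seg_bound_def by auto

lemma linked_Un:
  assumes "linked \<Omega> X Y" "linked \<Omega> X' Y" "X \<in> sets borel" "X' \<in> sets borel" "Y \<in> sets borel"
  shows "linked \<Omega> (X \<union> X') Y"
proof -
  obtain C where C: "C \<ge> 0" "\<And>h N. seg_bound \<Omega> h N \<Longrightarrow> osc h X Y \<le> ennreal C * N"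
    using assms unfolding linked_def by blast
  obtain C' where C': "C' \<ge> 0" "\<And>h N. seg_bound \<Omega> h N \<Longrightarrow> osc h X' Y \<le> ennreal C' * N"
    using assms unfolding linked_def by blast
  have "osc h (X \<union> X') Y \<le> ennreal (C + C') * N" if "seg_bound \<Omega> h N" for h N
  proof -
    have "osc h (X \<union> X') Y \<le> osc h X Y + osc h X' Y" by (rule osc_Un) (use assms in auto)
    also have "\<dots> \<le> ennreal C * N + ennreal C' * N" by (intro add_mono C C' that)
    finally show ?thesis using C C' by (simp add: distrib_right ennreal_plus)
  qed
  with C C' show ?thesis unfolding linked_def by (intro exI[of _ "C + C'"]) auto
qed

text \<open>
  \<open>osc_trans\<close> divided by the measure of the intermediate set, which is positive since \<open>Y\<close> is open and
  nonempty.
\<close>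

lemma linked_trans:
  fixes \<Omega> :: "'a::euclidean_space set"
  assumes XY: "linked \<Omega> X Y" and YZ: "linked \<Omega> Y Z"
    and s: "X \<in> sets borel" "Y \<in> sets borel" "Z \<in> sets borel"
    and b: "bounded X" "bounded Y" "bounded Z" and Y: "open Y" "Y \<noteq> {}"
  shows "linked \<Omega> X Z"
proof -
  obtain C where C: "C \<ge> 0" "\<And>h N. seg_bound \<Omega> h N \<Longrightarrow> osc h X Y \<le> ennreal C * N"
    using assms unfolding linked_def by blast
  obtain C' where C': "C' \<ge> 0" "\<And>h N. seg_bound \<Omega> h N \<Longrightarrow> osc h Y Z \<le> ennreal C' * N"
    using assms unfolding linked_def by blast
  have e: "emeasure lborel A = ennreal (measure lborel A)" if "bounded A" for A :: "'a set"
    using emeasure_bounded_finite[OF that] by (intro emeasure_eq_ennreal_measure) auto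
  have Yp: "measure lborel Y > 0"
  proof -
    obtain y where "y \<in> Y" using Y by auto
    then obtain r where r: "r > 0" "ball y r \<subseteq> Y" using Y(1) open_contains_ball[of Y] by auto
    then have "measure lborel (ball y r) \<le> measure lborel Y"
      using emeasure_bounded_finite[OF b(2)] s by (intro measure_mono_fmeasurable) (auto simp: fmeasurable_def)
    with content_ball_pos[OF r(1), of y] show ?thesis by linarith
  qed
  define C'' where "C'' = (measure lborel Z * C + measure lborel X * C') / measure lborel Y"
  have C''0: "C'' \<ge> 0" unfolding C''_def using C C' Yp by (intro divide_nonneg_pos add_nonneg_nonneg mult_nonneg_nonneg) auto
  have "osc h X Z \<le> ennreal C'' * N" if h: "seg_bound \<Omega> h N" for h N
  proof -
    have "ennreal (measure lborel Y) * osc h X Z \<le> ennreal (measure lborel Z) * osc h X Y + ennreal (measure lborel X) * osc h Y Z"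
      using osc_trans[of h X Y Z] s h b by (simp add: seg_bound_def e)
    also have "\<dots> \<le> ennreal (measure lborel Z) * (ennreal C * N) + ennreal (measure lborel X) * (ennreal C' * N)"
      by (intro add_mono mult_left_mono C C' h) auto
    also have "\<dots> = ennreal (measure lborel Z * C + measure lborel X * C') * N"
      using C C' by (simp add: ennreal_mult ennreal_plus distrib_right mult.assoc)
    also have "measure lborel Z * C + measure lborel X * C' = measure lborel Y * C''"
      unfolding C''_def using Yp by simp
    also have "ennreal (measure lborel Y * C'') * N = ennreal (measure lborel Y) * (ennreal C'' * N)"
      using C''0 by (simp add: ennreal_mult mult.assoc)
    finally show ?thesis using Yp by (subst (asm) ennreal_mult_le_mult_iff) auto
  qed
  with C''0 show ?thesis unfolding linked_def by blast
qed

text \<open>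
  Near \<open>p\<close> the defining function \<open>\<psi>\<close> decreases in every direction close to \<open>- n\<close>, where \<open>n\<close> is the normalised
  gradient at \<open>p\<close>.  For \<open>q = p - \<rho> n\<close> and \<open>r\<close> much smaller than \<open>\<rho>\<close>, all vectors from \<open>ball p r\<close> to
  \<open>ball q r\<close> have such directions, so a segment that starts in \<open>\<Omega>\<close> stays in \<open>{\<psi> < 0}\<close>.
\<close>

lemma boundary_segments:
  fixes \<Omega> :: "'a::euclidean_space set"
  assumes V: "open V" "p \<in> V" and \<psi>: "Ck_upto (Suc (Suc k)) V V \<psi>"
    and g: "\<forall>x\<in>V. grad \<psi> x \<noteq> 0" and \<Omega>: "\<Omega> \<inter> V = {x\<in>V. \<psi> x < 0}" and p: "p \<in> closure \<Omega>"
  obtains r q where "r > 0" "ball q r \<subseteq> \<Omega>" "\<And>x y. x \<in> \<Omega> \<inter> ball p r \<Longrightarrow> y \<in> ball q r \<Longrightarrow> closed_segment x y \<subseteq> \<Omega>"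
proof -
  obtain D where D: "\<And>x. x \<in> V \<Longrightarrow> GDERIV \<psi> x :> D x" "\<And>b. b \<in> Basis \<Longrightarrow> Ck_upto (Suc k) V V (\<lambda>x. D x \<bullet> b)"
    using \<psi> by auto
  have Dc: "continuous_on V D"
    using D(2) by (subst continuous_on_componentwise) auto
  have Dp: "D p \<noteq> 0"
  proof -
    have "grad \<psi> p = D p" by (rule grad_eqI[OF D(1)[OF V(2)]])
    with g V show ?thesis by auto
  qed
  define L where "L = norm (D p)"
  have L: "L > 0" using Dp by (simp add: L_def)
  obtain R1 where R1: "R1 > 0" "ball p R1 \<subseteq> V" using V open_contains_ball[of V] by auto
  obtain R2 where R2: "R2 > 0" "\<And>z. z \<in> V \<Longrightarrow> dist z p < R2 \<Longrightarrow> dist (D z) (D p) < L / 4"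
    using Dc[unfolded continuous_on_iff, rule_format, OF V(2), of "L / 4"] L by auto
  define R where "R = min R1 R2"
  have R: "R > 0" "ball p R \<subseteq> V" "\<And>z. z \<in> ball p R \<Longrightarrow> norm (D z - D p) \<le> L / 4"
  proof -
    show "R > 0" "ball p R \<subseteq> V" using R1 R2 by (auto simp: R_def)
    fix z assume "z \<in> ball p R"
    then have "z \<in> V" "dist z p < R2" using R1 by (auto simp: R_def dist_commute)
    then show "norm (D z - D p) \<le> L / 4" using R2(2)[of z] by (simp add: dist_norm)
  qed
  define n where "n = D p /\<^sub>R L"
  have n: "norm n = 1" "D p \<bullet> n = L" using L by (auto simp: n_def L_def dot_square_norm power2_eq_square)
  define \<rho> where "\<rho> = R / 2"
  define r where "r = R / 16"
  define q where "q = p - \<rho> *\<^sub>R n"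
  have key: "closed_segment x y \<subseteq> \<Omega>" if x: "x \<in> \<Omega> \<inter> ball p r" and y: "y \<in> ball q r" for x y
  proof
    fix z assume "z \<in> closed_segment x y"
    then obtain u where u: "0 \<le> u" "u \<le> 1" "z = x + u *\<^sub>R (y - x)"
      by (auto simp: in_segment algebra_simps)
    have "dist p y \<le> dist p q + dist q y" by (rule dist_triangle)
    also have "dist p q = \<rho>" using n R by (simp add: q_def dist_norm \<rho>_def)
    finally have yR: "y \<in> ball p R" using y R(1) by (simp add: \<rho>_def r_def)
    have xR: "x \<in> ball p R" using x R(1) by (simp add: r_def)
    have segR: "x + t *\<^sub>R (y - x) \<in> ball p R" if "0 \<le> t" "t \<le> 1" for t
    proof -
      have "(1 - t) *\<^sub>R x + t *\<^sub>R y \<in> ball p R"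
        using convex_ball[of p R] xR yR that unfolding convex_alt by blast
      then show ?thesis by (simp add: algebra_simps)
    qed
    \<comment> \<open>The radii \<open>\<rho> = R / 2\<close> and \<open>r = R / 16\<close> make the main term \<open>- \<rho> L\<close> dominate both errors.\<close>
    have slope: "D w \<bullet> (y - x) \<le> 0" if w: "w \<in> ball p R" for w
    proof -
      define e where "e = (y - q) - (x - p)"
      have e: "norm e \<le> 2 * r"
        using norm_triangle_ineq4[of "y - q" "x - p"] x y by (auto simp: e_def dist_norm norm_minus_commute)
      have yx: "y - x = e - \<rho> *\<^sub>R n" by (simp add: e_def q_def)
      have 1: "D w \<bullet> (y - x) = (D w - D p) \<bullet> (e - \<rho> *\<^sub>R n) + (D p \<bullet> e - \<rho> * L)"
        unfolding yx using n by (simp add: inner_diff_left inner_diff_right right_diff_distrib)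
      have "\<bar>(D w - D p) \<bullet> (e - \<rho> *\<^sub>R n)\<bar> \<le> norm (D w - D p) * norm (e - \<rho> *\<^sub>R n)"
        by (rule Cauchy_Schwarz_ineq2)
      also have "\<dots> \<le> (L / 4) * (2 * r + \<rho>)"
      proof (intro mult_mono)
        show "norm (e - \<rho> *\<^sub>R n) \<le> 2 * r + \<rho>"
          using norm_triangle_ineq4[of e "\<rho> *\<^sub>R n"] e n R(1) by (simp add: \<rho>_def)
      qed (use R w L in auto)
      finally have 2: "(D w - D p) \<bullet> (e - \<rho> *\<^sub>R n) \<le> (L / 4) * (2 * r + \<rho>)" by linarith
      have "D p \<bullet> e \<le> norm (D p) * norm e" by (rule norm_cauchy_schwarz)
      also have "\<dots> \<le> L * (2 * r)" using e by (simp add: L_def mult_left_mono)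
      finally have "D w \<bullet> (y - x) \<le> (L / 4) * (2 * r + \<rho>) + (L * (2 * r) - \<rho> * L)" using 1 2 by linarith
      also have "\<dots> = L * R * (- 7 / 32)" by (simp add: r_def \<rho>_def field_simps)
      also have "\<dots> \<le> 0" using L R(1) by simp
      finally show ?thesis .
    qed
    have "\<psi> (x + u *\<^sub>R (y - x)) \<le> \<psi> (x + 0 *\<^sub>R (y - x))"
    proof (rule DERIV_nonpos_imp_nonincreasing[OF u(1)])
      fix t assume t: "0 \<le> t" "t \<le> u"
      let ?w = "x + t *\<^sub>R (y - x)"
      have w: "?w \<in> ball p R" using segR t u by auto
      have "(\<psi> has_derivative (\<lambda>h. h \<bullet> D ?w)) (at ?w)"
        using D(1)[of ?w] w R(2) by (auto simp: gderiv_def)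
      moreover have "((\<lambda>t. x + t *\<^sub>R (y - x)) has_derivative (\<lambda>h. h *\<^sub>R (y - x))) (at t)"
        by (auto intro!: derivative_eq_intros)
      ultimately have "((\<lambda>t. \<psi> (x + t *\<^sub>R (y - x))) has_derivative (\<lambda>h. (h *\<^sub>R (y - x)) \<bullet> D ?w)) (at t)"
        using has_derivative_compose[of "\<lambda>t. x + t *\<^sub>R (y - x)" "\<lambda>h. h *\<^sub>R (y - x)" t UNIV \<psi> "\<lambda>h. h \<bullet> D ?w"] by blast
      then have "DERIV (\<lambda>t. \<psi> (x + t *\<^sub>R (y - x))) t :> D ?w \<bullet> (y - x)"
        unfolding has_field_derivative_def
        by (rule has_derivative_eq_rhs) (simp add: fun_eq_iff inner_commute)
      with slope[OF w] show "\<exists>d. DERIV (\<lambda>t. \<psi> (x + t *\<^sub>R (y - x))) t :> d \<and> d \<le> 0" by blast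
    qed
    moreover have "\<psi> x < 0" using x xR R(2) \<Omega> by auto
    ultimately have "\<psi> z < 0" by (simp add: u)
    moreover have "z \<in> V" using segR[OF u(1,2)] R(2) u(3) by auto
    ultimately show "z \<in> \<Omega>" using \<Omega> by auto
  qed
  have r: "r > 0" using R(1) by (simp add: r_def)
  obtain x0 where x0: "x0 \<in> \<Omega> \<inter> ball p r"
    using p r unfolding closure_approachable by (auto simp: dist_commute)
  have "ball q r \<subseteq> \<Omega>"
  proof
    fix y assume "y \<in> ball q r"
    from key[OF x0 this] show "y \<in> \<Omega>" using ends_in_segment(2)[of y x0] by blast
  qed
  with that r key show ?thesis by blast
qed

text \<open>
  Every point of \<open>\<Omega>\<close> has a ball linked to a fixed ball, because the set of these points is open and
  closed in \<open>\<Omega>\<close>: balls contained in one convex ball of \<open>\<Omega>\<close> are linked by segments.  A neighbourhood of a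
  boundary point is linked to a ball inside \<open>\<Omega>\<close> by \<open>boundary_segments\<close>.  Compactness of the closure
  leaves finitely many pieces.
\<close>

lemma domain_linked:
  fixes \<Omega> :: "'a::euclidean_space set"
  assumes \<Omega>: "open \<Omega>" "connected \<Omega>" "bounded \<Omega>" "Ck_boundary (Suc (Suc k)) \<Omega>"
  shows "linked \<Omega> \<Omega> \<Omega>"
proof (cases "\<Omega> = {}")
  case True then show ?thesis by (intro linked_segments) auto
next
  case False
  then obtain p0 where "p0 \<in> \<Omega>" by auto
  then obtain r0 where B0: "r0 > 0" "ball p0 r0 \<subseteq> \<Omega>" using \<Omega>(1) open_contains_ball[of \<Omega>] by auto
  have inner: "\<exists>r>0. ball p r \<subseteq> \<Omega> \<and> linked \<Omega> (ball p r) (ball p0 r0)" if "p \<in> \<Omega>" for p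
  proof (rule connected_induction_simple[OF \<Omega>(2), where a=p0 and b=p
        and P="\<lambda>p. \<exists>r>0. ball p r \<subseteq> \<Omega> \<and> linked \<Omega> (ball p r) (ball p0 r0)"])
    show "p0 \<in> \<Omega>" using B0 by auto
    show "\<exists>r>0. ball p0 r \<subseteq> \<Omega> \<and> linked \<Omega> (ball p0 r) (ball p0 r0)"
    proof (intro exI[of _ r0] conjI linked_segments B0)
      fix x y assume "x \<in> ball p0 r0" "y \<in> ball p0 r0"
      then show "closed_segment x y \<subseteq> \<Omega>"
        using closed_segment_subset[OF _ _ convex_ball[of p0 r0], of x y] B0 by blast
    qed auto
    show "p \<in> \<Omega>" by fact
  next
    fix a assume "a \<in> \<Omega>"
    then obtain R where R: "R > 0" "ball a R \<subseteq> \<Omega>" using \<Omega>(1) open_contains_ball[of \<Omega>] by auto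
    show "\<exists>T. openin (top_of_set \<Omega>) T \<and> a \<in> T \<and>
       (\<forall>x\<in>T. \<forall>y\<in>T. (\<exists>r>0. ball x r \<subseteq> \<Omega> \<and> linked \<Omega> (ball x r) (ball p0 r0)) \<longrightarrow>
           (\<exists>r>0. ball y r \<subseteq> \<Omega> \<and> linked \<Omega> (ball y r) (ball p0 r0)))"
    proof (intro exI[of _ "ball a R"] conjI ballI impI)
      show "openin (top_of_set \<Omega>) (ball a R)" using R \<Omega>(1) by (simp add: open_subset)
      show "a \<in> ball a R" using R by simp
      fix x y assume x: "x \<in> ball a R" and y: "y \<in> ball a R"
        and "\<exists>r>0. ball x r \<subseteq> \<Omega> \<and> linked \<Omega> (ball x r) (ball p0 r0)"
      then obtain r where r: "r > 0" "linked \<Omega> (ball x r) (ball p0 r0)" by blast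
      obtain s where s: "s > 0" "ball x s \<subseteq> ball a R" using x openE[OF open_ball[of a R]] by blast
      obtain t where t: "t > 0" "ball y t \<subseteq> ball a R" using y openE[OF open_ball[of a R]] by blast
      have "linked \<Omega> (ball x (min r s)) (ball p0 r0)"
        by (rule linked_subset[OF r(2)]) auto
      moreover have "linked \<Omega> (ball y t) (ball x (min r s))"
      proof (rule linked_segments)
        fix u v assume "u \<in> ball y t" "v \<in> ball x (min r s)"
        then have "u \<in> ball a R" "v \<in> ball a R" using s(2) t(2) by auto
        then have "closed_segment u v \<subseteq> ball a R" by (rule closed_segment_subset) (rule convex_ball)
        then show "closed_segment u v \<subseteq> \<Omega>" using R(2) by (rule order_trans)
      qed auto
      ultimately have "linked \<Omega> (ball y t) (ball p0 r0)"
        using r(1) s(1) by (rule_tac Y="ball x (min r s)" in linked_trans) auto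
      moreover have "ball y t \<subseteq> \<Omega>" by (rule order_trans[OF t(2) R(2)])
      ultimately show "\<exists>r>0. ball y r \<subseteq> \<Omega> \<and> linked \<Omega> (ball y r) (ball p0 r0)"
        using t(1) by blast
    qed
  qed
  have local: "\<exists>r>0. linked \<Omega> (\<Omega> \<inter> ball p r) (ball p0 r0)" if p: "p \<in> closure \<Omega>" for p
  proof (cases "p \<in> \<Omega>")
    case True
    then obtain r where r: "r > 0" "linked \<Omega> (ball p r) (ball p0 r0)" using inner by blast
    have "linked \<Omega> (\<Omega> \<inter> ball p r) (ball p0 r0)" by (rule linked_subset[OF r(2)]) auto
    with r show ?thesis by blast
  next
    case False
    then have "p \<in> frontier \<Omega>" using p \<Omega>(1) by (simp add: frontier_def interior_open)
    then obtain V \<psi> where V: "open V" "p \<in> V" "Ck_upto (Suc (Suc k)) V V \<psi>" "\<forall>x\<in>V. grad \<psi> x \<noteq> 0"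
        "\<Omega> \<inter> V = {x\<in>V. \<psi> x < 0}"
      using \<Omega>(4) unfolding Ck_boundary_def by blast
    obtain r q where rq: "r > 0" "ball q r \<subseteq> \<Omega>"
      "\<And>x y. x \<in> \<Omega> \<inter> ball p r \<Longrightarrow> y \<in> ball q r \<Longrightarrow> closed_segment x y \<subseteq> \<Omega>"
      using boundary_segments[OF V p] by blast
    have "q \<in> \<Omega>" using rq by auto
    then obtain s where s: "s > 0" "linked \<Omega> (ball q s) (ball p0 r0)" using inner by blast
    have "linked \<Omega> (ball q (min r s)) (ball p0 r0)" by (rule linked_subset[OF s(2)]) auto
    moreover have "linked \<Omega> (\<Omega> \<inter> ball p r) (ball q (min r s))"
      using \<Omega>(1) rq(3) by (intro linked_segments) auto
    moreover have "bounded (\<Omega> \<inter> ball p r)" by (rule bounded_subset[OF \<Omega>(3)]) auto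
    ultimately have "linked \<Omega> (\<Omega> \<inter> ball p r) (ball p0 r0)"
      using rq(1) s(1) \<Omega>(1) by (rule_tac Y="ball q (min r s)" in linked_trans) auto
    with rq show ?thesis by blast
  qed
  then have "\<forall>p\<in>closure \<Omega>. \<exists>r. r > 0 \<and> linked \<Omega> (\<Omega> \<inter> ball p r) (ball p0 r0)" by blast
  from bchoice[OF this] obtain r
    where r: "\<And>p. p \<in> closure \<Omega> \<Longrightarrow> r p > 0 \<and> linked \<Omega> (\<Omega> \<inter> ball p (r p)) (ball p0 r0)" by blast
  have "compact (closure \<Omega>)" using \<Omega>(3) by simp
  moreover have "closure \<Omega> \<subseteq> (\<Union>p\<in>closure \<Omega>. ball p (r p))" using r by force
  ultimately obtain F where F: "F \<subseteq> closure \<Omega>" "finite F" "closure \<Omega> \<subseteq> (\<Union>p\<in>F. ball p (r p))"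
    using compactE_image[of "closure \<Omega>" "closure \<Omega>" "\<lambda>p. ball p (r p)"] by auto
  have "linked \<Omega> (\<Omega> \<inter> (\<Union>p\<in>F. ball p (r p))) (ball p0 r0)"
    using F(2,1)
  proof (induction F)
    case empty show ?case by (intro linked_segments) auto
  next
    case (insert p F)
    have "linked \<Omega> ((\<Omega> \<inter> ball p (r p)) \<union> (\<Omega> \<inter> (\<Union>p\<in>F. ball p (r p)))) (ball p0 r0)"
      using insert r \<Omega>(1) by (rule_tac linked_Un) (auto intro!: borel_open)
    then show ?case by (simp add: Int_Un_distrib)
  qed
  moreover have "\<Omega> \<inter> (\<Union>p\<in>F. ball p (r p)) = \<Omega>" using F(3) closure_subset by blast
  ultimately have l: "linked \<Omega> \<Omega> (ball p0 r0)" by simp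
  then have "linked \<Omega> (ball p0 r0) \<Omega>" using \<Omega>(1) by (rule_tac linked_sym) auto
  with l show ?thesis using B0(1) \<Omega>(1,3) by (rule_tac Y="ball p0 r0" in linked_trans) auto
qed

section \<open>Oscillation of functions with a weak gradient\<close>

lemma nn_integral_affine_le:
  fixes H :: "'a::euclidean_space \<Rightarrow> ennreal"
  assumes [measurable]: "H \<in> borel_measurable borel" and c: "1 / 2 \<le> c"
  shows "(\<integral>\<^sup>+x. H (t + c *\<^sub>R x) \<partial>lborel) \<le> 2 ^ DIM('a) * (\<integral>\<^sup>+x. H x \<partial>lborel)"
proof -
  let ?d = "DIM('a)"
  have "(\<integral>\<^sup>+x. H x \<partial>lborel) = (\<integral>\<^sup>+x. H x \<partial>density (distr lborel borel (\<lambda>x. t + c *\<^sub>R x)) (\<lambda>_. ennreal (\<bar>c\<bar> ^ ?d)))"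
    using lborel_affine[of c t] c by simp
  also have "\<dots> = ennreal (\<bar>c\<bar> ^ ?d) * (\<integral>\<^sup>+x. H (t + c *\<^sub>R x) \<partial>lborel)"
    by (simp add: nn_integral_density nn_integral_distr nn_integral_cmult)
  finally have "2 ^ ?d * (\<integral>\<^sup>+x. H x \<partial>lborel) = ennreal (2 ^ ?d * \<bar>c\<bar> ^ ?d) * (\<integral>\<^sup>+x. H (t + c *\<^sub>R x) \<partial>lborel)"
    by (simp add: ennreal_mult ennreal_power[symmetric] mult.assoc)
  moreover have "1 \<le> 2 ^ ?d * \<bar>c\<bar> ^ ?d"
    using c one_le_power[of "2 * \<bar>c\<bar>" ?d] by (simp add: power_mult_distrib)
  then have "1 * (\<integral>\<^sup>+x. H (t + c *\<^sub>R x) \<partial>lborel) \<le> ennreal (2 ^ ?d * \<bar>c\<bar> ^ ?d) * (\<integral>\<^sup>+x. H (t + c *\<^sub>R x) \<partial>lborel)"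
    by (intro mult_right_mono) (simp_all add: ennreal_leI flip: ennreal_1)
  ultimately show ?thesis by simp
qed

text \<open>
  Put \<open>z = x + s (y - x)\<close>.  For \<open>s \<le> 1/2\<close> and fixed \<open>y\<close> the map from \<open>x\<close> to \<open>z\<close> has Jacobian \<open>(1 - s)\<^sup>d \<ge> 2\<^sup>-\<^sup>d\<close>;
  for \<open>s \<ge> 1/2\<close> one substitutes in \<open>y\<close> at fixed \<open>x\<close> instead.  So no singularity arises at either end.
\<close>

lemma osc_segment_estimate:
  fixes h :: "'a::euclidean_space \<Rightarrow> real" and k :: "'a \<Rightarrow> ennreal"
  assumes [measurable]: "h \<in> borel_measurable borel" "k \<in> borel_measurable borel" "X \<in> sets borel" "Y \<in> sets borel"
    and bd: "\<And>x y. x \<in> X \<Longrightarrow> y \<in> Y \<Longrightarrow>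
      ennreal \<bar>h x - h y\<bar> \<le> R * (\<integral>\<^sup>+s. indicator {0..1} s * k (x + s *\<^sub>R (y - x)) \<partial>(lborel :: real measure))"
  shows "osc h X Y \<le> R * (2 ^ DIM('a) * (emeasure lborel X + emeasure lborel Y) * (\<integral>\<^sup>+x. k x \<partial>lborel))"
proof -
  let ?i = "\<lambda>A x. indicator A x :: ennreal"
  let ?I = "\<integral>\<^sup>+x. k x \<partial>lborel" and ?d = "2 ^ DIM('a) :: ennreal"
  let ?Q = "\<lambda>x y s. ?i X x * (?i Y y * (?i {0..1} s * k (x + s *\<^sub>R (y - x))))"
  have "osc h X Y \<le> (\<integral>\<^sup>+x. \<integral>\<^sup>+y. R * (\<integral>\<^sup>+s. ?Q x y s \<partial>(lborel :: real measure)) \<partial>lborel \<partial>lborel)"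
  proof -
    have "osc h X Y = (\<integral>\<^sup>+x. \<integral>\<^sup>+y. ?i X x * (?i Y y * ennreal \<bar>h x - h y\<bar>) \<partial>lborel \<partial>lborel)"
      by (simp add: osc_iterated nn_integral_cmult)
    also have "\<dots> \<le> (\<integral>\<^sup>+x. \<integral>\<^sup>+y. R * (\<integral>\<^sup>+s. ?Q x y s \<partial>(lborel :: real measure)) \<partial>lborel \<partial>lborel)"
    proof (intro nn_integral_mono)
      fix x y
      show "?i X x * (?i Y y * ennreal \<bar>h x - h y\<bar>) \<le> R * (\<integral>\<^sup>+s. ?Q x y s \<partial>(lborel :: real measure))"
        using bd[of x y] by (cases "x \<in> X"; cases "y \<in> Y") simp_all
    qed
    finally show ?thesis .
  qed
  also have "\<dots> = R * (\<integral>\<^sup>+x. \<integral>\<^sup>+y. \<integral>\<^sup>+s. ?Q x y s \<partial>(lborel :: real measure) \<partial>lborel \<partial>lborel)"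
    by (simp add: nn_integral_cmult)
  also have "(\<integral>\<^sup>+x. \<integral>\<^sup>+y. \<integral>\<^sup>+s. ?Q x y s \<partial>(lborel :: real measure) \<partial>lborel \<partial>lborel)
     = (\<integral>\<^sup>+x. \<integral>\<^sup>+s. \<integral>\<^sup>+y. ?Q x y s \<partial>lborel \<partial>(lborel :: real measure) \<partial>lborel)"
    by (intro nn_integral_cong lborel_pair.Fubini') measurable
  also have "\<dots> = (\<integral>\<^sup>+s. \<integral>\<^sup>+x. \<integral>\<^sup>+y. ?Q x y s \<partial>lborel \<partial>lborel \<partial>(lborel :: real measure))"
    by (rule lborel_pair.Fubini') measurable
  also have "\<dots> \<le> (\<integral>\<^sup>+s. (?d * (emeasure lborel X + emeasure lborel Y) * ?I) * ?i {0..1} s \<partial>(lborel :: real measure))"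
  proof (intro nn_integral_mono)
    fix s :: real
    show "(\<integral>\<^sup>+x. \<integral>\<^sup>+y. ?Q x y s \<partial>lborel \<partial>lborel) \<le> (?d * (emeasure lborel X + emeasure lborel Y) * ?I) * ?i {0..1} s"
    proof (cases "s \<in> {0..1}")
      case s: True
      show ?thesis
      proof (cases "s \<le> 1 / 2")
        case True
        have "(\<integral>\<^sup>+x. \<integral>\<^sup>+y. ?Q x y s \<partial>lborel \<partial>lborel) = (\<integral>\<^sup>+y. \<integral>\<^sup>+x. ?Q x y s \<partial>lborel \<partial>lborel)"
          by (rule lborel_pair.Fubini') measurable
        also have "\<dots> \<le> (\<integral>\<^sup>+y. (?d * ?I) * ?i Y y \<partial>lborel)"
        proof (intro nn_integral_mono)
          fix y
          have "(\<integral>\<^sup>+x. ?Q x y s \<partial>lborel) \<le> (\<integral>\<^sup>+x. ?i Y y * k (s *\<^sub>R y + (1 - s) *\<^sub>R x) \<partial>lborel)"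
            by (intro nn_integral_mono) (auto simp: indicator_def algebra_simps)
          also have "\<dots> = ?i Y y * (\<integral>\<^sup>+x. k (s *\<^sub>R y + (1 - s) *\<^sub>R x) \<partial>lborel)"
            by (rule nn_integral_cmult) measurable
          also have "\<dots> \<le> ?i Y y * (?d * ?I)"
            using True by (intro mult_left_mono nn_integral_affine_le) auto
          finally show "(\<integral>\<^sup>+x. ?Q x y s \<partial>lborel) \<le> (?d * ?I) * ?i Y y" by (simp add: mult.commute)
        qed
        also have "\<dots> = (?d * ?I) * emeasure lborel Y" by (rule nn_integral_cmult_indicator) simp
        also have "\<dots> \<le> ?d * (emeasure lborel X + emeasure lborel Y) * ?I"
          by (simp add: distrib_left distrib_right ac_simps)
        finally show ?thesis using s by simp
      next
        case False
        have "(\<integral>\<^sup>+x. \<integral>\<^sup>+y. ?Q x y s \<partial>lborel \<partial>lborel) \<le> (\<integral>\<^sup>+x. (?d * ?I) * ?i X x \<partial>lborel)"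
        proof (intro nn_integral_mono)
          fix x
          have "(\<integral>\<^sup>+y. ?Q x y s \<partial>lborel) \<le> (\<integral>\<^sup>+y. ?i X x * k ((1 - s) *\<^sub>R x + s *\<^sub>R y) \<partial>lborel)"
            by (intro nn_integral_mono) (auto simp: indicator_def algebra_simps)
          also have "\<dots> = ?i X x * (\<integral>\<^sup>+y. k ((1 - s) *\<^sub>R x + s *\<^sub>R y) \<partial>lborel)"
            by (rule nn_integral_cmult) measurable
          also have "\<dots> \<le> ?i X x * (?d * ?I)"
            using False by (intro mult_left_mono nn_integral_affine_le) auto
          finally show "(\<integral>\<^sup>+y. ?Q x y s \<partial>lborel) \<le> (?d * ?I) * ?i X x" by (simp add: mult.commute)
        qed
        also have "\<dots> = (?d * ?I) * emeasure lborel X" by (rule nn_integral_cmult_indicator) simp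
        also have "\<dots> \<le> ?d * (emeasure lborel X + emeasure lborel Y) * ?I"
          by (simp add: distrib_left distrib_right ac_simps)
        finally show ?thesis using s by simp
      qed
    qed simp
  qed
  also have "\<dots> = (?d * (emeasure lborel X + emeasure lborel Y) * ?I) * emeasure lborel {0..1::real}"
    by (rule nn_integral_cmult_indicator) simp
  also have "emeasure lborel {0..1::real} = 1" by simp
  finally show ?thesis by (simp add: mult_left_mono)
qed

text \<open>
  \<open>G\<close> is a weak gradient of \<open>g\<close> in \<open>\<Omega>\<close> as far as shifted mollifiers can tell.  The functions are defined on the
  whole space, and integrable there, so that convolutions need no restriction of the domain.
\<close>

definition mollifier_grad :: "'a::euclidean_space set \<Rightarrow> ('a \<Rightarrow> real) \<Rightarrow> ('a \<Rightarrow> 'a) \<Rightarrow> bool" where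
  "mollifier_grad \<Omega> g G \<longleftrightarrow> integrable lborel g \<and> integrable lborel G \<and>
     (\<forall>x r. 0 < r \<and> cball x r \<subseteq> \<Omega> \<longrightarrow> mollify r G x = (LINT y|lborel. g y *\<^sub>R moll_grad r (x - y)))"

text \<open>
  The fundamental theorem of calculus on the segment; the derivative of \<open>mollify r g\<close> along it is given
  by the mollified weak gradient, as balls of radius \<open>r\<close> around its points lie in \<open>\<Omega>\<close>.
\<close>

lemma mollified_segment:
  fixes g :: "'a::euclidean_space \<Rightarrow> real"
  assumes gG: "mollifier_grad \<Omega> g G" and r: "0 < r"
    and \<theta>: "\<And>t. DERIV \<theta> t :> \<theta>' t" "continuous_on UNIV \<theta>'"
    and K: "closed_segment x y \<subseteq> K" "\<And>z. z \<in> K \<Longrightarrow> cball z r \<subseteq> \<Omega>" and R: "norm (y - x) \<le> R"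
  shows "ennreal \<bar>\<theta> (mollify r g x) - \<theta> (mollify r g y)\<bar>
    \<le> ennreal R * (\<integral>\<^sup>+s. indicator {0..1} s *
        (indicator K (x + s *\<^sub>R (y - x)) * ennreal (\<bar>\<theta>' (mollify r g (x + s *\<^sub>R (y - x)))\<bar> * norm (mollify r G (x + s *\<^sub>R (y - x))))) \<partial>(lborel :: real measure))"
proof -
  let ?p = "\<lambda>s::real. x + s *\<^sub>R (y - x)"
  have g: "integrable lborel g" "integrable lborel G" using gG by (auto simp: mollifier_grad_def)
  have [measurable]: "g \<in> borel_measurable borel" using g by auto
  have r0: "0 \<le> r" using r by simp
  have pK: "?p s \<in> K" if "s \<in> {0..1}" for s
  proof -
    have "?p s \<in> closed_segment x y" using that by (auto simp: in_segment algebra_simps intro!: exI[of _ s])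
    then show ?thesis using K by blast
  qed
  define \<phi>' where "\<phi>' s = \<theta>' (mollify r g (?p s)) * ((y - x) \<bullet> mollify r G (?p s))" for s
  have der: "DERIV (\<lambda>s. \<theta> (mollify r g (?p s))) s :> \<phi>' s" if s: "s \<in> {0..1}" for s
  proof -
    obtain B where B: "B > 0" "\<And>z::'a. norm (moll_grad r z) \<le> B" using moll_grad_bounded[OF r0] by blast
    have i: "integrable lborel (\<lambda>z. g z *\<^sub>R moll_grad r (?p s - z))"
      by (rule Bochner_Integration.integrable_bound[of lborel "\<lambda>z. B * g z"])
        (use g B in \<open>auto intro!: mult_mono simp: mult.commute[of B] abs_mult\<close>)
    have "(LINT z|lborel. ((y - x) \<bullet> moll_grad r (?p s - z)) * g z) = (LINT z|lborel. (y - x) \<bullet> (g z *\<^sub>R moll_grad r (?p s - z)))"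
      by (simp add: mult.commute)
    also have "\<dots> = (y - x) \<bullet> (LINT z|lborel. g z *\<^sub>R moll_grad r (?p s - z))"
      by (rule integral_inner_right) (rule i)
    also have "(LINT z|lborel. g z *\<^sub>R moll_grad r (?p s - z)) = mollify r G (?p s)"
      using gG K(2)[OF pK[OF s]] r by (auto simp: mollifier_grad_def)
    finally have "DERIV (\<lambda>s. mollify r g (?p s)) s :> (y - x) \<bullet> mollify r G (?p s)"
      using mollify_line_derivative[OF g(1) r0, of x "y - x" s] by simp
    from DERIV_chain2[OF \<theta>(1) this] show ?thesis by (simp add: \<phi>'_def)
  qed
  have pc: "continuous_on UNIV ?p" by (intro continuous_intros)
  have gc: "continuous_on UNIV (\<lambda>s. mollify r g (?p s))"
    by (rule continuous_on_compose2[OF mollify_continuous[OF g(1) r0] pc]) simp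
  have Gc: "continuous_on UNIV (\<lambda>s. mollify r G (?p s))"
    by (rule continuous_on_compose2[OF mollify_continuous[OF g(2) r0] pc]) simp
  have c: "continuous_on UNIV \<phi>'"
    unfolding \<phi>'_def
    by (intro continuous_intros Gc continuous_on_compose2[OF \<theta>(2) gc]) simp
  have "(LBINT s. indicator {0..1} s *\<^sub>R \<phi>' s) = \<theta> (mollify r g (?p 1)) - \<theta> (mollify r g (?p 0))"
  proof (rule integral_FTC_Icc)
    fix s :: real assume "0 \<le> s" "s \<le> 1"
    then have "DERIV (\<lambda>s. \<theta> (mollify r g (?p s))) s :> \<phi>' s" by (intro der) simp
    then show "((\<lambda>s. \<theta> (mollify r g (?p s))) has_vector_derivative \<phi>' s) (at s within {0..1})"
      unfolding has_real_derivative_iff_has_vector_derivative by (rule has_vector_derivative_at_within)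
  next
    show "continuous_on {0..1} \<phi>'" by (rule continuous_on_subset[OF c]) simp
  qed simp
  then have "ennreal \<bar>\<theta> (mollify r g x) - \<theta> (mollify r g y)\<bar> = ennreal (norm (LBINT s. indicator {0..1} s *\<^sub>R \<phi>' s))"
    by (simp add: abs_minus_commute)
  also have "\<dots> \<le> (\<integral>\<^sup>+s. ennreal (norm (indicator {0..1} s *\<^sub>R \<phi>' s)) \<partial>lborel)"
    by (intro integral_norm_bound_ennreal borel_integrable_compact continuous_on_subset[OF c]) auto
  also have "\<dots> \<le> (\<integral>\<^sup>+s. ennreal R * (indicator {0..1} s *
        (indicator K (?p s) * ennreal (\<bar>\<theta>' (mollify r g (?p s))\<bar> * norm (mollify r G (?p s))))) \<partial>lborel)"
  proof (intro nn_integral_mono)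
    fix s :: real
    show "ennreal (norm (indicator {0..1} s *\<^sub>R \<phi>' s)) \<le> ennreal R * (indicator {0..1} s *
        (indicator K (?p s) * ennreal (\<bar>\<theta>' (mollify r g (?p s))\<bar> * norm (mollify r G (?p s)))))"
    proof (cases "s \<in> {0..1}")
      case True
      have "\<bar>(y - x) \<bullet> mollify r G (?p s)\<bar> \<le> norm (y - x) * norm (mollify r G (?p s))" by (rule Cauchy_Schwarz_ineq2)
      also have "\<dots> \<le> R * norm (mollify r G (?p s))" using R by (intro mult_right_mono) auto
      finally have "\<bar>\<theta>' (mollify r g (?p s))\<bar> * \<bar>(y - x) \<bullet> mollify r G (?p s)\<bar>
          \<le> \<bar>\<theta>' (mollify r g (?p s))\<bar> * (R * norm (mollify r G (?p s)))" by (intro mult_left_mono) auto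
      then have "\<bar>\<phi>' s\<bar> \<le> R * (\<bar>\<theta>' (mollify r g (?p s))\<bar> * norm (mollify r G (?p s)))"
        by (simp add: \<phi>'_def abs_mult ac_simps)
      moreover have "0 \<le> R" using R norm_ge_zero[of "y - x"] by linarith
      ultimately show ?thesis using True pK[OF True]
        by (simp add: ennreal_mult[symmetric] ennreal_leI)
    qed simp
  qed
  also have "\<dots> = ennreal R * (\<integral>\<^sup>+s. indicator {0..1} s *
        (indicator K (?p s) * ennreal (\<bar>\<theta>' (mollify r g (?p s))\<bar> * norm (mollify r G (?p s)))) \<partial>lborel)"
  proof -
    have eq: "indicator {0..1} s * (indicator K (?p s) * e) = indicator {0..1} s * e" for s and e :: ennreal
      using pK[of s] by (cases "s \<in> {0..1}") simp_all
    have [measurable]: "(\<lambda>s. mollify r g (?p s)) \<in> borel_measurable borel" "(\<lambda>s. mollify r G (?p s)) \<in> borel_measurable borel"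
      "\<theta>' \<in> borel_measurable borel"
      using gc Gc \<theta>(2) by (auto intro: borel_measurable_continuous_onI)
    show ?thesis unfolding eq by (rule nn_integral_cmult) measurable
  qed
  finally show ?thesis .
qed

text \<open>
  Mollification is applied before \<open>\<theta>\<close>, so that the chain rule is used for smooth functions only.  On the
  right-hand side \<open>\<theta>'\<close> of the mollified function converges boundedly and almost everywhere along a
  subsequence, while all other errors are controlled by the \<open>L\<^sup>1\<close> distances.
\<close>

lemma osc_compose_compact:
  fixes g :: "'a::euclidean_space \<Rightarrow> real"
  assumes gG: "mollifier_grad \<Omega> g G"
    and \<theta>: "\<And>t. DERIV \<theta> t :> \<theta>' t" "continuous_on UNIV \<theta>'" "\<And>t. \<bar>\<theta>' t\<bar> \<le> B" "0 \<le> B"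
    and X: "compact X" and Y: "compact Y" and \<Omega>: "open \<Omega>"
    and seg: "\<And>x y. x \<in> X \<Longrightarrow> y \<in> Y \<Longrightarrow> closed_segment x y \<subseteq> \<Omega>"
    and R: "\<And>x y. x \<in> X \<Longrightarrow> y \<in> Y \<Longrightarrow> norm (y - x) \<le> R"
  shows "osc (\<lambda>x. \<theta> (g x)) X Y \<le> ennreal R * (2 ^ DIM('a) * (emeasure lborel X + emeasure lborel Y)) *
      (\<integral>\<^sup>+x. indicator \<Omega> x * ennreal (\<bar>\<theta>' (g x)\<bar> * norm (G x)) \<partial>lborel)"
proof -
  have g: "integrable lborel g" "integrable lborel G" using gG by (auto simp: mollifier_grad_def)
  have gm [measurable]: "g \<in> borel_measurable borel" "G \<in> borel_measurable borel" using g by auto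
  have \<theta>c: "continuous_on UNIV \<theta>"
    using \<theta>(1) DERIV_isCont by (blast intro: continuous_at_imp_continuous_on)
  have [measurable]: "\<theta> \<in> borel_measurable borel" "\<theta>' \<in> borel_measurable borel"
    using \<theta>c \<theta>(2) by (auto intro: borel_measurable_continuous_onI)
  have [measurable]: "X \<in> sets borel" "Y \<in> sets borel" "\<Omega> \<in> sets borel"
    using X Y \<Omega> by (auto simp: compact_imp_closed)
  have fin: "emeasure lborel X < top" "emeasure lborel Y < top"
    using emeasure_bounded_finite compact_imp_bounded X Y by (auto simp: less_top)
  define K where "K = (\<lambda>(s, x, y). x + s *\<^sub>R (y - x)) ` ({0..1::real} \<times> X \<times> Y)"
  have K: "compact K" unfolding K_def
    by (intro compact_continuous_image compact_Times X Y) (auto simp: case_prod_beta intro!: continuous_intros)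
  have segK: "closed_segment x y \<subseteq> K" if "x \<in> X" "y \<in> Y" for x y
  proof
    fix z assume "z \<in> closed_segment x y"
    then obtain s where s: "0 \<le> s" "s \<le> 1" "z = x + s *\<^sub>R (y - x)" by (auto simp: in_segment algebra_simps)
    then show "z \<in> K" unfolding K_def using that by (intro image_eqI[of _ _ "(s, x, y)"]) auto
  qed
  have K\<Omega>: "K \<subseteq> \<Omega>"
  proof
    fix z assume "z \<in> K"
    then obtain s x y where s: "0 \<le> s" "s \<le> 1" "x \<in> X" "y \<in> Y" "z = x + s *\<^sub>R (y - x)" unfolding K_def by auto
    then have "z \<in> closed_segment x y" by (auto simp: in_segment algebra_simps intro!: exI[of _ s])
    with seg s show "z \<in> \<Omega>" by blast
  qed
  have [measurable]: "K \<in> sets borel" using K by (simp add: compact_imp_closed)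
  obtain \<epsilon> where \<epsilon>: "\<epsilon> > 0" "(\<Union>x\<in>K. ball x \<epsilon>) \<subseteq> \<Omega>"
    using compact_subset_open_imp_ball_epsilon_subset[OF K \<Omega> K\<Omega>] .
  obtain r \<delta> where r: "\<And>n. 0 < r n" "\<And>n. r n < \<epsilon>" "r \<longlonglongrightarrow> 0" "\<delta> \<longlonglongrightarrow> 0"
    "\<And>n. (\<integral>\<^sup>+x. ennreal (norm (mollify (r n) g x - g x)) \<partial>lborel) \<le> ennreal (\<delta> n)"
    "\<And>n. (\<integral>\<^sup>+x. ennreal (norm (mollify (r n) G x - G x)) \<partial>lborel) \<le> ennreal (\<delta> n)"
    "AE x in lborel. (\<lambda>n. mollify (r n) g x) \<longlonglongrightarrow> g x"
    by (rule mollify_AE_subsequence[OF g \<epsilon>(1)], rule that) assumption+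
  have rm [measurable]: "mollify (r n) g \<in> borel_measurable borel" "mollify (r n) G \<in> borel_measurable borel" for n
    using mollify_continuous[OF g(1), of "r n"] mollify_continuous[OF g(2), of "r n"] r(1)[of n]
    by (auto intro!: borel_measurable_continuous_onI)
  have \<delta>0: "(\<lambda>n. ennreal (\<delta> n)) \<longlonglongrightarrow> 0"
    using tendsto_ennrealI[OF r(4)] by simp
  have lip: "\<bar>\<theta> a - \<theta> b\<bar> \<le> B * \<bar>a - b\<bar>" for a b
    using field_differentiable_bound[of UNIV \<theta> \<theta>' B a b] \<theta>(1,3) by auto
  let ?m = "emeasure lborel X + emeasure lborel Y"
  let ?c = "ennreal R * (2 ^ DIM('a) * ?m)"
  let ?J = "\<lambda>n. \<integral>\<^sup>+x. indicator \<Omega> x * ennreal (\<bar>\<theta>' (mollify (r n) g x)\<bar> * norm (G x)) \<partial>lborel"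
  let ?I = "\<integral>\<^sup>+x. indicator \<Omega> x * ennreal (\<bar>\<theta>' (g x)\<bar> * norm (G x)) \<partial>lborel"
  have bound: "osc (\<lambda>x. \<theta> (g x)) X Y \<le> ?c * (?J n + ennreal B * ennreal (\<delta> n)) + ennreal B * ?m * ennreal (\<delta> n)" for n
  proof -
    let ?gn = "mollify (r n) g" and ?Gn = "mollify (r n) G"
    let ?i = "\<lambda>A x. indicator A x :: ennreal"
    let ?e = "\<lambda>x. ennreal (norm (?gn x - g x))"
    have "osc (\<lambda>x. \<theta> (g x)) X Y = (\<integral>\<^sup>+x. \<integral>\<^sup>+y. ?i X x * (?i Y y * ennreal \<bar>\<theta> (g x) - \<theta> (g y)\<bar>) \<partial>lborel \<partial>lborel)"
      by (simp add: osc_iterated nn_integral_cmult)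
    also have "\<dots> \<le> (\<integral>\<^sup>+x. \<integral>\<^sup>+y. ?i X x * (?i Y y * ennreal \<bar>\<theta> (?gn x) - \<theta> (?gn y)\<bar>)
         + (ennreal B * (?e x * ?i Y y) + ennreal B * (?i X x * ?e y)) \<partial>lborel \<partial>lborel)"
    proof (intro nn_integral_mono)
      fix x y
      have "\<bar>\<theta> (g x) - \<theta> (g y)\<bar> \<le> \<bar>\<theta> (?gn x) - \<theta> (?gn y)\<bar> + (B * \<bar>?gn x - g x\<bar> + B * \<bar>?gn y - g y\<bar>)"
        using lip[of "?gn x" "g x"] lip[of "?gn y" "g y"] by linarith
      then have "ennreal \<bar>\<theta> (g x) - \<theta> (g y)\<bar> \<le> ennreal \<bar>\<theta> (?gn x) - \<theta> (?gn y)\<bar> + (ennreal B * ?e x + ennreal B * ?e y)"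
        using \<theta>(4) by (simp flip: ennreal_plus ennreal_mult add: ennreal_leI)
      then show "?i X x * (?i Y y * ennreal \<bar>\<theta> (g x) - \<theta> (g y)\<bar>) \<le>
        ?i X x * (?i Y y * ennreal \<bar>\<theta> (?gn x) - \<theta> (?gn y)\<bar>) + (ennreal B * (?e x * ?i Y y) + ennreal B * (?i X x * ?e y))"
        by (cases "x \<in> X"; cases "y \<in> Y") simp_all
    qed
    also have "\<dots> = (\<integral>\<^sup>+x. \<integral>\<^sup>+y. ?i X x * (?i Y y * ennreal \<bar>\<theta> (?gn x) - \<theta> (?gn y)\<bar>) \<partial>lborel \<partial>lborel)
        + (ennreal B * ((\<integral>\<^sup>+x. ?e x \<partial>lborel) * emeasure lborel Y) + ennreal B * (emeasure lborel X * (\<integral>\<^sup>+x. ?e x \<partial>lborel)))"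
      by (simp add: nn_integral_add nn_integral_cmult nn_integral_multc)
    also have "(\<integral>\<^sup>+x. \<integral>\<^sup>+y. ?i X x * (?i Y y * ennreal \<bar>\<theta> (?gn x) - \<theta> (?gn y)\<bar>) \<partial>lborel \<partial>lborel) = osc (\<lambda>x. \<theta> (?gn x)) X Y"
      by (simp add: osc_iterated nn_integral_cmult)
    also have "osc (\<lambda>x. \<theta> (?gn x)) X Y
      \<le> ennreal R * (2 ^ DIM('a) * ?m * (\<integral>\<^sup>+x. indicator K x * ennreal (\<bar>\<theta>' (?gn x)\<bar> * norm (?Gn x)) \<partial>lborel))"
    proof (rule osc_segment_estimate)
      fix x y assume xy: "x \<in> X" "y \<in> Y"
      have "cball z (r n) \<subseteq> \<Omega>" if "z \<in> K" for z
        using \<epsilon>(2) that r(2)[of n] by (force simp: subset_iff)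
      from mollified_segment[OF gG r(1) \<theta>(1,2) segK[OF xy] this R[OF xy]]
      show "ennreal \<bar>\<theta> (?gn x) - \<theta> (?gn y)\<bar> \<le> ennreal R * (\<integral>\<^sup>+s. indicator {0..1} s *
        (indicator K (x + s *\<^sub>R (y - x)) * ennreal (\<bar>\<theta>' (?gn (x + s *\<^sub>R (y - x)))\<bar> * norm (?Gn (x + s *\<^sub>R (y - x))))) \<partial>lborel)" .
    qed measurable
    also have "(\<integral>\<^sup>+x. indicator K x * ennreal (\<bar>\<theta>' (?gn x)\<bar> * norm (?Gn x)) \<partial>lborel)
      \<le> (\<integral>\<^sup>+x. indicator \<Omega> x * ennreal (\<bar>\<theta>' (?gn x)\<bar> * norm (G x)) + ennreal B * ennreal (norm (?Gn x - G x)) \<partial>lborel)"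
    proof (intro nn_integral_mono)
      fix x
      have "norm (?Gn x) \<le> norm (G x) + norm (?Gn x - G x)" using norm_triangle_ineq2[of "?Gn x" "G x"] by linarith
      then have "\<bar>\<theta>' (?gn x)\<bar> * norm (?Gn x) \<le> \<bar>\<theta>' (?gn x)\<bar> * (norm (G x) + norm (?Gn x - G x))" by (intro mult_left_mono) auto
      also have "\<dots> \<le> \<bar>\<theta>' (?gn x)\<bar> * norm (G x) + B * norm (?Gn x - G x)"
        using \<theta>(3) by (simp add: distrib_left mult_right_mono)
      finally have "ennreal (\<bar>\<theta>' (?gn x)\<bar> * norm (?Gn x)) \<le> ennreal (\<bar>\<theta>' (?gn x)\<bar> * norm (G x)) + ennreal B * ennreal (norm (?Gn x - G x))"
        using \<theta>(4) by (simp flip: ennreal_plus ennreal_mult add: ennreal_leI)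
      then show "indicator K x * ennreal (\<bar>\<theta>' (?gn x)\<bar> * norm (?Gn x)) \<le>
        indicator \<Omega> x * ennreal (\<bar>\<theta>' (?gn x)\<bar> * norm (G x)) + ennreal B * ennreal (norm (?Gn x - G x))"
        using K\<Omega> by (cases "x \<in> K") auto
    qed
    also have "\<dots> = ?J n + ennreal B * (\<integral>\<^sup>+x. ennreal (norm (?Gn x - G x)) \<partial>lborel)"
      by (simp add: nn_integral_add nn_integral_cmult)
    also have "(\<integral>\<^sup>+x. ennreal (norm (?Gn x - G x)) \<partial>lborel) \<le> ennreal (\<delta> n)" by (rule r)
    also have "(\<integral>\<^sup>+x. ?e x \<partial>lborel) \<le> ennreal (\<delta> n)" by (rule r)
    finally have "osc (\<lambda>x. \<theta> (g x)) X Y \<le> ennreal R * (2 ^ DIM('a) * ?m * (?J n + ennreal B * ennreal (\<delta> n)))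
       + (ennreal B * (ennreal (\<delta> n) * emeasure lborel Y) + ennreal B * (emeasure lborel X * ennreal (\<delta> n)))"
      by (simp add: add_mono mult_left_mono mult_right_mono)
    then show ?thesis by (simp add: distrib_left distrib_right ac_simps)
  qed
  have "?J \<longlonglongrightarrow> ?I"
  proof (rule nn_integral_dominated_convergence[where w="\<lambda>x. ennreal (B * norm (G x))"])
    show "(\<integral>\<^sup>+ x. ennreal (B * norm (G x)) \<partial>lborel) < \<infinity>"
      using g(2) \<theta>(4) by (simp add: ennreal_mult nn_integral_cmult integrable_iff_bounded ennreal_mult_less_top)
    show "AE x in lborel. indicator \<Omega> x * ennreal (\<bar>\<theta>' (mollify (r n) g x)\<bar> * norm (G x)) \<le> ennreal (B * norm (G x))" for n
      using \<theta>(3) by (intro AE_I2) (auto simp: indicator_def intro!: ennreal_leI mult_right_mono)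
    show "AE x in lborel. (\<lambda>n. indicator \<Omega> x * ennreal (\<bar>\<theta>' (mollify (r n) g x)\<bar> * norm (G x))) \<longlonglongrightarrow> indicator \<Omega> x * ennreal (\<bar>\<theta>' (g x)\<bar> * norm (G x))"
      using r(7)
    proof eventually_elim
      case (elim x)
      moreover have "isCont \<theta>' (g x)" using \<theta>(2) by (simp add: continuous_on_eq_continuous_at)
      ultimately have "(\<lambda>n. \<theta>' (mollify (r n) g x)) \<longlonglongrightarrow> \<theta>' (g x)" by (rule isCont_tendsto_compose[rotated])
      then have "(\<lambda>n. ennreal (\<bar>\<theta>' (mollify (r n) g x)\<bar> * norm (G x))) \<longlonglongrightarrow> ennreal (\<bar>\<theta>' (g x)\<bar> * norm (G x))"
        by (intro tendsto_ennrealI tendsto_intros)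
      then show ?case by (intro ennreal_tendsto_cmult) (auto simp: indicator_def)
    qed
  qed auto
  moreover have c: "?c < top" using fin by (auto simp: ennreal_mult_less_top power_less_top_ennreal)
  moreover have "ennreal B * ?m < top" using fin by (auto simp: ennreal_mult_less_top)
  ultimately have "(\<lambda>n. ?c * (?J n + ennreal B * ennreal (\<delta> n)) + ennreal B * ?m * ennreal (\<delta> n)) \<longlonglongrightarrow> ?c * (?I + ennreal B * 0) + ennreal B * ?m * 0"
    using \<delta>0 by (intro tendsto_add ennreal_tendsto_cmult) auto
  from LIMSEQ_le_const[OF this] bound show ?thesis by simp
qed

text \<open>
  Open sets are exhausted by compact sets, on which the segments have positive distance to the
  boundary of \<open>\<Omega>\<close> and \<open>osc_compose_compact\<close> applies.
\<close>

lemma seg_bound_compose: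
  fixes g :: "'a::euclidean_space \<Rightarrow> real"
  assumes gG: "mollifier_grad \<Omega> g G"
    and \<theta>: "\<And>t. DERIV \<theta> t :> \<theta>' t" "continuous_on UNIV \<theta>'" "\<And>t. \<bar>\<theta>' t\<bar> \<le> B" "0 \<le> B"
    and \<Omega>: "open \<Omega>" "bounded \<Omega>"
  shows "seg_bound \<Omega> (\<lambda>x. \<theta> (g x)) (ennreal (diameter \<Omega>) * (2 ^ DIM('a) * (emeasure lborel \<Omega> + emeasure lborel \<Omega>)) *
      (\<integral>\<^sup>+x. indicator \<Omega> x * ennreal (\<bar>\<theta>' (g x)\<bar> * norm (G x)) \<partial>lborel))"
  unfolding seg_bound_def
proof (intro conjI allI impI)
  have \<theta>c: "continuous_on UNIV \<theta>"
    using \<theta>(1) DERIV_isCont by (blast intro: continuous_at_imp_continuous_on)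
  have [measurable]: "\<theta> \<in> borel_measurable borel"
    using \<theta>c by (auto intro: borel_measurable_continuous_onI)
  have [measurable]: "g \<in> borel_measurable borel" using gG by (auto simp: mollifier_grad_def)
  show m [measurable]: "(\<lambda>x. \<theta> (g x)) \<in> borel_measurable borel" by measurable
  fix X Y :: "'a set"
  assume *: "open X \<and> open Y \<and> (\<forall>x\<in>X. \<forall>y\<in>Y. closed_segment x y \<subseteq> \<Omega>)"
  let ?N = "ennreal (diameter \<Omega>) * (2 ^ DIM('a) * (emeasure lborel \<Omega> + emeasure lborel \<Omega>)) *
      (\<integral>\<^sup>+x. indicator \<Omega> x * ennreal (\<bar>\<theta>' (g x)\<bar> * norm (G x)) \<partial>lborel)"
  have oX: "open X" and oY: "open Y" using * by auto
  obtain C where C: "\<And>n. compact (C n)" "\<And>n. C n \<subseteq> X" "\<And>n. C n \<subseteq> interior (C (Suc n))" "\<Union>(range C) = X"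
    by (rule open_Union_compact_subsets[OF oX], rule that) assumption+
  obtain C' where C': "\<And>n. compact (C' n)" "\<And>n. C' n \<subseteq> Y" "\<And>n. C' n \<subseteq> interior (C' (Suc n))" "\<Union>(range C') = Y"
    by (rule open_Union_compact_subsets[OF oY], rule that) assumption+
  have inc: "incseq C" "incseq C'"
    by (rule incseq_SucI, rule order_trans[OF C(3) interior_subset])
      (rule incseq_SucI, rule order_trans[OF C'(3) interior_subset])
  have le: "osc (\<lambda>x. \<theta> (g x)) (C n) (C' n) \<le> ?N" for n
  proof (cases "C n = {} \<or> C' n = {}")
    case True then show ?thesis by (auto simp: osc_def)
  next
    case False
    then obtain x0 y0 where xy0: "x0 \<in> C n" "y0 \<in> C' n" by auto
    have seg: "closed_segment x y \<subseteq> \<Omega>" if "x \<in> C n" "y \<in> C' n" for x y using * C(2) C'(2) that by blast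
    have CO: "C n \<subseteq> \<Omega>" "C' n \<subseteq> \<Omega>"
    proof -
      show "C n \<subseteq> \<Omega>" using seg[OF _ xy0(2)] ends_in_segment(1) by (meson subsetD subsetI)
      show "C' n \<subseteq> \<Omega>" using seg[OF xy0(1)] ends_in_segment(2) by (meson subsetD subsetI)
    qed
    have "osc (\<lambda>x. \<theta> (g x)) (C n) (C' n) \<le> ennreal (diameter \<Omega>) * (2 ^ DIM('a) * (emeasure lborel (C n) + emeasure lborel (C' n))) *
      (\<integral>\<^sup>+x. indicator \<Omega> x * ennreal (\<bar>\<theta>' (g x)\<bar> * norm (G x)) \<partial>lborel)"
    proof (rule osc_compose_compact[OF gG \<theta> C(1) C'(1) \<Omega>(1) seg])
      fix x y assume "x \<in> C n" "y \<in> C' n"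
      then show "norm (y - x) \<le> diameter \<Omega>"
        using diameter_bounded_bound[OF \<Omega>(2), of y x] CO by (auto simp: dist_norm)
    qed
    also have "\<dots> \<le> ?N"
      using CO \<Omega>(1) by (intro mult_right_mono mult_left_mono add_mono emeasure_mono) auto
    finally show ?thesis .
  qed
  have "(\<lambda>n. osc (\<lambda>x. \<theta> (g x)) (C n) (C' n)) \<longlonglongrightarrow> emeasure (density lborel (\<lambda>z. ennreal \<bar>\<theta> (g (fst z)) - \<theta> (g (snd z))\<bar>)) (\<Union>n. C n \<times> C' n)"
    unfolding osc_def
  proof (rule Lim_emeasure_incseq)
    show "range (\<lambda>n. C n \<times> C' n) \<subseteq> sets (density lborel (\<lambda>z. ennreal \<bar>\<theta> (g (fst z)) - \<theta> (g (snd z))\<bar>))"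
      using C(1) C'(1) by (auto intro!: borel_compact compact_Times)
    show "incseq (\<lambda>n. C n \<times> C' n)"
      unfolding incseq_def by (intro allI impI Sigma_mono incseqD[OF inc(1)] incseqD[OF inc(2)])
  qed
  moreover have "(\<Union>n. C n \<times> C' n) = X \<times> Y"
  proof
    show "X \<times> Y \<subseteq> (\<Union>n. C n \<times> C' n)"
    proof clarify
      fix x y assume "x \<in> X" "y \<in> Y"
      then obtain i j where "x \<in> C i" "y \<in> C' j" using C(4) C'(4) by blast
      then have "x \<in> C (max i j)" "y \<in> C' (max i j)" 
        using incseqD[OF inc(1), of i "max i j"] incseqD[OF inc(2), of j "max i j"] by auto
      then show "(x, y) \<in> (\<Union>n. C n \<times> C' n)" by blast
    qed
  qed (use C(2) C'(2) in blast)
  ultimately have "(\<lambda>n. osc (\<lambda>x. \<theta> (g x)) (C n) (C' n)) \<longlonglongrightarrow> osc (\<lambda>x. \<theta> (g x)) X Y" by (simp add: osc_def)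
  then show "osc (\<lambda>x. \<theta> (g x)) X Y \<le> ?N" using le by (intro LIMSEQ_le_const2[of _ _ ?N]) auto
qed

section \<open>Separated level sets of Sobolev functions\<close>

definition sqpos :: "real \<Rightarrow> real" where "sqpos s = (max 0 s)\<^sup>2"

lemma sqpos_derivative: "DERIV sqpos s :> 2 * max 0 s"
  unfolding has_field_derivative_def has_derivative_at_alt
proof (intro conjI allI impI)
  show "bounded_linear ((*) (2 * max 0 s))" by (rule bounded_linear_mult_right)
  fix e :: real assume e: "e > 0"
  have key: "\<bar>sqpos y - sqpos s - 2 * max 0 s * (y - s)\<bar> \<le> (y - s)\<^sup>2" for y
  proof -
    consider "0 \<le> s" "0 \<le> y" | "0 \<le> s" "y < 0" | "s < 0" "0 \<le> y" | "s < 0" "y < 0" by linarith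
    then show ?thesis
    proof cases
      case 1
      then have "sqpos y - sqpos s - 2 * max 0 s * (y - s) = (y - s)\<^sup>2"
        by (simp add: sqpos_def power2_eq_square algebra_simps)
      then show ?thesis by simp
    next
      case 2
      have "s * y \<le> 0" using 2 by (simp add: mult_nonneg_nonpos)
      moreover have "sqpos y - sqpos s - 2 * max 0 s * (y - s) = s\<^sup>2 - 2 * (s * y)"
        using 2 by (simp add: sqpos_def power2_eq_square algebra_simps)
      moreover have "(y - s)\<^sup>2 = s\<^sup>2 - 2 * (s * y) + y\<^sup>2" by (simp add: power2_eq_square algebra_simps)
      ultimately show ?thesis using zero_le_power2[of s] zero_le_power2[of y] by linarith
    next
      case 3
      have "y\<^sup>2 \<le> (y - s)\<^sup>2" using 3 by (intro power_mono) auto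
      then show ?thesis using 3 by (simp add: sqpos_def)
    next
      case 4
      then show ?thesis by (simp add: sqpos_def)
    qed
  qed
  show "\<exists>d>0. \<forall>y. norm (y - s) < d \<longrightarrow> norm (sqpos y - sqpos s - 2 * max 0 s * (y - s)) \<le> e * norm (y - s)"
  proof (intro exI[of _ e] conjI allI impI e)
    fix y assume y: "norm (y - s) < e"
    have "(y - s)\<^sup>2 = \<bar>y - s\<bar> * \<bar>y - s\<bar>" by (simp add: power2_eq_square)
    also have "\<dots> \<le> e * \<bar>y - s\<bar>" using y by (intro mult_right_mono) auto
    finally show "norm (sqpos y - sqpos s - 2 * max 0 s * (y - s)) \<le> e * norm (y - s)"
      using key[of y] by simp
  qed
qed

text \<open>
  A function of class \<open>C\<^sup>1\<close> that is \<open>1\<close> below \<open>a\<close> and \<open>0\<close> above \<open>b\<close>; its derivative is confined to the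
  interval between the two levels, which localises the gradient term in \<open>level_set_estimate\<close>.
\<close>

definition cutoff :: "real \<Rightarrow> real \<Rightarrow> real \<Rightarrow> real" where
  "cutoff a b t = sqpos (1 - sqpos ((t - a) / (b - a)))"

definition cutoff_deriv :: "real \<Rightarrow> real \<Rightarrow> real \<Rightarrow> real" where
  "cutoff_deriv a b t = - (2 * max 0 (1 - sqpos ((t - a) / (b - a)))) * (2 * max 0 ((t - a) / (b - a))) / (b - a)"

lemma cutoff_has_derivative: "a < b \<Longrightarrow> DERIV (cutoff a b) t :> cutoff_deriv a b t"
proof -
  assume ab: "a < b"
  have "DERIV (\<lambda>t. (t - a) / (b - a)) t :> 1 / (b - a)" using ab by (auto intro!: derivative_eq_intros)
  from DERIV_chain2[OF sqpos_derivative this]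
  have "DERIV (\<lambda>t. 1 - sqpos ((t - a) / (b - a))) t :> - (2 * max 0 ((t - a) / (b - a)) * (1 / (b - a)))"
    by (auto intro!: derivative_eq_intros)
  from DERIV_chain2[OF sqpos_derivative this] show ?thesis
    by (simp add: cutoff_def[abs_def] cutoff_deriv_def)
qed

lemma cutoff_deriv_continuous: "continuous_on UNIV (cutoff_deriv a b)"
  unfolding cutoff_deriv_def sqpos_def
  by (cases "a = b") (auto intro!: continuous_intros)

lemma cutoff_low: "a < b \<Longrightarrow> t \<le> a \<Longrightarrow> cutoff a b t = 1"
proof -
  assume "a < b" "t \<le> a"
  then have "max 0 ((t - a) / (b - a)) = 0" by (simp add: divide_nonpos_pos)
  then show ?thesis by (simp add: cutoff_def sqpos_def)
qed

lemma sqpos_ge_1: "1 \<le> s \<Longrightarrow> 1 \<le> sqpos s"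
  using power_mono[of 1 s 2] by (simp add: sqpos_def)

lemma cutoff_high: "a < b \<Longrightarrow> b \<le> t \<Longrightarrow> cutoff a b t = 0"
  using sqpos_ge_1[of "(t - a) / (b - a)"] by (simp add: cutoff_def sqpos_def[of "1 - _"])

lemma cutoff_deriv_bound:
  assumes "a < b"
  shows "\<bar>cutoff_deriv a b t\<bar> \<le> 4 / (b - a) * indicator {a<..<b} t"
proof -
  let ?s = "(t - a) / (b - a)"
  consider "t \<le> a" | "b \<le> t" | "a < t" "t < b" by linarith
  then show ?thesis
  proof cases
    case 1
    then have "max 0 ?s = 0" using assms by (simp add: divide_nonpos_pos)
    then show ?thesis using 1 by (simp add: cutoff_deriv_def)
  next
    case 2
    then have "1 \<le> sqpos ?s" using assms by (intro sqpos_ge_1) simp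
    then have "max 0 (1 - sqpos ?s) = 0" by simp
    then show ?thesis using 2 by (simp add: cutoff_deriv_def)
  next
    case 3
    have "max 0 ?s \<le> 1" "max 0 (1 - sqpos ?s) \<le> 1" using 3 assms by (auto simp: sqpos_def)
    then have "(2 * max 0 (1 - sqpos ?s)) * (2 * max 0 ?s) \<le> 2 * 2" by (intro mult_mono) auto
    then have "\<bar>(2 * max 0 (1 - sqpos ?s)) * (2 * max 0 ?s)\<bar> / (b - a) \<le> 4 / (b - a)"
      using assms by (intro divide_right_mono) (auto simp: abs_mult)
    then show ?thesis using 3 assms by (simp add: cutoff_deriv_def abs_mult)
  qed
qed

lemma borel_representative:
  fixes G :: "'a::euclidean_space \<Rightarrow> 'b::euclidean_space"
  assumes "G \<in> borel_measurable lebesgue"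
  shows "\<exists>G'\<in>borel_measurable lborel. AE x in lborel. G x = G' x"
proof -
  have "\<exists>g. g \<in> borel_measurable lborel \<and> (AE x in lborel. G x \<bullet> b = g x)" for b
    using completion_ex_borel_measurable_real[of "\<lambda>x. G x \<bullet> b" lborel] assms by auto
  then have "\<forall>b. \<exists>g. g \<in> borel_measurable lborel \<and> (AE x in lborel. G x \<bullet> b = g x)" ..
  from choice[OF this] obtain g where g: "\<And>b. g b \<in> borel_measurable lborel" "\<And>b. AE x in lborel. G x \<bullet> b = g b x"
    by blast
  have "AE x in lborel. \<forall>b\<in>Basis. G x \<bullet> b = g b x"
    using g(2) by (intro AE_finite_allI) auto
  then have "AE x in lborel. G x = (\<Sum>b\<in>Basis. g b x *\<^sub>R b)"
  proof eventually_elim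
    case (elim x)
    have "G x = (\<Sum>b\<in>Basis. (G x \<bullet> b) *\<^sub>R b)" by (simp add: euclidean_representation)
    also have "\<dots> = (\<Sum>b\<in>Basis. g b x *\<^sub>R b)" using elim by (intro sum.cong) auto
    finally show ?case .
  qed
  moreover have "(\<lambda>x. \<Sum>b\<in>Basis. g b x *\<^sub>R b) \<in> borel_measurable lborel"
    by (intro borel_measurable_sum borel_measurable_scaleR g(1) borel_measurable_const)
  ultimately show ?thesis by (intro bexI[of _ "\<lambda>x. \<Sum>b\<in>Basis. g b x *\<^sub>R b"])
qed

lemma L2_integrable:
  fixes w :: "'a::euclidean_space \<Rightarrow> 'b::euclidean_space"
  assumes "L2 \<Omega> w" "open \<Omega>" "bounded \<Omega>"
  shows "integrable (lebesgue_on \<Omega>) w"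
proof -
  have "\<Omega> \<in> lmeasurable" using bounded_set_imp_lmeasurable[OF assms(3)] assms(2) by simp
  then have "integrable (lebesgue_on \<Omega>) (\<lambda>x. 1::real)"
    by (rule finite_measure.integrable_const[OF finite_measure_lebesgue_on])
  then have "integrable (lebesgue_on \<Omega>) (\<lambda>x. 1 + (norm (w x))\<^sup>2)"
    using assms(1) by (auto simp: L2_def)
  then show ?thesis
  proof (rule Bochner_Integration.integrable_bound)
    show "w \<in> borel_measurable (lebesgue_on \<Omega>)" using assms(1) by (simp add: L2_def)
    have "s \<le> 1 + s\<^sup>2" if "0 \<le> s" for s :: real
      using zero_le_power2[of "s - 1/2"] by (simp add: power2_eq_square algebra_simps)
    then show "AE x in lebesgue_on \<Omega>. norm (w x) \<le> norm (1 + (norm (w x))\<^sup>2)"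
      by (intro AE_I2) auto
  qed
qed

text \<open>
  Extended by zero and made Borel measurable, a function and its weak gradient can be used in
  convolutions, where Fubini's theorem is applied to \<open>lborel\<close> rather than to its completion.
\<close>

lemma H1_borel_representative:
  fixes \<Omega> :: "'a::euclidean_space set"
  assumes \<Omega>: "open \<Omega>" "bounded \<Omega>" and H: "H1_with_grad \<Omega> w G"
  obtains w' G' where "mollifier_grad \<Omega> w' G'" "AE x in lebesgue_on \<Omega>. w x = w' x \<and> G x = G' x"
proof -
  have \<Omega>m: "\<Omega> \<in> sets lebesgue" using \<Omega> by simp
  have wi: "integrable (lebesgue_on \<Omega>) w" and Gi: "integrable (lebesgue_on \<Omega>) G"
    using H L2_integrable[OF _ \<Omega>] unfolding H1_with_grad_def by blast+
  have wi': "integrable lebesgue (\<lambda>x. indicator \<Omega> x *\<^sub>R w x)" and Gi': "integrable lebesgue (\<lambda>x. indicator \<Omega> x *\<^sub>R G x)"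
    using wi Gi \<Omega>m integrable_restrict_space[of \<Omega> lebesgue w] integrable_restrict_space[of \<Omega> lebesgue G] by auto
  obtain w' where w': "w' \<in> borel_measurable lborel" "AE x in lborel. indicator \<Omega> x *\<^sub>R w x = w' x"
    using borel_representative[OF borel_measurable_integrable[OF wi']] by blast
  obtain G' where G': "G' \<in> borel_measurable lborel" "AE x in lborel. indicator \<Omega> x *\<^sub>R G x = G' x"
    using borel_representative[OF borel_measurable_integrable[OF Gi']] by blast
  note aew = AE_completion[OF w'(2)] and aeG = AE_completion[OF G'(2)]
  have mw: "w' \<in> borel_measurable lebesgue" "G' \<in> borel_measurable lebesgue"
    using w' G' by (auto intro: measurable_completion)
  have "integrable lebesgue w'" "integrable lebesgue G'"
    using integrable_cong_AE[OF borel_measurable_integrable[OF wi'] mw(1) aew] wi'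
      integrable_cong_AE[OF borel_measurable_integrable[OF Gi'] mw(2) aeG] Gi' by auto
  then have i: "integrable lborel w'" "integrable lborel G'"
    using integrable_completion[OF w'(1)] integrable_completion[OF G'(1)] by auto
  have "mollify r G' x = (LINT y|lborel. w' y *\<^sub>R moll_grad r (x - y))" if r: "0 < r" "cball x r \<subseteq> \<Omega>" for x r
  proof -
    have [measurable]: "w' \<in> borel_measurable borel" "G' \<in> borel_measurable borel" using w' G' by auto
    have "(LINT y|lebesgue_on \<Omega>. w y *\<^sub>R grad (\<lambda>y. moll r (x - y)) y) = - (LINT y|lebesgue_on \<Omega>. moll r (x - y) *\<^sub>R G y)"
      using H test_function_moll[OF r] unfolding H1_with_grad_def by blast
    then have e: "(LINT y|lebesgue_on \<Omega>. w y *\<^sub>R moll_grad r (x - y)) = (LINT y|lebesgue_on \<Omega>. moll r (x - y) *\<^sub>R G y)"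
      by (simp add: grad_moll_shift)
    have "(LINT y|lebesgue_on \<Omega>. w y *\<^sub>R moll_grad r (x - y)) = (LINT y|lebesgue. w' y *\<^sub>R moll_grad r (x - y))"
    proof -
      have "(LINT y|lebesgue_on \<Omega>. w y *\<^sub>R moll_grad r (x - y)) = (LINT y|lebesgue. indicator \<Omega> y *\<^sub>R (w y *\<^sub>R moll_grad r (x - y)))"
        using \<Omega>m by (intro integral_restrict_space) simp
      also have "\<dots> = (LINT y|lebesgue. w' y *\<^sub>R moll_grad r (x - y))"
      proof (rule integral_cong_AE)
        have m1: "(\<lambda>y. moll_grad r (x - y)) \<in> borel_measurable lebesgue" by (intro measurable_completion) measurable
        show "(\<lambda>y. indicator \<Omega> y *\<^sub>R (w y *\<^sub>R moll_grad r (x - y))) \<in> borel_measurable lebesgue"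
          using borel_measurable_scaleR[OF borel_measurable_integrable[OF wi'] m1] by simp
        show "(\<lambda>y. w' y *\<^sub>R moll_grad r (x - y)) \<in> borel_measurable lebesgue" by (rule borel_measurable_scaleR[OF mw(1) m1])
        show "AE y in lebesgue. indicator \<Omega> y *\<^sub>R (w y *\<^sub>R moll_grad r (x - y)) = w' y *\<^sub>R moll_grad r (x - y)"
          using aew
        proof eventually_elim
          case (elim y) show ?case unfolding elim[symmetric] by simp
        qed
      qed
      finally show ?thesis .
    qed
    moreover have "\<dots> = (LINT y|lborel. w' y *\<^sub>R moll_grad r (x - y))"
      by (rule integral_completion) measurable
    moreover have "(LINT y|lebesgue_on \<Omega>. moll r (x - y) *\<^sub>R G y) = (LINT y|lebesgue. moll r (x - y) *\<^sub>R G' y)"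
    proof -
      have "(LINT y|lebesgue_on \<Omega>. moll r (x - y) *\<^sub>R G y) = (LINT y|lebesgue. indicator \<Omega> y *\<^sub>R (moll r (x - y) *\<^sub>R G y))"
        using \<Omega>m by (intro integral_restrict_space) simp
      also have "\<dots> = (LINT y|lebesgue. moll r (x - y) *\<^sub>R G' y)"
      proof (rule integral_cong_AE)
        have m1: "(\<lambda>y. moll r (x - y)) \<in> borel_measurable lebesgue" by (intro measurable_completion) measurable
        show "(\<lambda>y. indicator \<Omega> y *\<^sub>R (moll r (x - y) *\<^sub>R G y)) \<in> borel_measurable lebesgue"
          using borel_measurable_scaleR[OF m1 borel_measurable_integrable[OF Gi']] by (simp add: mult.commute)
        show "(\<lambda>y. moll r (x - y) *\<^sub>R G' y) \<in> borel_measurable lebesgue" by (rule borel_measurable_scaleR[OF m1 mw(2)])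
        show "AE y in lebesgue. indicator \<Omega> y *\<^sub>R (moll r (x - y) *\<^sub>R G y) = moll r (x - y) *\<^sub>R G' y"
          using aeG
        proof eventually_elim
          case (elim y) show ?case unfolding elim[symmetric] by simp
        qed
      qed
      finally show ?thesis .
    qed
    moreover have "\<dots> = mollify r G' x" unfolding mollify_def
      by (rule integral_completion) measurable
    ultimately show ?thesis using e by simp
  qed
  then have "mollifier_grad \<Omega> w' G'" using i by (auto simp: mollifier_grad_def)
  moreover have "AE x in lebesgue_on \<Omega>. w x = w' x \<and> G x = G' x"
    using aew aeG \<Omega>m by (subst AE_restrict_space_iff) (auto elim!: eventually_elim2)
  ultimately show ?thesis using that by blast
qed

text \<open>
  The Poincare inequality for \<open>cutoff a b\<close> of \<open>w\<close>, which differs by \<open>1\<close> between \<open>A\<close> and \<open>Z\<close>.  The sets contain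
  the sublevel set and the superlevel set of \<open>w\<close> up to null sets; they are introduced because the level
  sets themselves need not be Borel.
\<close>

lemma level_set_estimate:
  fixes \<Omega> :: "'a::euclidean_space set"
  assumes \<Omega>: "open \<Omega>" "connected \<Omega>" "bounded \<Omega>" "Ck_boundary (Suc (Suc k)) \<Omega>"
  shows "\<exists>c\<ge>0. \<forall>w G a b. H1_with_grad \<Omega> w G \<and> a < b \<longrightarrow>
    (\<exists>A Z. A \<in> sets borel \<and> Z \<in> sets borel \<and> A \<subseteq> \<Omega> \<and> Z \<subseteq> \<Omega> \<and>
      (AE x in lebesgue_on \<Omega>. w x \<le> a \<longrightarrow> x \<in> A) \<and> (AE x in lebesgue_on \<Omega>. b \<le> w x \<longrightarrow> x \<in> Z) \<and>
      emeasure lborel A * emeasure lborel Z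
        \<le> ennreal (c / (b - a)) * (\<integral>\<^sup>+x. ennreal (indicator {a<..<b} (w x) * norm (G x)) \<partial>lebesgue_on \<Omega>))"
proof -
  obtain C where C: "C \<ge> 0" "\<And>h N. seg_bound \<Omega> h N \<Longrightarrow> osc h \<Omega> \<Omega> \<le> ennreal C * N"
    using domain_linked[OF \<Omega>] unfolding linked_def by blast
  define c0 where "c0 = diameter \<Omega> * (2 ^ DIM('a) * (measure lborel \<Omega> + measure lborel \<Omega>))"
  have d0: "0 \<le> diameter \<Omega>" by (rule diameter_ge_0[OF \<Omega>(3)])
  have c0: "0 \<le> c0" unfolding c0_def using d0 by (intro mult_nonneg_nonneg add_nonneg_nonneg) auto
  have em: "emeasure lborel \<Omega> = ennreal (measure lborel \<Omega>)"
    using emeasure_bounded_finite[OF \<Omega>(3)] by (intro emeasure_eq_ennreal_measure) auto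
  have c0e: "ennreal (diameter \<Omega>) * (2 ^ DIM('a) * (emeasure lborel \<Omega> + emeasure lborel \<Omega>)) = ennreal c0"
    unfolding c0_def em using d0 by (simp add: ennreal_mult ennreal_power[symmetric] flip: ennreal_plus)
  show ?thesis
  proof (intro exI[of _ "C * c0 * 4"] conjI allI impI)
    show "0 \<le> C * c0 * 4" using C c0 by simp
    fix w G and a b :: real
    assume H: "H1_with_grad \<Omega> w G \<and> a < b"
    then have ab: "a < b" by simp
    obtain w' G' where W: "mollifier_grad \<Omega> w' G'" "AE x in lebesgue_on \<Omega>. w x = w' x \<and> G x = G' x"
      using H1_borel_representative[OF \<Omega>(1,3)] H by blast
    have [measurable]: "w' \<in> borel_measurable borel" "G' \<in> borel_measurable borel" using W(1) by (auto simp: mollifier_grad_def)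
    have [measurable]: "\<Omega> \<in> sets borel" using \<Omega> by simp
    define h where "h x = cutoff a b (w' x)" for x
    have "continuous_on UNIV (cutoff a b)"
      using cutoff_has_derivative[OF ab] DERIV_isCont by (blast intro: continuous_at_imp_continuous_on)
    then have [measurable]: "cutoff a b \<in> borel_measurable borel" by (rule borel_measurable_continuous_onI)
    have hm [measurable]: "h \<in> borel_measurable borel" unfolding h_def by measurable
    have [measurable]: "cutoff_deriv a b \<in> borel_measurable borel"
      using cutoff_deriv_continuous by (rule borel_measurable_continuous_onI)
    have bd: "\<bar>cutoff_deriv a b t\<bar> \<le> 4 / (b - a)" for t
      using order_trans[OF cutoff_deriv_bound[OF ab, of t], of "4 / (b - a)"] ab
      by (cases "t \<in> {a<..<b}") auto
    let ?I = "\<integral>\<^sup>+x. indicator \<Omega> x * ennreal (\<bar>cutoff_deriv a b (w' x)\<bar> * norm (G' x)) \<partial>lborel"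
    let ?J = "\<integral>\<^sup>+x. ennreal (indicator {a<..<b} (w x) * norm (G x)) \<partial>lebesgue_on \<Omega>"
    have "seg_bound \<Omega> h (ennreal c0 * ?I)"
      using seg_bound_compose[OF W(1) cutoff_has_derivative[OF ab] cutoff_deriv_continuous bd _ \<Omega>(1,3)] ab
      unfolding h_def c0e by simp
    from C(2)[OF this] have oscb: "osc h \<Omega> \<Omega> \<le> ennreal C * (ennreal c0 * ?I)" .
    have IJ: "?I \<le> ennreal (4 / (b - a)) * ?J"
    proof -
      have "?I = (\<integral>\<^sup>+x. indicator \<Omega> x * ennreal (\<bar>cutoff_deriv a b (w' x)\<bar> * norm (G' x)) \<partial>lebesgue)"
        by (simp add: nn_integral_completion)
      also have "\<dots> = (\<integral>\<^sup>+x. ennreal (\<bar>cutoff_deriv a b (w' x)\<bar> * norm (G' x)) \<partial>lebesgue_on \<Omega>)"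
        by (subst nn_integral_restrict_space) (auto simp: mult.commute)
      also have "\<dots> \<le> (\<integral>\<^sup>+x. ennreal (4 / (b - a)) * ennreal (indicator {a<..<b} (w' x) * norm (G' x)) \<partial>lebesgue_on \<Omega>)"
      proof (intro nn_integral_mono)
        fix x
        have "\<bar>cutoff_deriv a b (w' x)\<bar> * norm (G' x) \<le> (4 / (b - a) * indicator {a<..<b} (w' x)) * norm (G' x)"
          by (intro mult_right_mono cutoff_deriv_bound ab) simp
        then show "ennreal (\<bar>cutoff_deriv a b (w' x)\<bar> * norm (G' x)) \<le> ennreal (4 / (b - a)) * ennreal (indicator {a<..<b} (w' x) * norm (G' x))"
          using ab by (subst ennreal_mult[symmetric]) (auto simp: ac_simps intro!: ennreal_leI)
      qed
      also have "\<dots> = ennreal (4 / (b - a)) * (\<integral>\<^sup>+x. ennreal (indicator {a<..<b} (w' x) * norm (G' x)) \<partial>lebesgue_on \<Omega>)"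
      proof (rule nn_integral_cmult)
        have "(\<lambda>x. ennreal (indicator {a<..<b} (w' x) * norm (G' x))) \<in> borel_measurable lebesgue"
          by (intro measurable_completion) measurable
        then show "(\<lambda>x. ennreal (indicator {a<..<b} (w' x) * norm (G' x))) \<in> borel_measurable (lebesgue_on \<Omega>)"
          by (rule measurable_restrict_space1)
      qed
      also have "(\<integral>\<^sup>+x. ennreal (indicator {a<..<b} (w' x) * norm (G' x)) \<partial>lebesgue_on \<Omega>) = ?J"
      proof (rule nn_integral_cong_AE)
        show "AE x in lebesgue_on \<Omega>. ennreal (indicator {a<..<b} (w' x) * norm (G' x)) = ennreal (indicator {a<..<b} (w x) * norm (G x))"
          using W(2) by eventually_elim simp
      qed
      finally show ?thesis .
    qed
    define A where "A = {x\<in>\<Omega>. h x = 1}"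
    define Z where "Z = {x\<in>\<Omega>. h x = 0}"
    have AZ [measurable]: "A \<in> sets borel" "Z \<in> sets borel"
      unfolding A_def Z_def by measurable
    have "emeasure lborel A * emeasure lborel Z = osc h A Z"
    proof -
      have "osc h A Z = (\<integral>\<^sup>+x. indicator A x * (\<integral>\<^sup>+y. indicator Z y * ennreal \<bar>h x - h y\<bar> \<partial>lborel) \<partial>lborel)"
        by (rule osc_iterated) auto
      also have "\<dots> = (\<integral>\<^sup>+x. emeasure lborel Z * indicator A x \<partial>lborel)"
      proof (intro nn_integral_cong)
        fix x
        have "(\<integral>\<^sup>+y. indicator Z y * ennreal \<bar>h x - h y\<bar> \<partial>lborel) = (\<integral>\<^sup>+y. indicator Z y \<partial>lborel)" if "x \<in> A"
          using that by (intro nn_integral_cong) (auto simp: A_def Z_def indicator_def)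
        then show "indicator A x * (\<integral>\<^sup>+y. indicator Z y * ennreal \<bar>h x - h y\<bar> \<partial>lborel) = emeasure lborel Z * indicator A x"
          by (cases "x \<in> A") auto
      qed
      also have "\<dots> = emeasure lborel Z * emeasure lborel A" by (rule nn_integral_cmult_indicator) simp
      finally show ?thesis by (simp add: mult.commute)
    qed
    also have "\<dots> \<le> osc h \<Omega> \<Omega>" by (rule osc_mono) (auto simp: A_def Z_def)
    also have "\<dots> \<le> ennreal C * (ennreal c0 * (ennreal (4 / (b - a)) * ?J))"
      by (rule order_trans[OF oscb]) (intro mult_left_mono IJ zero_le)
    also have "\<dots> = ennreal (C * c0 * 4 / (b - a)) * ?J"
    proof -
      have "ennreal (C * c0 * 4 / (b - a)) = ennreal C * (ennreal c0 * ennreal (4 / (b - a)))"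
        using C c0 ab by (simp add: ennreal_mult[symmetric] mult.assoc)
      then show ?thesis by (simp add: mult.assoc)
    qed
    finally have fin: "emeasure lborel A * emeasure lborel Z \<le> ennreal (C * c0 * 4 / (b - a)) * ?J" .
    have inO: "AE x in lebesgue_on \<Omega>. x \<in> \<Omega>" by (rule AE_I2) (simp add: space_restrict_space)
    have aeA: "AE x in lebesgue_on \<Omega>. w x \<le> a \<longrightarrow> x \<in> A"
      using W(2) inO by eventually_elim (auto simp: A_def h_def cutoff_low[OF ab])
    have aeZ: "AE x in lebesgue_on \<Omega>. b \<le> w x \<longrightarrow> x \<in> Z"
      using W(2) inO by eventually_elim (auto simp: Z_def h_def cutoff_high[OF ab])
    show "\<exists>A Z. A \<in> sets borel \<and> Z \<in> sets borel \<and> A \<subseteq> \<Omega> \<and> Z \<subseteq> \<Omega> \<and>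
      (AE x in lebesgue_on \<Omega>. w x \<le> a \<longrightarrow> x \<in> A) \<and> (AE x in lebesgue_on \<Omega>. b \<le> w x \<longrightarrow> x \<in> Z) \<and>
      emeasure lborel A * emeasure lborel Z \<le> ennreal (C * c0 * 4 / (b - a)) * ?J"
      using AZ aeA aeZ fin by (intro exI[of _ A] exI[of _ Z]) (auto simp: A_def Z_def)
  qed
qed

section \<open>The nonlinearity and the entropy density\<close>

text \<open>
  The dominating function is Lebesgue measurable, whereas the integrals in \<open>Phi\<close>, \<open>Phi_x\<close> and
  \<open>E_density\<close> are taken with respect to \<open>lborel\<close>.
\<close>

lemma dominated_lborel_integral:
  fixes h :: "real \<Rightarrow> 'b::euclidean_space"
  assumes h: "set_borel_measurable lborel A h" and g: "L1_loc {0..} g" and b: "0 \<le> b" "A \<subseteq> {0<..b}"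
    and le: "AE u in lebesgue_on {0<..}. norm (h u) \<le> g u"
  shows "set_integrable lborel A h" "norm (LINT u:A|lborel. h u) \<le> (LINT u:{0..b}|lebesgue. g u)"
proof -
  have gi: "integrable lebesgue (\<lambda>u. indicator {0..b} u *\<^sub>R g u)"
    using g b unfolding L1_loc_def set_integrable_def by auto
  have ae: "AE u in lebesgue. norm (indicator A u *\<^sub>R h u) \<le> indicator {0..b} u *\<^sub>R g u"
  proof -
    have "AE u in lebesgue. u \<in> {0<..} \<longrightarrow> norm (h u) \<le> g u"
      using le by (subst (asm) AE_restrict_space_iff) auto
    moreover have "AE u in lebesgue. u \<in> {0<..} \<longrightarrow> 0 \<le> g u"
      using calculation by eventually_elim (auto intro: order_trans[OF norm_ge_zero])
    moreover have "AE u in lebesgue. u \<noteq> (0::real)"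
      using AE_lborel_singleton[of "0::real"] by (rule AE_completion)
    ultimately show ?thesis
      by eventually_elim (use b in \<open>auto simp: indicator_def subset_iff\<close>)
  qed
  have hm: "(\<lambda>u. indicator A u *\<^sub>R h u) \<in> borel_measurable lborel"
    using h by (simp add: set_borel_measurable_def)
  have il: "integrable lebesgue (\<lambda>u. indicator A u *\<^sub>R h u)"
    by (rule Bochner_Integration.integrable_bound[OF gi measurable_completion[OF hm]])
      (use ae in \<open>eventually_elim, auto intro: order_trans[OF _ abs_ge_self]\<close>)
  then show i: "set_integrable lborel A h"
    unfolding set_integrable_def using il integrable_completion[OF hm] by simp
  have "norm (LINT u:A|lborel. h u) \<le> (LINT u|lborel. norm (indicator A u *\<^sub>R h u))"
    unfolding set_lebesgue_integral_def by (rule integral_norm_bound)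
  also have "\<dots> = (LINT u|lebesgue. norm (indicator A u *\<^sub>R h u))"
    by (rule integral_completion[symmetric, OF measurable_compose[OF hm borel_measurable_norm]])
  also have "\<dots> \<le> (LINT u:{0..b}|lebesgue. g u)"
    unfolding set_lebesgue_integral_def
    by (rule integral_mono_AE[OF integrable_norm[OF il] gi ae])
  finally show "norm (LINT u:A|lborel. h u) \<le> (LINT u:{0..b}|lebesgue. g u)" .
qed

lemma L1_loc_small:
  fixes g :: "real \<Rightarrow> real" and e :: real
  assumes g: "L1_loc {0..} g" and e: "e > 0"
  shows "\<exists>\<delta>>0. (LINT u:{0..\<delta>}|lebesgue. g u) \<le> e"
proof -
  have gi: "integrable lebesgue (\<lambda>u. indicator {0..1} u *\<^sub>R g u)"
    using g unfolding L1_loc_def set_integrable_def by auto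
  have gm: "integrable lebesgue (\<lambda>u. indicator {0..b} u *\<^sub>R g u)" for b
    using g unfolding L1_loc_def set_integrable_def by auto
  have "(\<lambda>n. LINT u|lebesgue. indicator {0..1 / (real n + 1)} u *\<^sub>R g u) \<longlonglongrightarrow> (LINT u|(lebesgue :: real measure). (0::real))"
  proof (rule integral_dominated_convergence[where w="\<lambda>u. norm (indicator {0..1} u *\<^sub>R g u)"])
    show "integrable lebesgue (\<lambda>u. norm (indicator {0..1} u *\<^sub>R g u))" using gi by (rule integrable_norm)
    show "(\<lambda>u. indicator {0..1 / (real n + 1)} u *\<^sub>R g u) \<in> borel_measurable lebesgue" for n
      using gm by (rule borel_measurable_integrable)
    show "AE u in lebesgue. norm (indicator {0..1 / (real n + 1)} u *\<^sub>R g u) \<le> norm (indicator {0..1} u *\<^sub>R g u)" for n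
      by (intro AE_I2) (auto simp: indicator_def intro: order_trans)
    have "AE u in lebesgue. u \<noteq> (0::real)"
      using AE_lborel_singleton[of "0::real"] by (rule AE_completion)
    then show "AE u in lebesgue. (\<lambda>n. indicator {0..1 / (real n + 1)} u *\<^sub>R g u) \<longlonglongrightarrow> 0"
    proof eventually_elim
      case (elim u)
      have "\<forall>\<^sub>F n in sequentially. indicator {0..1 / (real n + 1)} u *\<^sub>R g u = 0"
      proof (cases "u > 0")
        case True
        have "(\<lambda>n. 1 / (real n + 1)) \<longlonglongrightarrow> 0" using LIMSEQ_inverse_real_of_nat by (simp add: inverse_eq_divide add.commute)
        from order_tendstoD(2)[OF this True] show ?thesis
          by eventually_elim (simp add: indicator_def)
      next
        case False
        with elim show ?thesis by (simp add: indicator_def)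
      qed
      then show ?case by (rule tendsto_eventually)
    qed
  qed simp
  then have "\<forall>\<^sub>F n in sequentially. (LINT u|lebesgue. indicator {0..1 / (real n + 1)} u *\<^sub>R g u) < e"
    using order_tendstoD(2) e by fastforce
  then obtain n where "(LINT u|lebesgue. indicator {0..1 / (real n + 1)} u *\<^sub>R g u) < e"
    by (auto simp: eventually_sequentially)
  then show ?thesis by (intro exI[of _ "1 / (real n + 1)"]) (simp add: set_lebesgue_integral_def)
qed

lemma set_integral_ge_const:
  fixes h :: "real \<Rightarrow> real"
  assumes i: "set_integrable lborel A h" and A: "A \<in> sets borel" and ab: "a \<le> b" "{a<..<b} \<subseteq> A"
    and nn: "\<And>s. s \<in> A \<Longrightarrow> 0 \<le> h s" and ge: "\<And>s. a < s \<Longrightarrow> s < b \<Longrightarrow> c \<le> h s"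
  shows "c * (b - a) \<le> (LINT s:A|lborel. h s)"
proof -
  have "c * (b - a) = (LINT s|lborel. indicator {a<..<b} s *\<^sub>R c)"
    using ab by simp
  also have "\<dots> \<le> (LINT s|lborel. indicator A s *\<^sub>R h s)"
  proof (rule integral_mono)
    show "integrable lborel (\<lambda>s. indicator {a<..<b} s *\<^sub>R c)" using ab by simp
    show "integrable lborel (\<lambda>s. indicator A s *\<^sub>R h s)" using i by (simp add: set_integrable_def)
    fix s show "indicator {a<..<b} s *\<^sub>R c \<le> indicator A s *\<^sub>R h s"
      using nn[of s] ge[of s] ab(2) by (auto simp: indicator_def)
  qed
  finally show ?thesis by (simp add: set_lebesgue_integral_def)
qed

lemma set_integral_le_const:
  fixes h :: "real \<Rightarrow> real"
  assumes i: "set_integrable lborel {a<..<b} h" and ab: "a \<le> b"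
    and le: "\<And>s. a < s \<Longrightarrow> s < b \<Longrightarrow> h s \<le> c"
  shows "(LINT s:{a<..<b}|lborel. h s) \<le> c * (b - a)"
proof -
  have "(LINT s|lborel. indicator {a<..<b} s *\<^sub>R h s) \<le> (LINT s|lborel. indicator {a<..<b} s *\<^sub>R c)"
  proof (rule integral_mono)
    show "integrable lborel (\<lambda>s. indicator {a<..<b} s *\<^sub>R c)" using ab by simp
    show "integrable lborel (\<lambda>s. indicator {a<..<b} s *\<^sub>R h s)" using i by (simp add: set_integrable_def)
    fix s show "indicator {a<..<b} s *\<^sub>R h s \<le> indicator {a<..<b} s *\<^sub>R c"
      using le[of s] by (auto simp: indicator_def)
  qed
  also have "\<dots> = c * (b - a)" using ab by simp
  finally show ?thesis by (simp add: set_lebesgue_integral_def)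
qed

locale nonlinearity =
  fixes \<Omega> :: "'a::euclidean_space set" and f :: "'a \<Rightarrow> real \<Rightarrow> real" and m :: "'a \<Rightarrow> real"
  assumes op: "open \<Omega>" and bdd: "bounded \<Omega>" and adm: "admissible \<Omega> f m"
begin

abbreviation "F \<equiv> (\<lambda>(x, u). f x u)"

lemma compact_closure_domain: "compact (closure \<Omega>)" using bdd by simp

lemma f_cont: "continuous_on (closure \<Omega> \<times> {0<..}) F"
  using adm by (auto simp: admissible_def numeral_2_eq_2)

lemma f_cont_u: "x \<in> closure \<Omega> \<Longrightarrow> continuous_on {0<..} (f x)"
proof -
  assume x: "x \<in> closure \<Omega>"
  have "continuous_on {0<..} (\<lambda>u. F (x, u))"
    by (rule continuous_on_compose2[OF f_cont]) (use x in \<open>auto intro!: continuous_intros\<close>)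
  then show ?thesis by simp
qed

lemma m_cont: "continuous_on (closure \<Omega>) m"
  and m_pos: "x \<in> closure \<Omega> \<Longrightarrow> m x > 0" and m_int: "(LINT x|lebesgue_on \<Omega>. m x) = 1"
  and f_m: "x \<in> closure \<Omega> \<Longrightarrow> f x (m x) = 0"
  using adm by (auto simp: admissible_def numeral_2_eq_2)

lemma nonempty: "\<Omega> \<noteq> {}"
proof
  assume e: "\<Omega> = {}"
  have "(LINT x|lebesgue_on \<Omega>. m x) = 0"
    unfolding e by (rule integral_eq_zero_AE) (simp add: AE_restrict_space_iff)
  then show False using m_int by simp
qed

lemma m_bounds: "\<exists>a>0. \<exists>b. \<forall>x\<in>closure \<Omega>. a \<le> m x \<and> m x \<le> b"
proof -
  have ne: "closure \<Omega> \<noteq> {}" using nonempty by simp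
  obtain x where x: "x \<in> closure \<Omega>" "\<And>y. y \<in> closure \<Omega> \<Longrightarrow> m x \<le> m y"
    using continuous_attains_inf[OF compact_closure_domain ne m_cont] by blast
  obtain z where z: "z \<in> closure \<Omega>" "\<And>y. y \<in> closure \<Omega> \<Longrightarrow> m y \<le> m z"
    using continuous_attains_sup[OF compact_closure_domain ne m_cont] by blast
  show ?thesis using x z m_pos by blast
qed

lemma f_gradient:
  obtains D where "\<And>z. z \<in> \<Omega> \<times> {0<..} \<Longrightarrow> GDERIV F z :> D z"
    "\<And>b. b \<in> Basis \<Longrightarrow> continuous_on (closure \<Omega> \<times> {0<..}) (\<lambda>z. D z \<bullet> b)"
proof -
  have "Ck_upto (Suc (Suc 0)) (\<Omega> \<times> {0<..}) (closure \<Omega> \<times> {0<..}) F"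
    using adm by (simp add: admissible_def numeral_2_eq_2 del: Ck_upto.simps)
  then obtain D where D: "\<forall>z\<in>\<Omega> \<times> {0<..}. GDERIV F z :> D z"
    "\<forall>b\<in>Basis. Ck_upto (Suc 0) (\<Omega> \<times> {0<..}) (closure \<Omega> \<times> {0<..}) (\<lambda>z. D z \<bullet> b)"
    by (subst (asm) Ck_upto.simps(2)) blast
  show ?thesis
  proof (rule that[of D])
    show "GDERIV F z :> D z" if "z \<in> \<Omega> \<times> {0<..}" for z using D that by blast
    show "continuous_on (closure \<Omega> \<times> {0<..}) (\<lambda>z. D z \<bullet> b)" if "b \<in> Basis" for b
      using D(2) that by (auto simp del: Ck_upto.simps(1))
  qed
qed

text \<open>
  In the interior this is part of \<open>C\<^sup>2\<close> regularity.  At a boundary point one passes to the limit in the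
  mean value inequality at interior points, using that the derivative extends continuously.
\<close>

lemma f_u_derivative_continuous:
  "\<And>x u. x \<in> closure \<Omega> \<Longrightarrow> u > 0 \<Longrightarrow> DERIV (f x) u :> f_u f x u"
  "continuous_on (closure \<Omega> \<times> {0<..}) (\<lambda>(x, u). f_u f x u)"
proof -
  obtain D where D: "\<And>z. z \<in> \<Omega> \<times> {0<..} \<Longrightarrow> GDERIV F z :> D z"
    "\<And>b. b \<in> Basis \<Longrightarrow> continuous_on (closure \<Omega> \<times> {0<..}) (\<lambda>z. D z \<bullet> b)" using f_gradient by blast
  define p where "p = (\<lambda>z. D z \<bullet> (0, 1::real))"
  have pc: "continuous_on (closure \<Omega> \<times> {0<..}) p"
    unfolding p_def by (rule D(2)) (simp add: Basis_prod_def)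
  have inner: "DERIV (f x) u :> p (x, u)" if "x \<in> \<Omega>" "u > 0" for x u
  proof -
    have "((\<lambda>u. (x, u)) has_derivative (\<lambda>h. (0, h))) (at u)" by (auto intro!: derivative_eq_intros)
    moreover have "(F has_derivative (\<lambda>h. h \<bullet> D (x, u))) (at (x, u))"
      using D(1)[of "(x, u)"] that by (simp add: gderiv_def)
    ultimately have "((\<lambda>u. F (x, u)) has_derivative (\<lambda>h. (0, h) \<bullet> D (x, u))) (at u)"
      using has_derivative_compose[of "\<lambda>u. (x, u)" "\<lambda>h. (0, h)" u UNIV F "\<lambda>h. h \<bullet> D (x, u)"] by blast
    moreover have "(0, h) \<bullet> D (x, u) = p (x, u) * h" for h
      by (simp add: p_def inner_prod_def)
    ultimately show ?thesis by (simp add: has_field_derivative_def)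
  qed
  have der: "DERIV (f x) u :> p (x, u)" if x: "x \<in> closure \<Omega>" and u: "u > 0" for x u
    unfolding has_field_derivative_def has_derivative_at_alt
  proof (intro conjI allI impI)
    show "bounded_linear ((*) (p (x, u)))" by (rule bounded_linear_mult_right)
    fix e :: real assume e: "e > 0"
    have xu: "(x, u) \<in> closure \<Omega> \<times> {0<..}" using x u by simp
    obtain d where d: "d > 0" "\<And>z. z \<in> closure \<Omega> \<times> {0<..} \<Longrightarrow> dist z (x, u) < d \<Longrightarrow> dist (p z) (p (x, u)) < e"
      using pc[unfolded continuous_on_iff, rule_format, OF xu e] by auto
    define d' where "d' = min (d / 2) (u / 2)"
    have d': "d' > 0" using d u by (simp add: d'_def)
    show "\<exists>d>0. \<forall>y. norm (y - u) < d \<longrightarrow> norm (f x y - f x u - p (x, u) * (y - u)) \<le> e * norm (y - u)"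
    proof (intro exI[of _ d'] conjI allI impI d')
      fix y assume y: "norm (y - u) < d'"
      have ypos: "w > 0" if "\<bar>w - u\<bar> < d'" for w
      proof -
        have "\<bar>w - u\<bar> < u / 2" using that by (simp add: d'_def)
        then show ?thesis using u by linarith
      qed
      obtain X where X: "\<And>n. X n \<in> \<Omega>" "X \<longlonglongrightarrow> x" using x unfolding closure_sequential by blast
      have lim: "(\<lambda>n. f (X n) w) \<longlonglongrightarrow> f x w" if "w > 0" for w
      proof -
        have "(\<lambda>n. F (X n, w)) \<longlonglongrightarrow> F (x, w)"
        proof (rule continuous_on_tendsto_compose[OF f_cont])
          show "(\<lambda>n. (X n, w)) \<longlonglongrightarrow> (x, w)" by (intro tendsto_Pair X tendsto_const)
          show "\<forall>\<^sub>F n in sequentially. (X n, w) \<in> closure \<Omega> \<times> {0<..}"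
            using X(1) closure_subset that by (intro always_eventually) auto
        qed (use x that in auto)
        then show ?thesis by simp
      qed
      have l: "(\<lambda>n. norm (f (X n) y - f (X n) u - p (x, u) * (y - u))) \<longlonglongrightarrow> norm (f x y - f x u - p (x, u) * (y - u))"
        using y u ypos by (intro tendsto_norm tendsto_diff lim tendsto_const) auto
      have "\<forall>\<^sub>F n in sequentially. norm (f (X n) y - f (X n) u - p (x, u) * (y - u)) \<le> e * norm (y - u)"
      proof -
        have "\<forall>\<^sub>F n in sequentially. dist (X n) x < d / 2"
          using X(2) d(1) by (intro tendstoD) auto
        then show ?thesis
        proof eventually_elim
          case (elim n)
          let ?S = "{w. \<bar>w - u\<bar> < d'}"
          have S: "?S = ball u d'" by (auto simp: dist_norm)
          have "norm ((f (X n) y - p (x, u) * y) - (f (X n) u - p (x, u) * u)) \<le> e * norm (y - u)"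
          proof (rule field_differentiable_bound[of ?S _ "\<lambda>w. p (X n, w) - p (x, u)"])
            show "convex ?S" unfolding S by (rule convex_ball)
            fix w assume w: "w \<in> ?S"
            have "DERIV (f (X n)) w :> p (X n, w)" using X(1) ypos w by (intro inner) auto
            then have "DERIV (\<lambda>w. f (X n) w - p (x, u) * w) w :> p (X n, w) - p (x, u)"
              by (auto intro!: derivative_eq_intros)
            then show "((\<lambda>w. f (X n) w - p (x, u) * w) has_field_derivative p (X n, w) - p (x, u)) (at w within ?S)"
              by (rule has_field_derivative_at_within)
            have "dist (X n, w) (x, u) \<le> dist (X n) x + dist w u"
              by (simp add: dist_Pair_Pair sqrt_sum_squares_le_sum)
            also have "\<dots> < d" using elim w by (auto simp: dist_real_def d'_def)
            finally have dd: "dist (X n, w) (x, u) < d" .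
            have "(X n, w) \<in> closure \<Omega> \<times> {0<..}"
              using subsetD[OF closure_subset X(1)[of n]] ypos w by auto
            from d(2)[OF this dd] show "norm (p (X n, w) - p (x, u)) \<le> e"
              by (simp add: dist_real_def)
          qed (use y d' in auto)
          then show ?case by (simp add: algebra_simps)
        qed
      qed
      from tendsto_upperbound[OF l this] show "norm (f x y - f x u - p (x, u) * (y - u)) \<le> e * norm (y - u)"
        by simp
    qed
  qed
  have eq: "f_u f x u = p (x, u)" if "x \<in> closure \<Omega>" "u > 0" for x u
    unfolding f_u_def using der[OF that] by (rule DERIV_imp_deriv)
  show "DERIV (f x) u :> f_u f x u" if "x \<in> closure \<Omega>" "u > 0" for x u
    using der[OF that] eq[OF that] by simp
  show "continuous_on (closure \<Omega> \<times> {0<..}) (\<lambda>(x, u). f_u f x u)"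
    using pc by (rule continuous_on_cong[THEN iffD1, rotated -1]) (auto simp: eq)
qed

lemma f_u_neg: "x \<in> closure \<Omega> \<Longrightarrow> u > 0 \<Longrightarrow> f_u f x u < 0"
  using adm by (simp add: admissible_def)

lemma f_u_bounds:
  assumes "0 < a" "a \<le> b"
  shows "\<exists>l>0. \<exists>L. \<forall>x\<in>closure \<Omega>. \<forall>u\<in>{a..b}. l \<le> - f_u f x u \<and> - f_u f x u \<le> L"
proof -
  let ?K = "closure \<Omega> \<times> {a..b}"
  have K: "compact ?K" "?K \<noteq> {}" using compact_closure_domain nonempty assms by (auto intro: compact_Times)
  have c: "continuous_on ?K (\<lambda>z. - (case z of (x, u) \<Rightarrow> f_u f x u))"
    using assms by (intro continuous_on_minus continuous_on_subset[OF f_u_derivative_continuous(2)]) auto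
  obtain z where z: "z \<in> ?K" "\<And>y. y \<in> ?K \<Longrightarrow> - (case z of (x, u) \<Rightarrow> f_u f x u) \<le> - (case y of (x, u) \<Rightarrow> f_u f x u)"
    using continuous_attains_inf[OF K c] by blast
  obtain w where w: "w \<in> ?K" "\<And>y. y \<in> ?K \<Longrightarrow> - (case y of (x, u) \<Rightarrow> f_u f x u) \<le> - (case w of (x, u) \<Rightarrow> f_u f x u)"
    using continuous_attains_sup[OF K c] by blast
  show ?thesis
  proof (intro exI conjI ballI)
    show "0 < - (case z of (x, u) \<Rightarrow> f_u f x u)" using z(1) assms f_u_neg by auto
    fix x u assume "x \<in> closure \<Omega>" "u \<in> {a..b}"
    then show "- (case z of (x, u) \<Rightarrow> f_u f x u) \<le> - f_u f x u" "- f_u f x u \<le> - (case w of (x, u) \<Rightarrow> f_u f x u)"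
      using z(2)[of "(x, u)"] w(2)[of "(x, u)"] by auto
  qed
qed

lemma f_slopes:
  assumes "0 < a" "a \<le> b"
  shows "\<exists>l>0. \<exists>L. \<forall>x\<in>closure \<Omega>. \<forall>u\<in>{a..b}. \<forall>v\<in>{a..b}. u \<le> v \<longrightarrow>
    l * (v - u) \<le> f x u - f x v \<and> f x u - f x v \<le> L * (v - u)"
proof -
  obtain l L where l: "l > 0" "\<And>x u. x \<in> closure \<Omega> \<Longrightarrow> u \<in> {a..b} \<Longrightarrow> l \<le> - f_u f x u \<and> - f_u f x u \<le> L"
    using f_u_bounds[OF assms] by blast
  have "l * (v - u) \<le> f x u - f x v \<and> f x u - f x v \<le> L * (v - u)"
    if x: "x \<in> closure \<Omega>" and uv: "u \<in> {a..b}" "v \<in> {a..b}" "u \<le> v" for x u v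
  proof (cases "u = v")
    case False
    then have "u < v" using uv by simp
    then obtain z where z: "u < z" "z < v" "f x v - f x u = (v - u) * f_u f x z"
      using MVT2[of u v "f x" "f_u f x"] f_u_derivative_continuous(1)[OF x] uv assms by auto
    have "l \<le> - f_u f x z" "- f_u f x z \<le> L" using l(2)[OF x, of z] z uv by auto
    then have "(v - u) * l \<le> (v - u) * (- f_u f x z)" "(v - u) * (- f_u f x z) \<le> (v - u) * L"
      using uv by (intro mult_left_mono; simp)+
    then show ?thesis using z(3) by (simp add: mult.commute)
  qed simp
  with l(1) show ?thesis by blast
qed

lemma f_antimono: "x \<in> closure \<Omega> \<Longrightarrow> 0 < u \<Longrightarrow> u \<le> v \<Longrightarrow> f x v \<le> f x u"
proof -
  assume x: "x \<in> closure \<Omega>" and u: "0 < u" "u \<le> v"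
  have "\<exists>d. DERIV (f x) w :> d \<and> d \<le> 0" if "u \<le> w" for w
    using f_u_derivative_continuous(1)[OF x, of w] f_u_neg[OF x, of w] that u by (intro exI[of _ "f_u f x w"]) auto
  then show ?thesis by (intro DERIV_nonpos_imp_nonincreasing[OF u(2)])
qed

lemma f_sign: "x \<in> closure \<Omega> \<Longrightarrow> 0 < u \<Longrightarrow> u \<le> m x \<Longrightarrow> 0 \<le> f x u"
  "x \<in> closure \<Omega> \<Longrightarrow> m x \<le> u \<Longrightarrow> f x u \<le> 0"
  using f_antimono[of x u "m x"] f_antimono[of x "m x" u] f_m[of x] m_pos[of x] by auto

lemma f_dominated: "\<exists>g1. L1_loc {0..} g1 \<and> (\<forall>x\<in>closure \<Omega>. AE u in lebesgue_on {0<..}. norm (f x u) \<le> g1 u)"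
  using adm by (simp add: admissible_def)

lemma f_set_measurable: "x \<in> closure \<Omega> \<Longrightarrow> A \<in> sets borel \<Longrightarrow> A \<subseteq> {0<..} \<Longrightarrow> set_borel_measurable lborel A (f x)"
proof -
  assume x: "x \<in> closure \<Omega>" and A: "A \<in> sets borel" "A \<subseteq> {0<..}"
  show ?thesis
    using borel_measurable_continuous_on_indicator[OF A(1) continuous_on_subset[OF f_cont_u[OF x] A(2)]]
    by (simp add: set_borel_measurable_def)
qed

lemma f_set_integrable:
  assumes x: "x \<in> closure \<Omega>" and ab: "0 \<le> a" "a \<le> b"
  shows "set_integrable lborel {a<..<b} (f x)"
proof -
  obtain g1 where g1: "L1_loc {0..} g1" "AE u in lebesgue_on {0<..}. norm (f x u) \<le> g1 u"
    using f_dominated x by blast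
  show ?thesis
    by (rule dominated_lborel_integral(1)[OF f_set_measurable[OF x] g1(1) _ _ g1(2), of _ b]) (use ab in auto)
qed

lemma E_density_integral: "E_density f m x u = (if m x \<le> u then (LINT s:{m x<..<u}|lborel. - f x s) else (LINT s:{u<..<m x}|lborel. f x s))"
  unfolding E_density_def interval_lebesgue_integral_def
  by (simp add: set_lebesgue_integral_def)

text \<open>
  On \<open>(m x, u)\<close> the integrand \<open>- f\<close> is nonnegative and increasing, so its integral is at least that of its
  value at \<open>c\<close> over \<open>(c, u)\<close>.  With \<open>c\<close> halfway between \<open>m x\<close> and \<open>u\<close> this yields a quadratic lower bound, with
  \<open>c\<close> fixed and large a linear one of large slope.
\<close>

lemma E_lower_above_m:
  assumes x: "x \<in> closure \<Omega>" and c: "m x \<le> c" "c \<le> u"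
  shows "- f x c * (u - c) \<le> E_density f m x u"
proof -
  have "set_integrable lborel {m x<..<u} (\<lambda>s. - f x s)"
    using f_set_integrable[OF x, of "m x" u] m_pos[OF x] c unfolding set_integrable_def by simp
  then have "- f x c * (u - c) \<le> (LINT s:{m x<..<u}|lborel. - f x s)"
  proof (rule set_integral_ge_const)
    show "0 \<le> - f x s" if "s \<in> {m x<..<u}" for s using f_sign(2)[OF x, of s] that by auto
    show "- f x c \<le> - f x s" if "c < s" "s < u" for s using f_antimono[OF x, of c s] that c m_pos[OF x] by auto
  qed (use c in auto)
  then show ?thesis using c by (simp add: E_density_integral)
qed

lemma E_lower_below_m:
  assumes x: "x \<in> closure \<Omega>" and c: "0 \<le> u" "u \<le> c" "c \<le> m x" "0 < c"
  shows "f x c * (c - u) \<le> E_density f m x u"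
proof (cases "u = m x")
  case True
  then show ?thesis using c by (simp add: E_density_integral set_lebesgue_integral_def)
next
  case False
  have "set_integrable lborel {u<..<m x} (f x)"
    using f_set_integrable[OF x, of u "m x"] c by simp
  then have "f x c * (c - u) \<le> (LINT s:{u<..<m x}|lborel. f x s)"
  proof (rule set_integral_ge_const)
    show "0 \<le> f x s" if "s \<in> {u<..<m x}" for s using f_sign(1)[OF x, of s] that c by auto
    show "f x c \<le> f x s" if "u < s" "s < c" for s using f_antimono[OF x, of s c] that c by auto
  qed (use c in auto)
  then show ?thesis using c False by (simp add: E_density_integral)
qed

lemma E_nonneg: "x \<in> closure \<Omega> \<Longrightarrow> 0 \<le> u \<Longrightarrow> 0 \<le> E_density f m x u"
  using E_lower_above_m[of x "m x" u] E_lower_below_m[of x u "m x"] f_m[of x] m_pos[of x] by (cases "m x \<le> u") auto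

text \<open>
  Convexity of the entropy density, whose derivative in \<open>u\<close> is \<open>- f\<close> and which vanishes at \<open>m x\<close>.
\<close>

lemma E_upper:
  assumes x: "x \<in> closure \<Omega>" and u: "0 < u"
  shows "E_density f m x u \<le> f x u * (m x - u)"
proof (cases "m x \<le> u")
  case True
  have "(LINT s:{m x<..<u}|lborel. - f x s) \<le> - f x u * (u - m x)"
  proof (rule set_integral_le_const[OF _ True])
    show "set_integrable lborel {m x<..<u} (\<lambda>s. - f x s)"
      using f_set_integrable[OF x, of "m x" u] m_pos[OF x] True unfolding set_integrable_def by simp
    show "- f x s \<le> - f x u" if "m x < s" "s < u" for s using f_antimono[OF x, of s u] that m_pos[OF x] by auto
  qed
  then show ?thesis using True by (simp add: E_density_integral algebra_simps)
next
  case False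
  have "(LINT s:{u<..<m x}|lborel. f x s) \<le> f x u * (m x - u)"
  proof (rule set_integral_le_const)
    show "set_integrable lborel {u<..<m x} (f x)"
      using f_set_integrable[OF x, of u "m x"] u False by simp
    show "f x s \<le> f x u" if "u < s" "s < m x" for s using f_antimono[OF x, of u s] that u by auto
  qed (use False in simp)
  then show ?thesis using False by (simp add: E_density_integral)
qed

lemma E_bounded:
  assumes b: "\<And>x. x \<in> closure \<Omega> \<Longrightarrow> m x \<le> b"
  shows "\<exists>C\<ge>0. \<forall>x\<in>closure \<Omega>. \<forall>u\<in>{0..b}. E_density f m x u \<le> C"
proof -
  obtain g1 where g1: "L1_loc {0..} g1" "\<And>x. x \<in> closure \<Omega> \<Longrightarrow> AE u in lebesgue_on {0<..}. norm (f x u) \<le> g1 u"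
    using f_dominated by blast
  have b0: "0 \<le> b"
  proof -
    obtain x where "x \<in> closure \<Omega>" using nonempty closure_subset[of \<Omega>] by auto
    then show ?thesis using b[of x] m_pos[of x] by simp
  qed
  have *: "E_density f m x u \<le> (LINT s:{0..b}|lebesgue. g1 s)" if x: "x \<in> closure \<Omega>" and u: "u \<in> {0..b}" for x u
  proof (cases "m x \<le> u")
    case True
    have "norm (LINT s:{m x<..<u}|lborel. f x s) \<le> (LINT s:{0..b}|lebesgue. g1 s)"
      by (rule dominated_lborel_integral(2)[OF f_set_measurable[OF x] g1(1) b0 _ g1(2)[OF x]]) (use True u b[OF x] m_pos[OF x] in auto)
    then show ?thesis using True unfolding E_density_integral set_lebesgue_integral_def by simp
  next
    case False
    have "norm (LINT s:{u<..<m x}|lborel. f x s) \<le> (LINT s:{0..b}|lebesgue. g1 s)"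
      by (rule dominated_lborel_integral(2)[OF f_set_measurable[OF x] g1(1) b0 _ g1(2)[OF x]]) (use False u b[OF x] m_pos[OF x] in auto)
    then show ?thesis using False unfolding E_density_integral by simp
  qed
  then show ?thesis by (intro exI[of _ "max 0 (LINT s:{0..b}|lebesgue. g1 s)"]) (auto intro: max.coboundedI2)
qed

lemma f_derivatives_dominated: "\<exists>g2. L1_loc {0..} g2 \<and>
   (\<forall>x\<in>\<Omega>. AE u in lebesgue_on {0<..}. norm (u * f_u f x u) \<le> g2 u \<and> norm (u *\<^sub>R f_xu f x u) \<le> g2 u)"
proof -
  obtain g2 where g2: "L1_loc {0..} g2" "\<And>x. x \<in> \<Omega> \<Longrightarrow> AE u in lebesgue_on {0<..}. u * \<bar>f_u f x u\<bar> + u * norm (f_xu f x u) \<le> g2 u"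
    using adm unfolding admissible_def by blast
  have "AE u in lebesgue_on {0<..}. norm (u * f_u f x u) \<le> g2 u \<and> norm (u *\<^sub>R f_xu f x u) \<le> g2 u" if "x \<in> \<Omega>" for x
  proof -
    have pos: "AE u in lebesgue_on {0<..}. 0 < (u::real)" by (rule AE_I2) (simp add: space_restrict_space)
    show ?thesis using g2(2)[OF that] pos
    proof eventually_elim
      case (elim u)
      have "0 \<le> u * \<bar>f_u f x u\<bar>" "0 \<le> u * norm (f_xu f x u)" using elim by auto
      moreover have "norm (u * f_u f x u) = u * \<bar>f_u f x u\<bar>" "norm (u *\<^sub>R f_xu f x u) = u * norm (f_xu f x u)"
        using elim by (auto simp: abs_mult)
      ultimately show ?case using elim(1) by auto
    qed
  qed
  with g2(1) show ?thesis by blast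
qed

lemma Phi_integral: "0 \<le> u \<Longrightarrow> Phi f x u = (LINT s:{0<..<u}|lborel. - (s * f_u f x s))"
  unfolding Phi_def interval_lebesgue_integral_def zero_ereal_def
  by (simp add: set_lebesgue_integral_def)

lemma f_u_cont_u: "x \<in> closure \<Omega> \<Longrightarrow> continuous_on {0<..} (\<lambda>u. u * f_u f x u)"
proof -
  assume x: "x \<in> closure \<Omega>"
  have "continuous_on {0<..} (\<lambda>u. (case (x, u) of (x, u) \<Rightarrow> f_u f x u))"
    by (rule continuous_on_compose2[OF f_u_derivative_continuous(2)]) (use x in \<open>auto intro!: continuous_intros\<close>)
  then show ?thesis by (auto intro!: continuous_intros)
qed

lemma Phi_set_measurable: "x \<in> \<Omega> \<Longrightarrow> set_borel_measurable lborel {0<..<u} (\<lambda>s. s * f_u f x s)"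
proof -
  assume x: "x \<in> \<Omega>"
  have "continuous_on {0<..<u} (\<lambda>s. s * f_u f x s)"
    by (rule continuous_on_subset[OF f_u_cont_u[OF subsetD[OF closure_subset x]]]) auto
  from borel_measurable_continuous_on_indicator[OF _ this] show ?thesis
    by (simp add: set_borel_measurable_def)
qed

lemma Phi_integrable:
  assumes x: "x \<in> \<Omega>" and u: "0 \<le> u"
  shows "set_integrable lborel {0<..<u} (\<lambda>s. - (s * f_u f x s))"
proof -
  obtain g2 where g2: "L1_loc {0..} g2" "AE u in lebesgue_on {0<..}. norm (u * f_u f x u) \<le> g2 u"
    using f_derivatives_dominated x by (auto simp: AE_conj_iff)
  have "set_integrable lborel {0<..<u} (\<lambda>s. s * f_u f x s)"
    by (rule dominated_lborel_integral(1)[OF Phi_set_measurable[OF x] g2(1) u _ g2(2)]) (use u in auto)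
  then show ?thesis unfolding set_integrable_def by simp
qed

lemma Phi_mono:
  assumes x: "x \<in> \<Omega>" and u: "0 \<le> u" "u \<le> v"
  shows "Phi f x u \<le> Phi f x v"
proof -
  have xc: "x \<in> closure \<Omega>" using x closure_subset by blast
  have "(LINT s:{0<..<u}|lborel. - (s * f_u f x s)) \<le> (LINT s:{0<..<v}|lborel. - (s * f_u f x s))"
    unfolding set_lebesgue_integral_def
  proof (rule integral_mono)
    fix s
    show "indicator {0<..<u} s *\<^sub>R - (s * f_u f x s) \<le> indicator {0<..<v} s *\<^sub>R - (s * f_u f x s)"
      using mult_nonneg_nonpos[of s "f_u f x s"] f_u_neg[OF xc, of s] u by (auto simp: indicator_def)
  qed (use Phi_integrable[OF x] u in \<open>auto simp: set_integrable_def\<close>)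
  then show ?thesis using u by (simp add: Phi_integral)
qed

lemma Phi_small:
  assumes "a > 0" shows "\<exists>\<delta>>0. \<forall>x\<in>\<Omega>. Phi f x \<delta> \<le> a"
proof -
  obtain g2 where g2: "L1_loc {0..} g2" "\<And>x. x \<in> \<Omega> \<Longrightarrow> AE u in lebesgue_on {0<..}. norm (u * f_u f x u) \<le> g2 u"
    using f_derivatives_dominated by (auto simp: AE_conj_iff)
  obtain \<delta> where d: "\<delta> > 0" "(LINT u:{0..\<delta>}|lebesgue. g2 u) \<le> a"
    using L1_loc_small[OF g2(1) assms] by blast
  have "Phi f x \<delta> \<le> a" if x: "x \<in> \<Omega>" for x
  proof -
    have "norm (LINT s:{0<..<\<delta>}|lborel. s * f_u f x s) \<le> (LINT u:{0..\<delta>}|lebesgue. g2 u)"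
      by (rule dominated_lborel_integral(2)[OF Phi_set_measurable[OF x] g2(1) _ _ g2(2)[OF x]]) (use d in auto)
    moreover have "Phi f x \<delta> = - (LINT s:{0<..<\<delta>}|lborel. s * f_u f x s)"
      using d by (simp add: Phi_integral set_lebesgue_integral_def)
    ultimately show ?thesis using d(2) by simp
  qed
  with d show ?thesis by blast
qed

lemma Phi_large:
  assumes "b > 0" shows "\<exists>a>0. \<forall>x\<in>\<Omega>. a \<le> Phi f x b"
proof -
  obtain l where l: "l > 0" "\<And>x u. x \<in> closure \<Omega> \<Longrightarrow> u \<in> {b/2..b} \<Longrightarrow> l \<le> - f_u f x u"
    using f_u_bounds[of "b/2" b] assms by auto
  have "(b / 2 * l) * (b - b / 2) \<le> Phi f x b" if x: "x \<in> \<Omega>" for x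
  proof -
    have xc: "x \<in> closure \<Omega>" using x closure_subset by blast
    have "(b / 2 * l) * (b - b / 2) \<le> (LINT s:{0<..<b}|lborel. - (s * f_u f x s))"
    proof (rule set_integral_ge_const)
      show "set_integrable lborel {0<..<b} (\<lambda>s. - (s * f_u f x s))" using Phi_integrable[OF x] assms by simp
      show "0 \<le> - (s * f_u f x s)" if "s \<in> {0<..<b}" for s
        using f_u_neg[OF xc, of s] that by (simp add: mult_le_0_iff)
      show "b / 2 * l \<le> - (s * f_u f x s)" if "b / 2 < s" "s < b" for s
      proof -
        have "b / 2 * l \<le> s * (- f_u f x s)" using l(2)[OF xc, of s] that l(1) assms by (intro mult_mono) auto
        then show ?thesis by simp
      qed
    qed (use assms in auto)
    then show ?thesis using assms by (simp add: Phi_integral)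
  qed
  moreover have "(b / 2 * l) * (b - b / 2) > 0" using assms l by simp
  ultimately show ?thesis by blast
qed

text \<open>
  This is the difference between the flux and \<open>- \<nabla>\<Phi>\<close>.
\<close>

lemma flux_correction_bounded:
  assumes b: "b > 0"
  shows "\<exists>M. \<forall>x\<in>\<Omega>. \<forall>u. 0 < u \<and> u \<le> b \<longrightarrow> norm (Phi_x f x u + u *\<^sub>R f_x f x u) \<le> M"
proof -
  obtain g2 where g2: "L1_loc {0..} g2" "\<And>x. x \<in> \<Omega> \<Longrightarrow> AE u in lebesgue_on {0<..}. norm (u *\<^sub>R f_xu f x u) \<le> g2 u"
    using f_derivatives_dominated by (auto simp: AE_conj_iff)
  obtain h where h: "continuous_on (closure \<Omega> \<times> {0..}) h" "\<And>x u. x \<in> \<Omega> \<Longrightarrow> u > 0 \<Longrightarrow> h (x, u) = u *\<^sub>R f_x f x u"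
    using adm unfolding admissible_def extends_continuously_def by auto
  have "bounded (h ` (closure \<Omega> \<times> {0..b}))"
    by (intro compact_imp_bounded compact_continuous_image compact_Times compact_closure_domain continuous_on_subset[OF h(1)]) auto
  then obtain B where B: "\<And>z. z \<in> closure \<Omega> \<times> {0..b} \<Longrightarrow> norm (h z) \<le> B" by (auto simp: bounded_iff)
  have Px: "norm (Phi_x f x u) \<le> (LINT s:{0..b}|lebesgue. g2 s)" if x: "x \<in> \<Omega>" and u: "0 < u" "u \<le> b" for x u
  proof -
    have eq: "norm (Phi_x f x u) = norm (LINT s:{0<..<u}|lborel. s *\<^sub>R f_xu f x s)"
      unfolding Phi_x_def interval_lebesgue_integral_def zero_ereal_def using u by simp
    \<comment> \<open>If the integrand is not integrable, its integral is \<open>0\<close> by convention, and the bound still holds.\<close>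
    have g0: "0 \<le> (LINT s:{0..b}|lebesgue. g2 s)"
      using dominated_lborel_integral(2)[of "{}" "\<lambda>u. u *\<^sub>R f_xu f x u" g2 b, OF _ g2(1) _ _ g2(2)[OF x]] b
      by (simp add: set_lebesgue_integral_def set_borel_measurable_def)
    show ?thesis
    proof (cases "set_integrable lborel {0<..<u} (\<lambda>s. s *\<^sub>R f_xu f x s)")
      case True
      then have "set_borel_measurable lborel {0<..<u} (\<lambda>s. s *\<^sub>R f_xu f x s)"
        by (simp add: set_integrable_def set_borel_measurable_def)
      moreover have "{0<..<u} \<subseteq> {0<..b}" using u by auto
      ultimately show ?thesis
        using dominated_lborel_integral(2)[OF _ g2(1) _ _ g2(2)[OF x], of "{0<..<u}" b] b eq by simp
    next
      case False
      then have "(LINT s:{0<..<u}|lborel. s *\<^sub>R f_xu f x s) = 0"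
        unfolding set_integrable_def set_lebesgue_integral_def by (rule not_integrable_integral_eq)
      then show ?thesis using eq g0 by simp
    qed
  qed
  have "norm (Phi_x f x u + u *\<^sub>R f_x f x u) \<le> (LINT s:{0..b}|lebesgue. g2 s) + B" if "x \<in> \<Omega>" "0 < u" "u \<le> b" for x u
  proof -
    have "norm (u *\<^sub>R f_x f x u) \<le> B" using B[of "(x, u)"] h(2)[of x u] that closure_subset by auto
    then show ?thesis using Px[OF that] norm_triangle_ineq[of "Phi_x f x u" "u *\<^sub>R f_x f x u"] by linarith
  qed
  then show ?thesis by blast
qed

lemma f_to_minus_infinity: "\<exists>K\<ge>k. \<forall>x\<in>closure \<Omega>. \<forall>u\<ge>K. f x u \<le> c"
proof -
  have "\<forall>\<^sub>F u in at_top. \<forall>x\<in>closure \<Omega>. f x u \<le> c" using adm unfolding admissible_def by blast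
  then obtain N where "\<And>u. u \<ge> N \<Longrightarrow> \<forall>x\<in>closure \<Omega>. f x u \<le> c" by (auto simp: eventually_at_top_linorder)
  then show ?thesis by (intro exI[of _ "max k N"]) auto
qed

lemma f_level_bounded: "K > 0 \<Longrightarrow> \<exists>M. \<forall>x\<in>closure \<Omega>. - M \<le> f x K"
proof -
  assume K: "K > 0"
  have "continuous_on (closure \<Omega>) (\<lambda>x. F (x, K))"
    by (rule continuous_on_compose2[OF f_cont]) (use K in \<open>auto intro!: continuous_intros\<close>)
  then have "continuous_on (closure \<Omega>) (\<lambda>x. f x K)" by simp
  from continuous_attains_inf[OF compact_closure_domain _ this] nonempty obtain x where "\<And>y. y \<in> closure \<Omega> \<Longrightarrow> f x K \<le> f y K" by auto
  then show ?thesis by (intro exI[of _ "- f x K"]) auto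
qed

end

section \<open>Entropy and entropy production\<close>

context nonlinearity
begin

text \<open>
  As \<open>f\<close> tends to \<open>-\<infinity>\<close>, the entropy density grows superlinearly; with this \<open>K\<close> the mass of \<open>v\<close> on
  \<open>{v \<ge> K}\<close> is at most \<open>1/4\<close> when the entropy of \<open>v\<close> is at most \<open>C\<close>.
\<close>

lemma large_values_entropy:
  assumes C: "C > 0"
  shows "\<exists>K>0. (\<forall>x\<in>\<Omega>. m x \<le> K) \<and> (\<forall>x\<in>\<Omega>. \<forall>u\<ge>K. u \<le> E_density f m x u / (4 * C))"
proof -
  obtain a0 b0 where ab: "a0 > 0" "\<And>x. x \<in> closure \<Omega> \<Longrightarrow> a0 \<le> m x \<and> m x \<le> b0" using m_bounds by blast
  obtain K0 where K0: "K0 \<ge> max b0 1" "\<And>x u. x \<in> closure \<Omega> \<Longrightarrow> u \<ge> K0 \<Longrightarrow> f x u \<le> - 8 * C"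
    using f_to_minus_infinity[of "max b0 1" "- 8 * C"] by auto
  have "u \<le> E_density f m x u / (4 * C)" if x: "x \<in> \<Omega>" and u: "u \<ge> 2 * K0" for x u
  proof -
    have xc: "x \<in> closure \<Omega>" using subsetD[OF closure_subset x] .
    have "4 * C * u \<le> 8 * C * (u - K0)" using u C by (simp add: algebra_simps)
    also have "\<dots> \<le> - f x K0 * (u - K0)" using K0(2)[OF xc, of K0] u K0(1) by (intro mult_right_mono) auto
    also have "\<dots> \<le> E_density f m x u" using E_lower_above_m[OF xc, of K0 u] ab(2)[OF xc] K0(1) u by auto
    finally show ?thesis using C by (simp add: field_simps)
  qed
  moreover have "m x \<le> 2 * K0" if "x \<in> \<Omega>" for x
    using ab(2)[OF subsetD[OF closure_subset that]] K0(1) by auto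
  moreover have "2 * K0 > 0" using K0(1) by auto
  ultimately show ?thesis by blast
qed

lemma f_lower_bound: "K > 0 \<Longrightarrow> \<exists>M>0. \<forall>x\<in>\<Omega>. \<forall>u. 0 < u \<and> u \<le> K \<longrightarrow> - M \<le> f x u"
proof -
  assume K: "K > 0"
  obtain M where M: "\<And>x. x \<in> closure \<Omega> \<Longrightarrow> - M \<le> f x K" using f_level_bounded[OF K] by blast
  have "- max M 1 \<le> f x u" if "x \<in> \<Omega>" "0 < u" "u \<le> K" for x u
    using M[OF subsetD[OF closure_subset that(1)]] f_antimono[OF subsetD[OF closure_subset that(1)] that(2,3)] by simp
  then show ?thesis by (intro exI[of _ "max M 1"]) auto
qed

text \<open>
  The level \<open>b\<close> separates the region of small values, where \<open>f \<ge> 2 \<epsilon>\<close>, and \<open>\<kappa>\<close> measures how far below \<open>m\<close>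
  a value must lie for \<open>f\<close> to exceed \<open>\<epsilon>/2\<close>.  All constants are uniform in \<open>x\<close> as the slopes of \<open>f\<close> are
  bounded above and below on compact sets of values.
\<close>

lemma near_equilibrium:
  "\<exists>b>0. \<exists>\<epsilon>>0. \<exists>\<kappa>>0. \<forall>x\<in>\<Omega>. 2 * b \<le> m x \<and> b \<le> m x - \<kappa> \<and> (\<forall>u. 0 < u \<and> u \<le> b \<longrightarrow> 2 * \<epsilon> \<le> f x u)
     \<and> (\<forall>u\<ge>m x - \<kappa>. f x u \<le> \<epsilon> / 2)"
proof -
  obtain a0 b0 where ab: "a0 > 0" "\<And>x. x \<in> closure \<Omega> \<Longrightarrow> a0 \<le> m x \<and> m x \<le> b0" using m_bounds by blast
  obtain x0 where "x0 \<in> closure \<Omega>" using nonempty closure_subset[of \<Omega>] by auto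
  then have "a0 \<le> b0" using ab(2)[of x0] by auto
  define b where "b = a0 / 2"
  have b: "b > 0" "b \<le> b0" using ab \<open>a0 \<le> b0\<close> by (auto simp: b_def)
  obtain l L where l: "l > 0" "\<And>x u v. x \<in> closure \<Omega> \<Longrightarrow> u \<in> {b..b0} \<Longrightarrow> v \<in> {b..b0} \<Longrightarrow> u \<le> v \<Longrightarrow>
      l * (v - u) \<le> f x u - f x v \<and> f x u - f x v \<le> L * (v - u)"
    using f_slopes[OF b] by metis
  define \<epsilon> where "\<epsilon> = l * b / 2"
  define \<kappa> where "\<kappa> = min b (\<epsilon> / (2 * max L 1))"
  have \<epsilon>: "\<epsilon> > 0" using l b by (simp add: \<epsilon>_def)
  have \<kappa>: "\<kappa> > 0" "\<kappa> \<le> b" "max L 1 * \<kappa> \<le> \<epsilon> / 2"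
  proof -
    show "\<kappa> > 0" "\<kappa> \<le> b" using b \<epsilon> by (auto simp: \<kappa>_def)
    have "max L 1 * \<kappa> \<le> max L 1 * (\<epsilon> / (2 * max L 1))" unfolding \<kappa>_def by (intro mult_left_mono) auto
    also have "\<dots> = \<epsilon> / 2" by simp
    finally show "max L 1 * \<kappa> \<le> \<epsilon> / 2" .
  qed
  have "2 * b \<le> m x \<and> b \<le> m x - \<kappa> \<and> (\<forall>u. 0 < u \<and> u \<le> b \<longrightarrow> 2 * \<epsilon> \<le> f x u) \<and> (\<forall>u\<ge>m x - \<kappa>. f x u \<le> \<epsilon> / 2)"
    if x: "x \<in> \<Omega>" for x
  proof -
    have xc: "x \<in> closure \<Omega>" using subsetD[OF closure_subset x] .
    have m: "2 * b \<le> m x" "m x \<le> b0" using ab(2)[OF xc] by (auto simp: b_def)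
    have "l * b \<le> l * (m x - b)" using l m by (intro mult_left_mono) auto
    also have "\<dots> \<le> f x b" using l(2)[OF xc, of b "m x"] m b f_m[OF xc] by auto
    finally have fb: "2 * \<epsilon> \<le> f x b" by (simp add: \<epsilon>_def)
    have "f x (m x - \<kappa>) \<le> L * \<kappa>" using l(2)[OF xc, of "m x - \<kappa>" "m x"] m b \<kappa> f_m[OF xc] by auto
    also have "\<dots> \<le> max L 1 * \<kappa>" using \<kappa> by (intro mult_right_mono) auto
    finally have fk: "f x (m x - \<kappa>) \<le> \<epsilon> / 2" using \<kappa>(3) by linarith
    show ?thesis
    proof (intro conjI allI impI)
      show "2 * b \<le> m x" "b \<le> m x - \<kappa>" using m \<kappa> by auto
      show "2 * \<epsilon> \<le> f x u" if "0 < u \<and> u \<le> b" for u using f_antimono[OF xc, of u b] that fb by auto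
      show "f x u \<le> \<epsilon> / 2" if "u \<ge> m x - \<kappa>" for u
        using f_antimono[OF xc, of "m x - \<kappa>" u] that fk m \<kappa> b by auto
    qed
  qed
  then show ?thesis using b(1) \<epsilon> \<kappa>(1) by blast
qed

text \<open>
  For \<open>\<delta> \<le> u \<le> K\<close> the convexity bound \<open>E + \<mu> (u - m) \<le> - (f - \<mu>) (u - m)\<close> is split by Young's
  inequality, and the quadratic term in \<open>u - m\<close> is absorbed by half of \<open>E\<close>, which is why only \<open>E/2\<close> stands
  on the left.  For large \<open>u\<close> one has \<open>f - \<mu> \<le> - 1\<close>, so \<open>\<bar>f - \<mu>\<bar> \<le> (f - \<mu>)\<^sup>2\<close>.  For \<open>u < \<delta>\<close> the left side is
  merely bounded.
\<close>

lemma pointwise_entropy_bound: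
  assumes \<delta>: "0 < \<delta>" "\<And>x. x \<in> \<Omega> \<Longrightarrow> \<delta> \<le> m x" and M: "0 \<le> M"
  shows "\<exists>C1\<ge>0. \<exists>C2\<ge>0. \<forall>x\<in>\<Omega>. \<forall>u\<ge>0. \<forall>\<mu>. \<bar>\<mu>\<bar> \<le> M \<longrightarrow>
    E_density f m x u / 2 + \<mu> * (u - m x) \<le> C1 * (if u < \<delta> then 1 else 0) + C2 * (u * (f x u - \<mu>)\<^sup>2)"
proof -
  obtain a0 b0 where ab: "a0 > 0" "\<And>x. x \<in> closure \<Omega> \<Longrightarrow> a0 \<le> m x \<and> m x \<le> b0" using m_bounds by blast
  obtain x0 where x0: "x0 \<in> \<Omega>" using nonempty by auto
  have b0: "\<delta> \<le> b0" using \<delta>(2)[OF x0] ab(2)[OF subsetD[OF closure_subset x0]] by simp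
  obtain CE where CE: "CE \<ge> 0" "\<And>x u. x \<in> closure \<Omega> \<Longrightarrow> u \<in> {0..b0} \<Longrightarrow> E_density f m x u \<le> CE"
    using E_bounded[of b0] ab(2) by blast
  obtain K where K: "K \<ge> b0" "\<And>x u. x \<in> closure \<Omega> \<Longrightarrow> u \<ge> K \<Longrightarrow> f x u \<le> - M - 1"
    using f_to_minus_infinity[of b0 "- M - 1"] by blast
  have \<delta>K: "\<delta> \<le> K" using b0 K by simp
  obtain l L where l: "l > 0" "\<And>x u v. x \<in> closure \<Omega> \<Longrightarrow> u \<in> {\<delta>..K} \<Longrightarrow> v \<in> {\<delta>..K} \<Longrightarrow> u \<le> v \<Longrightarrow>
      l * (v - u) \<le> f x u - f x v \<and> f x u - f x v \<le> L * (v - u)"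
    using f_slopes[OF \<delta>(1) \<delta>K] by metis
  define C1 where "C1 = CE + M * b0"
  define C2 where "C2 = max 1 (2 / (l * \<delta>))"
  have C: "0 \<le> C1" "1 \<le> C2" "2 / (l * \<delta>) \<le> C2" using CE M b0 \<delta> by (auto simp: C1_def C2_def)
  have "E_density f m x u / 2 + \<mu> * (u - m x) \<le> C1 * (if u < \<delta> then 1 else 0) + C2 * (u * (f x u - \<mu>)\<^sup>2)"
    if x: "x \<in> \<Omega>" and u: "u \<ge> 0" and \<mu>: "\<bar>\<mu>\<bar> \<le> M" for x u \<mu>
  proof -
    have xc: "x \<in> closure \<Omega>" using subsetD[OF closure_subset x] .
    have m: "\<delta> \<le> m x" "m x \<le> b0" "0 < m x" using \<delta> ab(2)[OF xc] ab(1) x by auto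
    have E0: "0 \<le> E_density f m x u" using E_nonneg[OF xc u] .
    have R0: "0 \<le> u * (f x u - \<mu>)\<^sup>2" using u by simp
    consider "u < \<delta>" | "\<delta> \<le> u" "u \<le> K" | "K < u" by linarith
    then show ?thesis
    proof cases
      case 1
      have "E_density f m x u \<le> CE" using CE(2)[OF xc, of u] 1 u b0 by auto
      moreover have "\<mu> * (u - m x) \<le> M * b0"
      proof -
        have "\<mu> * (u - m x) \<le> \<bar>\<mu>\<bar> * \<bar>u - m x\<bar>" by (metis abs_ge_self abs_mult)
        also have "\<dots> \<le> M * b0" using \<mu> 1 u m M by (intro mult_mono) auto
        finally show ?thesis .
      qed
      moreover have "0 \<le> C2 * (u * (f x u - \<mu>)\<^sup>2)" by (rule mult_nonneg_nonneg[OF _ R0]) (use C in simp)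
      ultimately show ?thesis using 1 E0 by (simp add: C1_def)
    next
      case 2
      define s where "s = u - m x"
      define p where "p = f x u - \<mu>"
      have up: "0 < u" using 2 \<delta> by simp
      have Elow: "l / 4 * s\<^sup>2 \<le> E_density f m x u"
      proof (cases "m x \<le> u")
        case True
        let ?c = "(u + m x) / 2"
        have "l * (?c - m x) \<le> - f x ?c" using l(2)[OF xc, of "m x" ?c] True 2 m f_m[OF xc] by (auto simp: field_simps)
        then have "l * (?c - m x) * (u - ?c) \<le> - f x ?c * (u - ?c)" using True by (intro mult_right_mono) auto
        also have "\<dots> \<le> E_density f m x u" using E_lower_above_m[OF xc, of ?c u] True by auto
        finally show ?thesis by (simp add: s_def power2_eq_square field_simps)
      next
        case False
        let ?c = "(u + m x) / 2"
        have "l * (m x - ?c) \<le> f x ?c" using l(2)[OF xc, of ?c "m x"] False 2 m K f_m[OF xc] by (auto simp: field_simps)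
        then have "l * (m x - ?c) * (?c - u) \<le> f x ?c * (?c - u)" using False by (intro mult_right_mono) auto
        also have "\<dots> \<le> E_density f m x u" using E_lower_below_m[OF xc, of u ?c] False up m by auto
        finally show ?thesis by (simp add: s_def power2_eq_square field_simps)
      qed
      have Eup: "E_density f m x u + \<mu> * s \<le> - (p * s)"
        using E_upper[OF xc up] by (simp add: s_def p_def algebra_simps)
      have sq: "- (p * s) \<le> 2 / l * p\<^sup>2 + l / 8 * s\<^sup>2"
      proof -
        have "0 \<le> (2 / l) * (p + l / 4 * s)\<^sup>2" using l by simp
        also have "\<dots> = 2 / l * p\<^sup>2 + p * s + l / 8 * s\<^sup>2"
          using l(1) by (simp add: power2_eq_square field_simps)
        finally show ?thesis by linarith
      qed
      have "2 / l * p\<^sup>2 \<le> C2 * (u * p\<^sup>2)"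
      proof -
        have "2 / l \<le> 2 / (l * \<delta>) * u" using 2 l \<delta> by (simp add: field_simps)
        also have "\<dots> \<le> C2 * u" using C u by (intro mult_right_mono) auto
        finally have "2 / l * p\<^sup>2 \<le> C2 * u * p\<^sup>2" by (intro mult_right_mono) auto
        then show ?thesis by (simp add: mult.assoc)
      qed
      then have "E_density f m x u / 2 + \<mu> * s \<le> C2 * (u * p\<^sup>2)"
        using Eup sq Elow by linarith
      then show ?thesis using 2 by (simp add: s_def p_def)
    next
      case 3
      define p where "p = f x u - \<mu>"
      have up: "0 < u" using 3 K m by linarith
      have p: "p \<le> - 1" using K(2)[OF xc, of u] 3 \<mu> by (auto simp: p_def)
      have "E_density f m x u + \<mu> * (u - m x) \<le> - p * (u - m x)"
        using E_upper[OF xc up] by (simp add: p_def algebra_simps)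
      also have "\<dots> \<le> - p * u" using p m by (intro mult_left_mono) auto
      also have "\<dots> \<le> p\<^sup>2 * u"
      proof (intro mult_right_mono)
        have "0 \<le> (- p) * (- p - 1)" using p by (intro mult_nonneg_nonneg) auto
        then show "- p \<le> p\<^sup>2" by (simp add: power2_eq_square algebra_simps)
      qed (use u in auto)
      also have "\<dots> \<le> C2 * (u * p\<^sup>2)" using mult_right_mono[OF C(2), of "u * p\<^sup>2"] u by (simp add: mult.commute)
      finally show ?thesis using E0 3 \<delta>K by (simp add: p_def)
    qed
  qed
  then show ?thesis using C by (intro exI[of _ C1] exI[of _ C2] conjI) auto
qed

text \<open>
  The factor \<open>indicator {0<..} (v x)\<close> removes the values of \<open>f\<close> outside the set where it is continuous.
\<close>

lemma f_superposition_measurable: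
  assumes v: "v \<in> borel_measurable (lebesgue_on \<Omega>)"
  shows "(\<lambda>x. indicator {0<..} (v x) * f x (v x)) \<in> borel_measurable (lebesgue_on \<Omega>)"
proof -
  have S: "closure \<Omega> \<times> {0<..} \<in> sets (borel :: ('a \<times> real) measure)"
    by (simp add: borel_prod[symmetric])
  have "(\<lambda>z. indicator (closure \<Omega> \<times> {0<..}) z *\<^sub>R F z) \<in> borel_measurable borel"
    by (rule borel_measurable_continuous_on_indicator[OF S f_cont])
  moreover have "(\<lambda>x. (x, v x)) \<in> measurable (lebesgue_on \<Omega>) (borel \<Otimes>\<^sub>M borel)"
  proof (rule measurable_Pair[OF _ v])
    show "(\<lambda>x. x) \<in> measurable (lebesgue_on \<Omega>) borel"
      by (intro measurable_restrict_space1 measurable_completion) simp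
  qed
  ultimately have "(\<lambda>x. indicator (closure \<Omega> \<times> {0<..}) (x, v x) *\<^sub>R F (x, v x)) \<in> borel_measurable (lebesgue_on \<Omega>)"
    unfolding borel_prod by (rule measurable_compose[rotated])
  then show ?thesis
    by (rule measurable_cong[THEN iffD1, rotated])
      (use closure_subset[of \<Omega>] in \<open>auto simp: indicator_def space_restrict_space\<close>)
qed

text \<open>
  The constant \<open>\<mu>\<close> stands for \<open>f_bar\<close>.  If \<open>\<mu> < - 2 M\<close> or \<open>\<mu> > \<epsilon>\<close>, the reaction part is at least \<open>D0\<close>.
  Otherwise \<open>pointwise_entropy_bound\<close> is integrated, and the measure of \<open>{v < \<delta>}\<close>, which is contained in
  \<open>A\<close> up to a null set, is bounded by the production by means of \<open>level_set_estimate\<close>.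
\<close>

lemma entropy_production_inequality:
  assumes conn: "connected \<Omega>" and bd: "Ck_boundary 2 \<Omega>" and C: "C > 0"
  shows "\<exists>\<gamma>>0. \<forall>v G \<mu>. v \<in> borel_measurable (lebesgue_on \<Omega>) \<and> (AE x in lebesgue_on \<Omega>. 0 \<le> v x) \<and>
     (LINT x|lebesgue_on \<Omega>. v x) = 1 \<and> H1_with_grad \<Omega> (\<lambda>x. Phi f x (v x)) G \<and> entropy f m \<Omega> v \<le> C \<longrightarrow>
     ennreal (\<gamma> * entropy f m \<Omega> v) \<le>
       (\<integral>\<^sup>+x. ennreal (v x * (f x (v x) - \<mu>)\<^sup>2) \<partial>lebesgue_on \<Omega>) +
       (\<integral>\<^sup>+x. ennreal (1 / v x * (norm (flux f G v x))\<^sup>2) \<partial>lebesgue_on {x\<in>\<Omega>. v x > 0})"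
proof -
  let ?N = "lebesgue_on \<Omega>"
  have \<Omega>l: "\<Omega> \<in> lmeasurable" using bounded_set_imp_lmeasurable[OF bdd] op by simp
  have \<Omega>b [measurable]: "\<Omega> \<in> sets borel" using op by simp
  interpret N: finite_measure ?N by (rule finite_measure_lebesgue_on[OF \<Omega>l])
  define V where "V = measure lebesgue \<Omega>"
  have V: "(LINT x|?N. k) = k * V" for k :: real
    using \<Omega>l by (simp add: V_def measure_restrict_space)
  obtain K where K: "K > 0" "\<And>x. x \<in> \<Omega> \<Longrightarrow> m x \<le> K" "\<And>x u. x \<in> \<Omega> \<Longrightarrow> u \<ge> K \<Longrightarrow> u \<le> E_density f m x u / (4 * C)"
    using large_values_entropy[OF C] by blast
  obtain M where M: "M > 0" "\<And>x u. x \<in> \<Omega> \<Longrightarrow> 0 < u \<Longrightarrow> u \<le> K \<Longrightarrow> - M \<le> f x u" using f_lower_bound[OF K(1)] by blast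
  obtain b \<epsilon> \<kappa> where b: "b > 0" "\<epsilon> > 0" "\<kappa> > 0" and beq: "\<And>x. x \<in> \<Omega> \<Longrightarrow> 2 * b \<le> m x" "\<And>x. x \<in> \<Omega> \<Longrightarrow> b \<le> m x - \<kappa>"
      "\<And>x u. x \<in> \<Omega> \<Longrightarrow> 0 < u \<Longrightarrow> u \<le> b \<Longrightarrow> 2 * \<epsilon> \<le> f x u" "\<And>x u. x \<in> \<Omega> \<Longrightarrow> u \<ge> m x - \<kappa> \<Longrightarrow> f x u \<le> \<epsilon> / 2"
    using near_equilibrium by auto
  obtain a where a: "a > 0" "\<And>x. x \<in> \<Omega> \<Longrightarrow> a \<le> Phi f x b" using Phi_large[OF b(1)] by blast
  have a2: "a / 2 > 0" using a by simp
  obtain \<delta>0 where d0: "\<delta>0 > 0" "\<And>x. x \<in> \<Omega> \<Longrightarrow> Phi f x \<delta>0 \<le> a / 2" using Phi_small[OF a2] by blast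
  define \<delta> where "\<delta> = min \<delta>0 b"
  have \<delta>: "0 < \<delta>" "\<delta> \<le> b" "\<And>x. x \<in> \<Omega> \<Longrightarrow> Phi f x \<delta> \<le> a / 2"
  proof -
    show "0 < \<delta>" "\<delta> \<le> b" using d0 b by (auto simp: \<delta>_def)
    fix x assume x: "x \<in> \<Omega>"
    show "Phi f x \<delta> \<le> a / 2" using Phi_mono[OF x, of \<delta> \<delta>0] d0(2)[OF x] d0(1) b(1) by (auto simp: \<delta>_def)
  qed
  define M' where "M' = max (2 * M) \<epsilon>"
  have dm: "\<delta> \<le> m x" if "x \<in> \<Omega>" for x using \<delta>(2) beq(1)[OF that] b(1) by linarith
  have M'0: "0 \<le> M'" using b by (simp add: M'_def)
  obtain C1 C2 where C12: "C1 \<ge> 0" "C2 \<ge> 0" "\<And>x u \<mu>. x \<in> \<Omega> \<Longrightarrow> u \<ge> 0 \<Longrightarrow> \<bar>\<mu>\<bar> \<le> M' \<Longrightarrow>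
    E_density f m x u / 2 + \<mu> * (u - m x) \<le> C1 * (if u < \<delta> then 1 else 0) + C2 * (u * (f x u - \<mu>)\<^sup>2)"
    using pointwise_entropy_bound[OF \<delta>(1) dm M'0] by blast
  obtain Mf0 where Mf0: "\<And>x u. x \<in> \<Omega> \<Longrightarrow> 0 < u \<Longrightarrow> u \<le> b \<Longrightarrow> norm (Phi_x f x u + u *\<^sub>R f_x f x u) \<le> Mf0"
    using flux_correction_bounded[OF b(1)] by blast
  define Mf where "Mf = max Mf0 0"
  have Mf: "0 \<le> Mf" "\<And>x u. x \<in> \<Omega> \<Longrightarrow> 0 < u \<Longrightarrow> u \<le> b \<Longrightarrow> norm (Phi_x f x u + u *\<^sub>R f_x f x u) \<le> Mf"
    using Mf0 by (auto simp: Mf_def intro: max.coboundedI1)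
  have bd': "Ck_boundary (Suc (Suc 0)) \<Omega>" using bd by (simp add: numeral_2_eq_2)
  obtain c where c: "c \<ge> 0" and level: "\<forall>w G a b. H1_with_grad \<Omega> w G \<and> a < b \<longrightarrow>
    (\<exists>A Z. A \<in> sets borel \<and> Z \<in> sets borel \<and> A \<subseteq> \<Omega> \<and> Z \<subseteq> \<Omega> \<and>
      (AE x in lebesgue_on \<Omega>. w x \<le> a \<longrightarrow> x \<in> A) \<and> (AE x in lebesgue_on \<Omega>. b \<le> w x \<longrightarrow> x \<in> Z) \<and>
      emeasure lborel A * emeasure lborel Z
        \<le> ennreal (c / (b - a)) * (\<integral>\<^sup>+x. ennreal (indicator {a<..<b} (w x) * norm (G x)) \<partial>lebesgue_on \<Omega>))"
    using level_set_estimate[OF op conn bdd bd'] by - (erule exE, erule conjE, rule that)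
  have mint: "integrable ?N m"
  proof (rule ccontr)
    assume "\<not> integrable ?N m"
    then have "(LINT x|?N. m x) = 0" by (rule not_integrable_integral_eq)
    then show False using m_int by simp
  qed
  have inO: "AE x in ?N. x \<in> \<Omega>" by (rule AE_I2) (simp add: space_restrict_space)
  have bV: "2 * b * V \<le> 1"
  proof -
    have "(LINT x|?N. 2 * b) \<le> (LINT x|?N. m x)"
      using inO mint by (intro integral_mono_AE) (auto elim!: eventually_mono simp: beq)
    then show ?thesis using V[of "2 * b"] m_int by linarith
  qed
  have Vpos: "0 < V"
  proof -
    have "V \<noteq> 0"
    proof
      assume "V = 0"
      have "(LINT x|?N. m x) \<le> (LINT x|?N. K)"
        using inO mint by (intro integral_mono_AE) (auto elim!: eventually_mono simp: K)
      then have "1 \<le> K * V" using V[of K] m_int by linarith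
      then show False using \<open>V = 0\<close> by simp
    qed
    then show ?thesis using measure_nonneg[of lebesgue \<Omega>] unfolding V_def by linarith
  qed
  define D0 where "D0 = min (3 / 4 * M\<^sup>2) (\<kappa> * V * \<epsilon>\<^sup>2 / 4)"
  have D0: "0 < D0" using M b Vpos by (simp add: D0_def)
  define C4 where "C4 = (1 + Mf / \<delta>) / \<epsilon>\<^sup>2"
  have C4: "0 \<le> C4" unfolding C4_def using Mf(1) \<delta>(1) by (intro divide_nonneg_nonneg) auto
  define C5 where "C5 = 4 * K * (c / (a / 2))"
  have C5: "0 \<le> C5" unfolding C5_def using K c a by (intro mult_nonneg_nonneg divide_nonneg_nonneg) auto
  define C9 where "C9 = 2 * C1 * C5 * (1 + C4) + 2 * C2 + 1"
  have C9: "0 < C9" unfolding C9_def using C12 C5 C4 by (intro add_nonneg_pos add_nonneg_nonneg mult_nonneg_nonneg) auto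
  define \<gamma> where "\<gamma> = min (1 / C9) (D0 / C)"
  have \<gamma>: "0 < \<gamma>" "\<gamma> \<le> 1 / C9" "\<gamma> \<le> D0 / C" using C9 D0 C by (auto simp: \<gamma>_def)
  have main: "ennreal (\<gamma> * entropy f m \<Omega> v) \<le>
       (\<integral>\<^sup>+x. ennreal (v x * (f x (v x) - \<mu>)\<^sup>2) \<partial>?N) +
       (\<integral>\<^sup>+x. ennreal (1 / v x * (norm (flux f G v x))\<^sup>2) \<partial>lebesgue_on {x\<in>\<Omega>. v x > 0})"
    if vm: "v \<in> borel_measurable ?N" and v0: "AE x in ?N. 0 \<le> v x" and v1: "(LINT x|?N. v x) = 1"
      and H: "H1_with_grad \<Omega> (\<lambda>x. Phi f x (v x)) G" and EC: "entropy f m \<Omega> v \<le> C" for v G \<mu>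
  proof -
    let ?E = "\<lambda>x. E_density f m x (v x)"
    let ?e = "entropy f m \<Omega> v"
    let ?Dr = "\<integral>\<^sup>+x. ennreal (v x * (f x (v x) - \<mu>)\<^sup>2) \<partial>?N"
    let ?Df = "\<integral>\<^sup>+x. ennreal (1 / v x * (norm (flux f G v x))\<^sup>2) \<partial>lebesgue_on {x\<in>\<Omega>. v x > 0}"
    have e: "?e = (LINT x|?N. ?E x)" by (simp add: entropy_def)
    show ?thesis
    \<comment> \<open>If the entropy density is not integrable, the entropy is \<open>0\<close> by convention.\<close>
    proof (cases "integrable ?N ?E \<and> ?Dr < top \<and> ?Df < top")
      case False
      have "?e = 0" if "\<not> integrable ?N ?E" using that by (simp add: e not_integrable_integral_eq)
      then show ?thesis using False by (auto simp: not_less top_unique)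
    next
      case True
      then have Ei: "integrable ?N ?E" and Drf: "?Dr < top" and Dff: "?Df < top" by auto
      have vi: "integrable ?N v"
      proof (rule ccontr)
        assume "\<not> integrable ?N v"
        then have "(LINT x|?N. v x) = 0" by (rule not_integrable_integral_eq)
        then show False using v1 by simp
      qed
      have E0: "AE x in ?N. 0 \<le> ?E x"
        using v0 inO
      proof eventually_elim
        case (elim x)
        show ?case by (rule E_nonneg[OF subsetD[OF closure_subset elim(2)] elim(1)])
      qed
      have e0: "0 \<le> ?e" unfolding e using E0 by (rule integral_nonneg_AE)
      define R where "R x = v x * (indicator {0<..} (v x) * f x (v x) - \<mu>)\<^sup>2" for x
      have Rm: "R \<in> borel_measurable ?N"
        unfolding R_def by (intro borel_measurable_times vm borel_measurable_power borel_measurable_diff f_superposition_measurable borel_measurable_const)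
      have Req: "AE x in ?N. v x * (f x (v x) - \<mu>)\<^sup>2 = R x"
        using v0 by eventually_elim (auto simp: R_def indicator_def)
      have R0: "AE x in ?N. 0 \<le> R x" using v0 by eventually_elim (simp add: R_def)
      have DrR: "?Dr = (\<integral>\<^sup>+x. ennreal (R x) \<partial>?N)"
      proof (rule nn_integral_cong_AE)
        show "AE x in ?N. ennreal (v x * (f x (v x) - \<mu>)\<^sup>2) = ennreal (R x)"
          using Req by eventually_elim simp
      qed
      have Ri: "integrable ?N R"
        using Drf unfolding DrR by (intro integrableI_nonneg[OF Rm R0]) simp
      define d where "d = (LINT x|?N. R x)"
      have d0: "0 \<le> d" unfolding d_def using R0 by (rule integral_nonneg_AE)
      have Drd: "?Dr = ennreal d" unfolding DrR d_def using nn_integral_eq_integral[OF Ri R0] .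
      define df where "df = enn2real ?Df"
      have df: "0 \<le> df" unfolding df_def by (rule enn2real_nonneg)
      have Dfd: "?Df = ennreal df" unfolding df_def by (rule ennreal_enn2real[OF Dff, symmetric])
      have E4: "(LINT x|?N. ?E x / (4 * C)) \<le> 1 / 4"
      proof -
        have "(LINT x|?N. ?E x / (4 * C)) = ?e / (4 * C)" by (simp add: e)
        then show ?thesis using EC C by (simp add: divide_le_eq)
      qed
      have goal: "\<gamma> * ?e \<le> d + df"
      proof (cases "\<mu> < - (2 * M)")
        case True
        \<comment> \<open>At least \<open>3/4\<close> of the mass lies on \<open>{v < K}\<close>, where \<open>f - \<mu> \<ge> M\<close>.\<close>
        have "AE x in ?N. v x \<le> ?E x / (4 * C) + R x / M\<^sup>2"
          using v0 inO E0 R0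
        proof eventually_elim
          case (elim x)
          have r: "0 \<le> R x / M\<^sup>2" "0 \<le> ?E x / (4 * C)" using elim C by auto
          show ?case
          proof (cases "v x = 0 \<or> K \<le> v x")
            case True
            then show ?thesis
            proof
              assume "v x = 0"
              with r show ?thesis by simp
            next
              assume "K \<le> v x"
              from K(3)[OF elim(2) this] r show ?thesis by linarith
            qed
          next
            case False
            then have vx: "0 < v x" "v x \<le> K" using elim by auto
            have "M \<le> f x (v x) - \<mu>" using M(2)[OF elim(2) vx] True by simp
            then have "M\<^sup>2 \<le> (f x (v x) - \<mu>)\<^sup>2" using M(1) by (intro power_mono) auto
            then have "v x * M\<^sup>2 \<le> R x" using vx by (simp add: R_def)
            then have "v x \<le> R x / M\<^sup>2" using M(1) by (simp add: pos_le_divide_eq)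
            then show ?thesis using r by linarith
          qed
        qed
        then have "(LINT x|?N. v x) \<le> (LINT x|?N. ?E x / (4 * C) + R x / M\<^sup>2)"
          using vi Ei Ri by (intro integral_mono_AE) auto
        also have "\<dots> = (LINT x|?N. ?E x / (4 * C)) + d / M\<^sup>2"
          using Ei Ri by (simp add: d_def)
        finally have "3 / 4 \<le> d / M\<^sup>2" using v1 E4 by linarith
        then have "3 / 4 * M\<^sup>2 \<le> d" using M(1) by (simp add: field_simps)
        then have "D0 \<le> d" unfolding D0_def by linarith
        moreover have "\<gamma> * ?e \<le> D0 / C * C" using \<gamma> EC e0 by (intro mult_mono) auto
        ultimately show ?thesis using C df by simp
      next
        case mu1: False
        show ?thesis
        proof (cases "\<epsilon> < \<mu>")
          case True
          \<comment> \<open>If \<open>v \<le> m - \<kappa>\<close> everywhere, the mass would be too small; where this fails, \<open>\<mu> - f \<ge> \<epsilon> / 2\<close>.\<close>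
          have "AE x in ?N. v x \<le> (m x - \<kappa>) + 4 / \<epsilon>\<^sup>2 * R x"
            using v0 inO R0
          proof eventually_elim
            case (elim x)
            show ?case
            proof (cases "v x \<le> m x - \<kappa>")
              case True
              then show ?thesis using elim(3) by (simp add: add_increasing2)
            next
              case False
              have mk: "0 < m x - \<kappa>" using beq(2)[OF elim(2)] b(1) by linarith
              have "f x (v x) \<le> \<epsilon> / 2" using beq(4)[OF elim(2), of "v x"] False by simp
              then have "\<epsilon> / 2 \<le> \<mu> - f x (v x)" using True by simp
              then have "(\<epsilon> / 2)\<^sup>2 \<le> (\<mu> - f x (v x))\<^sup>2" using b by (intro power_mono) auto
              then have "v x * (\<epsilon>\<^sup>2 / 4) \<le> v x * (f x (v x) - \<mu>)\<^sup>2"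
                using elim by (intro mult_left_mono) (auto simp: power2_commute power_divide)
              also have "\<dots> = R x" using False mk by (simp add: R_def)
              finally have "v x \<le> 4 / \<epsilon>\<^sup>2 * R x" using b by (simp add: field_simps)
              then show ?thesis using mk by simp
            qed
          qed
          then have "(LINT x|?N. v x) \<le> (LINT x|?N. (m x - \<kappa>) + 4 / \<epsilon>\<^sup>2 * R x)"
            using vi mint Ri by (intro integral_mono_AE) auto
          also have "\<dots> = 1 - \<kappa> * V + 4 / \<epsilon>\<^sup>2 * d"
            using mint Ri V[of \<kappa>] by (simp add: d_def m_int)
          finally have "\<kappa> * V \<le> 4 / \<epsilon>\<^sup>2 * d" using v1 by simp
          then have "\<kappa> * V * \<epsilon>\<^sup>2 / 4 \<le> d" using b by (simp add: field_simps)
          then have "D0 \<le> d" unfolding D0_def by linarith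
          moreover have "\<gamma> * ?e \<le> D0 / C * C" using \<gamma> EC e0 by (intro mult_mono) auto
          ultimately show ?thesis using C df by simp
        next
          case mu2: False
          have mu: "\<bar>\<mu>\<bar> \<le> M'" using mu1 mu2 M b by (auto simp: M'_def)
          let ?w = "\<lambda>x. Phi f x (v x)"
          have aa: "a / 2 < a" using a by simp
          obtain A Z where AZ: "A \<in> sets borel" "Z \<in> sets borel" "A \<subseteq> \<Omega>" "Z \<subseteq> \<Omega>"
            "AE x in ?N. ?w x \<le> a / 2 \<longrightarrow> x \<in> A" "AE x in ?N. a \<le> ?w x \<longrightarrow> x \<in> Z"
            "emeasure lborel A * emeasure lborel Z
              \<le> ennreal (c / (a - a / 2)) * (\<integral>\<^sup>+x. ennreal (indicator {a / 2<..<a} (?w x) * norm (G x)) \<partial>?N)"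
            using level[THEN spec, THEN spec, THEN spec, THEN spec, THEN mp, OF conjI[OF H aa]]
            by - (erule exE, erule exE, (erule conjE)+, rule that)
          have meas: "emeasure lborel S = ennreal (measure lborel S)" "(LINT x|?N. indicator S x) = measure lborel S" "integrable ?N (indicator S :: 'a \<Rightarrow> real)"
            if S: "S \<in> sets borel" "S \<subseteq> \<Omega>" for S
          proof -
            show "emeasure lborel S = ennreal (measure lborel S)"
              using emeasure_bounded_finite[OF bounded_subset[OF bdd S(2)]] by (intro emeasure_eq_ennreal_measure) auto
            have SN: "S \<in> sets ?N" using S op by (simp add: sets_restrict_space_iff)
            show "integrable ?N (indicator S :: 'a \<Rightarrow> real)" using SN by (intro integrable_real_indicator) (auto simp: N.emeasure_finite less_top[symmetric])
            have "(LINT x|?N. indicator S x) = measure ?N S" using SN S by (simp add: space_restrict_space Int_absorb2)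
            also have "\<dots> = measure lebesgue S" using S op by (intro measure_restrict_space) auto
            also have "\<dots> = measure lborel S" using S by (simp add: measure_completion)
            finally show "(LINT x|?N. indicator S x) = measure lborel S" .
          qed
          have Zlow: "1 / (4 * K) \<le> measure lborel Z"
          proof -
            have "AE x in ?N. v x \<le> b + K * indicator Z x + ?E x / (4 * C)"
              using v0 inO E0 AZ(6)
            proof eventually_elim
              case (elim x)
              consider "v x \<le> b" | "b < v x" "v x < K" | "K \<le> v x" by linarith
              then show ?case
              proof cases
                case 1 then show ?thesis using elim(3) K(1) C by (simp add: add_increasing2)
              next
                case 2
                have "a \<le> ?w x" using a(2)[OF elim(2)] Phi_mono[OF elim(2), of b "v x"] 2 b by auto
                then have "x \<in> Z" using elim by blast
                moreover have "0 \<le> ?E x / (4 * C)" using elim(3) C by simp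
                ultimately show ?thesis using 2 b by simp
              next
                case 3
                have "0 \<le> K * indicator Z x" using K(1) by simp
                then show ?thesis using K(3)[OF elim(2) 3] b by linarith
              qed
            qed
            then have "(LINT x|?N. v x) \<le> (LINT x|?N. b + K * indicator Z x + ?E x / (4 * C))"
              using vi Ei meas(3)[OF AZ(2,4)] by (intro integral_mono_AE) auto
            also have "\<dots> = b * V + K * measure lborel Z + (LINT x|?N. ?E x / (4 * C))"
              using Ei meas(2,3)[OF AZ(2,4)] V[of b] by simp
            finally have "1 / 4 \<le> K * measure lborel Z" using v1 E4 bV by linarith
            then show ?thesis using K(1) by (simp add: field_simps)
          qed
          have GJ: "(\<integral>\<^sup>+x. ennreal (indicator {a / 2<..<a} (?w x) * norm (G x)) \<partial>?N) \<le> ennreal (df + C4 * d)"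
          proof -
            define h where "h x = indicator {a / 2<..<a} (?w x) * norm (G x)" for x
            have hm: "h \<in> borel_measurable ?N"
            proof -
              have "?w \<in> borel_measurable ?N" "G \<in> borel_measurable ?N" using H by (auto simp: H1_with_grad_def L2_def)
              then show ?thesis unfolding h_def
                by (intro borel_measurable_times borel_measurable_norm measurable_compose[OF _ borel_measurable_indicator]) auto
            qed
            define P where "P = {x\<in>\<Omega>. v x > 0}"
            have Pl: "P \<in> sets lebesgue"
            proof -
              have "P = {x\<in>space ?N. v x > 0}" by (auto simp: P_def space_restrict_space)
              also have "\<dots> \<in> sets ?N" using vm by measurable
              finally show ?thesis using op by (simp add: sets_restrict_space_iff)
            qed
            \<comment> \<open>\<open>T\<close> is a measurable lower bound of \<open>\<bar>flux\<bar>\<^sup>2 / v\<close> where \<open>v > 0\<close>; its integral is additive, which the lower integral of the flux term may fail to be.\<close>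
            define T where "T x = max 0 (h x - C4 * R x)" for x
            have Tm: "T \<in> borel_measurable ?N" unfolding T_def using hm Rm by measurable
            have hb: "h x \<le> 1 / v x * (norm (flux f G v x))\<^sup>2 + C4 * R x" if x: "x \<in> \<Omega>" and vx: "0 < v x" for x
            proof (cases "?w x \<in> {a / 2<..<a}")
              case False
              then show ?thesis using vx C4 by (auto simp: h_def R_def intro!: add_nonneg_nonneg)
            next
              case True
              have vb: "v x < b"
              proof (rule ccontr)
                assume "\<not> v x < b"
                then have "a \<le> ?w x" using a(2)[OF x] Phi_mono[OF x, of b "v x"] b by auto
                then show False using True by simp
              qed
              have vd: "\<delta> < v x"
              proof (rule ccontr)
                assume "\<not> \<delta> < v x"
                then have "?w x \<le> a / 2" using \<delta>(3)[OF x] Phi_mono[OF x, of "v x" \<delta>] vx by auto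
                then show False using True by simp
              qed
              define q where "q = norm (flux f G v x)"
              have "G x = (Phi_x f x (v x) + v x *\<^sub>R f_x f x (v x)) - flux f G v x" by (simp add: flux_def)
              then have "norm (G x) \<le> norm (Phi_x f x (v x) + v x *\<^sub>R f_x f x (v x)) + q"
                unfolding q_def using norm_triangle_ineq4 by metis
              then have n1: "norm (G x) \<le> Mf + q" using Mf(2)[OF x vx] vb by simp
              have n2: "q \<le> 1 / v x * q\<^sup>2 + v x"
              proof -
                have "0 \<le> (q / v x - 1 / 2)\<^sup>2 * v x + 3 / 4 * v x" using vx by simp
                also have "\<dots> = 1 / v x * q\<^sup>2 - q + v x" using vx by (simp add: power2_eq_square field_simps)
                finally show ?thesis by simp
              qed
              have n3: "Mf \<le> Mf / \<delta> * v x" using vd \<delta>(1) Mf(1) by (simp add: field_simps mult_left_mono)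
              have "\<epsilon> \<le> f x (v x) - \<mu>" using beq(3)[OF x vx] vb mu2 by simp
              then have "\<epsilon>\<^sup>2 \<le> (f x (v x) - \<mu>)\<^sup>2" using b by (intro power_mono) auto
              then have "v x * \<epsilon>\<^sup>2 \<le> R x" using vx by (simp add: R_def)
              then have "v x \<le> R x / \<epsilon>\<^sup>2" using b by (simp add: field_simps)
              then have "(1 + Mf / \<delta>) * v x \<le> (1 + Mf / \<delta>) * (R x / \<epsilon>\<^sup>2)" using Mf(1) \<delta>(1) by (intro mult_left_mono) auto
              then have n4: "v x + Mf / \<delta> * v x \<le> C4 * R x" by (simp add: C4_def algebra_simps add_divide_distrib)
              have "h x = norm (G x)" using True by (simp add: h_def)
              then show ?thesis using n1 n2 n3 n4 unfolding q_def by linarith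
            qed
            have hz: "AE x in ?N. \<not> 0 < v x \<longrightarrow> T x = 0"
              using v0 R0
            proof eventually_elim
              case (elim x)
              show ?case
              proof
                assume "\<not> 0 < v x"
                then have "v x = 0" using elim by simp
                then have "?w x = 0" by (simp add: Phi_integral set_lebesgue_integral_def)
                then have "h x = 0" using a by (simp add: h_def)
                then show "T x = 0" using elim C4 by (simp add: T_def)
              qed
            qed
            have T: "(\<integral>\<^sup>+x. ennreal (T x) \<partial>?N) \<le> ?Df"
            proof -
              have "(\<integral>\<^sup>+x. ennreal (T x) \<partial>?N) = (\<integral>\<^sup>+x. ennreal (T x) * indicator P x \<partial>?N)"
              proof (rule nn_integral_cong_AE)
                show "AE x in ?N. ennreal (T x) = ennreal (T x) * indicator P x"
                  using hz inO by eventually_elim (auto simp: P_def indicator_def)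
              qed
              also have "\<dots> = (\<integral>\<^sup>+x. ennreal (T x) * indicator P x * indicator \<Omega> x \<partial>lebesgue)"
                using op by (intro nn_integral_restrict_space) simp
              also have "\<dots> = (\<integral>\<^sup>+x. ennreal (T x) * indicator P x \<partial>lebesgue)"
                by (intro nn_integral_cong) (auto simp: P_def indicator_def)
              also have "\<dots> = (\<integral>\<^sup>+x. ennreal (T x) \<partial>lebesgue_on P)"
                using Pl by (intro nn_integral_restrict_space[symmetric]) simp
              also have "\<dots> \<le> (\<integral>\<^sup>+x. ennreal (1 / v x * (norm (flux f G v x))\<^sup>2) \<partial>lebesgue_on P)"
              proof (intro nn_integral_mono ennreal_leI)
                fix x assume "x \<in> space (lebesgue_on P)"
                then have x: "x \<in> \<Omega>" "0 < v x" by (auto simp: P_def space_restrict_space)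
                show "T x \<le> 1 / v x * (norm (flux f G v x))\<^sup>2" using hb[OF x] x by (simp add: T_def)
              qed
              finally show ?thesis by (simp add: P_def)
            qed
            have "(\<integral>\<^sup>+x. ennreal (h x) \<partial>?N) \<le> (\<integral>\<^sup>+x. ennreal (T x) + ennreal C4 * ennreal (R x) \<partial>?N)"
            proof (rule nn_integral_mono_AE)
              show "AE x in ?N. ennreal (h x) \<le> ennreal (T x) + ennreal C4 * ennreal (R x)"
                using R0
              proof eventually_elim
                case (elim x)
                have "h x \<le> T x + C4 * R x" by (simp add: T_def)
                moreover have "0 \<le> T x" by (simp add: T_def)
                ultimately show ?case using elim C4 by (simp add: ennreal_leI flip: ennreal_mult ennreal_plus)
              qed
            qed
            also have "\<dots> = (\<integral>\<^sup>+x. ennreal (T x) \<partial>?N) + ennreal C4 * (\<integral>\<^sup>+x. ennreal (R x) \<partial>?N)"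
              using Tm Rm by (simp add: nn_integral_add nn_integral_cmult)
            also have "\<dots> \<le> ennreal df + ennreal C4 * ennreal d"
              using T Dfd Drd DrR by (intro add_mono) auto
            also have "\<dots> = ennreal (df + C4 * d)" using df d0 C4 by (simp add: ennreal_mult ennreal_plus)
            finally show ?thesis by (simp add: h_def)
          qed
          have Abound: "measure lborel A \<le> C5 * (df + C4 * d)"
          proof -
            have "ennreal (measure lborel A * measure lborel Z) \<le> ennreal (c / (a - a / 2)) * ennreal (df + C4 * d)"
              using order_trans[OF AZ(7) mult_left_mono[OF GJ]] meas(1)[OF AZ(1,3)] meas(1)[OF AZ(2,4)]
              by (simp add: ennreal_mult)
            also have "\<dots> = ennreal (c / (a / 2) * (df + C4 * d))"
              using c a df d0 C4 by (subst ennreal_mult) (auto simp: field_simps)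
            finally have "measure lborel A * measure lborel Z \<le> c / (a / 2) * (df + C4 * d)"
              using c a df d0 C4 by (subst (asm) ennreal_le_iff) (auto intro!: mult_nonneg_nonneg)
            moreover have "measure lborel A * (1 / (4 * K)) \<le> measure lborel A * measure lborel Z"
              using Zlow by (intro mult_left_mono) auto
            ultimately have "measure lborel A * (1 / (4 * K)) \<le> c / (a / 2) * (df + C4 * d)" by linarith
            then have "4 * K * (measure lborel A * (1 / (4 * K))) \<le> 4 * K * (c / (a / 2) * (df + C4 * d))"
              using K(1) by (intro mult_left_mono) auto
            then show ?thesis using K(1) by (simp add: C5_def)
          qed
          have "AE x in ?N. ?E x / 2 + \<mu> * (v x - m x) \<le> C1 * indicator A x + C2 * R x"
            using v0 inO AZ(5) Req
          proof eventually_elim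
            case (elim x)
            have "(if v x < \<delta> then 1 else 0) \<le> (indicator A x :: real)"
            proof (cases "v x < \<delta>")
              case True
              then have "?w x \<le> a / 2" using Phi_mono[OF elim(2), of "v x" \<delta>] \<delta>(3)[OF elim(2)] elim(1) by auto
              then have "x \<in> A" using elim(3) by blast
              then show ?thesis by simp
            qed simp
            then have "C1 * (if v x < \<delta> then 1 else 0) \<le> C1 * indicator A x" using C12(1) by (rule mult_left_mono)
            then show ?case using C12(3)[OF elim(2,1) mu] unfolding elim(4) by linarith
          qed
          \<comment> \<open>The term with \<open>\<mu>\<close> integrates to \<open>0\<close>, since \<open>v\<close> and \<open>m\<close> have the same mass.\<close>
          then have "(LINT x|?N. ?E x / 2 + \<mu> * (v x - m x)) \<le> (LINT x|?N. C1 * indicator A x + C2 * R x)"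
            using Ei vi mint Ri meas(3)[OF AZ(1,3)] by (intro integral_mono_AE) auto
          also have "(LINT x|?N. C1 * indicator A x + C2 * R x) = C1 * measure lborel A + C2 * d"
            using Ri meas(2,3)[OF AZ(1,3)] by (simp add: d_def)
          also have "(LINT x|?N. ?E x / 2 + \<mu> * (v x - m x)) = ?e / 2"
            using Ei vi mint v1 m_int by (simp add: e)
          finally have "?e / 2 \<le> C1 * measure lborel A + C2 * d" .
          also have "\<dots> \<le> C1 * (C5 * (df + C4 * d)) + C2 * d"
            using Abound C12(1) by (intro add_right_mono mult_left_mono)
          finally have 1: "?e \<le> 2 * C1 * C5 * (df + C4 * d) + 2 * C2 * d" by (simp add: algebra_simps)
          have "df + C4 * d \<le> (1 + C4) * (d + df)"
            using d0 df C4 by (simp add: algebra_simps mult_nonneg_nonneg)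
          then have "2 * C1 * C5 * (df + C4 * d) \<le> 2 * C1 * C5 * ((1 + C4) * (d + df))"
            using C12(1) C5 by (intro mult_left_mono) auto
          moreover have "2 * C2 * d \<le> 2 * C2 * (d + df)" using C12(2) df by (intro mult_left_mono) auto
          ultimately have "?e \<le> 2 * C1 * C5 * ((1 + C4) * (d + df)) + 2 * C2 * (d + df) + (d + df)"
            using 1 d0 df by linarith
          also have "\<dots> = C9 * (d + df)" by (simp add: C9_def algebra_simps)
          finally have "?e / C9 \<le> d + df" using C9 by (simp add: field_simps)
          moreover have "\<gamma> * ?e \<le> 1 / C9 * ?e" using \<gamma>(2) e0 by (rule mult_right_mono)
          ultimately show ?thesis by simp
        qed
      qed
      have "ennreal (\<gamma> * ?e) \<le> ennreal (d + df)" using goal by (rule ennreal_leI)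
      then show ?thesis using Drd Dfd df d0 by (simp add: ennreal_plus)
    qed
  qed
  show ?thesis
    using \<gamma>(1) main by (intro exI[of _ \<gamma>]) blast
qed

end

section \<open>A Gronwall inequality for distributions\<close>

lemma Ck_upto_real_SucI:
  assumes "\<And>t::real. DERIV g t :> g' t" "Ck_upto k UNIV UNIV g'"
  shows "Ck_upto (Suc k) UNIV UNIV g"
proof -
  have "continuous_on UNIV g" using assms(1) DERIV_isCont by (blast intro: continuous_at_imp_continuous_on)
  moreover have "\<forall>x\<in>UNIV. GDERIV g x :> g' x" using assms(1) by simp
  moreover have "\<forall>b\<in>Basis. Ck_upto k UNIV UNIV (\<lambda>x. g' x \<bullet> b)" using assms(2) by simp
  ultimately show ?thesis unfolding Ck_upto.simps(2) by blast
qed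

lemma Ck_upto_real_SucD:
  assumes "Ck_upto (Suc k) UNIV UNIV (g :: real \<Rightarrow> real)"
  obtains g' where "\<And>t. DERIV g t :> g' t" "Ck_upto k UNIV UNIV g'"
proof -
  obtain D where D: "\<forall>x\<in>UNIV. GDERIV g x :> D x" "\<forall>b\<in>Basis. Ck_upto k UNIV UNIV (\<lambda>x. D x \<bullet> b)"
    using assms by (subst (asm) Ck_upto.simps(2)) blast
  show ?thesis by (rule that[of D]) (use D in auto)
qed

lemma Ck_upto_continuous: "Ck_upto k U S g \<Longrightarrow> continuous_on S g"
  by (cases k) auto

lemma Ck_upto_SucD: "Ck_upto (Suc k) UNIV UNIV (g :: real \<Rightarrow> real) \<Longrightarrow> Ck_upto k UNIV UNIV g"
proof (induction k arbitrary: g)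
  case 0 then show ?case by (auto dest: Ck_upto_continuous)
next
  case (Suc k)
  obtain g' where g': "\<And>t. DERIV g t :> g' t" "Ck_upto (Suc k) UNIV UNIV g'"
    using Ck_upto_real_SucD[OF Suc.prems] by blast
  show ?case by (rule Ck_upto_real_SucI[OF g'(1) Suc.IH[OF g'(2)]])
qed

lemma Ck_upto_real_add:
  "Ck_upto k UNIV UNIV (g :: real \<Rightarrow> real) \<Longrightarrow> Ck_upto k UNIV UNIV h \<Longrightarrow> Ck_upto k UNIV UNIV (\<lambda>t. g t + h t)"
proof (induction k arbitrary: g h)
  case 0 then show ?case by (auto intro!: continuous_intros)
next
  case (Suc k)
  obtain g' where g': "\<And>t. DERIV g t :> g' t" "Ck_upto k UNIV UNIV g'"
    using Ck_upto_real_SucD[OF Suc.prems(1)] by blast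
  obtain h' where h': "\<And>t. DERIV h t :> h' t" "Ck_upto k UNIV UNIV h'"
    using Ck_upto_real_SucD[OF Suc.prems(2)] by blast
  show ?case
    by (rule Ck_upto_real_SucI[of _ "\<lambda>t. g' t + h' t"]) (use g' h' Suc.IH in \<open>auto intro!: DERIV_add\<close>)
qed

lemma Ck_upto_real_mult:
  "Ck_upto k UNIV UNIV (g :: real \<Rightarrow> real) \<Longrightarrow> Ck_upto k UNIV UNIV h \<Longrightarrow> Ck_upto k UNIV UNIV (\<lambda>t. g t * h t)"
proof (induction k arbitrary: g h)
  case 0 then show ?case by (auto intro!: continuous_intros)
next
  case (Suc k)
  obtain g' where g': "\<And>t. DERIV g t :> g' t" "Ck_upto k UNIV UNIV g'"
    using Ck_upto_real_SucD[OF Suc.prems(1)] by blast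
  obtain h' where h': "\<And>t. DERIV h t :> h' t" "Ck_upto k UNIV UNIV h'"
    using Ck_upto_real_SucD[OF Suc.prems(2)] by blast
  show ?case
  proof (rule Ck_upto_real_SucI[of _ "\<lambda>t. g' t * h t + h' t * g t"])
    show "DERIV (\<lambda>t. g t * h t) t :> g' t * h t + h' t * g t" for t by (rule DERIV_mult[OF g'(1) h'(1)])
    show "Ck_upto k UNIV UNIV (\<lambda>t. g' t * h t + h' t * g t)"
      by (intro Ck_upto_real_add Suc.IH g'(2) h'(2) Ck_upto_SucD[OF Suc.prems(1)] Ck_upto_SucD[OF Suc.prems(2)])
  qed
qed

lemma Ck_upto_real_const: "Ck_upto k UNIV UNIV (\<lambda>t::real. c)"
proof (induction k arbitrary: c)
  case (Suc k) show ?case by (rule Ck_upto_real_SucI[OF DERIV_const Suc.IH])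
qed simp

lemma Ck_upto_real_exp: "Ck_upto k UNIV UNIV (\<lambda>t::real. exp (c * t))"
proof (induction k)
  case 0 show ?case by (auto intro!: continuous_intros)
next
  case (Suc k)
  show ?case
  proof (rule Ck_upto_real_SucI[of _ "\<lambda>t. c * exp (c * t)"])
    show "DERIV (\<lambda>t. exp (c * t)) t :> c * exp (c * t)" for t by (auto intro!: derivative_eq_intros)
    show "Ck_upto k UNIV UNIV (\<lambda>t. c * exp (c * t))" by (rule Ck_upto_real_mult[OF Ck_upto_real_const Suc.IH])
  qed
qed

lemma moll_shift_Ck: "Ck_upto k UNIV UNIV (\<lambda>t::real. moll r (t - s))"
proof -
  have "Ck_upto k UNIV UNIV (\<lambda>t::real. moll r (s - t))" by (rule bump_alg_Ck[OF moll_in_bump_alg])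
  moreover have "moll r (s - t) = moll r (t - s)" for t :: real using moll_minus[of r "t - s"] by simp
  ultimately show ?thesis by simp
qed

text \<open>
  Testing with \<open>exp (\<gamma> t) \<zeta> t\<close> shows that \<open>B t = A t exp (\<gamma> t)\<close> is nonincreasing in the sense of
  distributions.  For \<open>\<zeta>\<close> one takes the primitive of the difference of two mollifiers, centred at \<open>s < t0\<close>:
  this compares the mollification of \<open>B\<close> at \<open>t0\<close> with that at \<open>s\<close>, which is at most \<open>A0 exp (\<gamma> (s + r))\<close>.
  The initial value \<open>A0\<close> remains as \<open>s\<close> and the radius \<open>r\<close> tend to \<open>0\<close>.
\<close>

lemma distributional_Gronwall:
  fixes A :: "real \<Rightarrow> real" and D :: "real \<Rightarrow> ennreal"
  assumes Am: "A \<in> borel_measurable (lebesgue_on {0<..})" and \<gamma>: "0 < \<gamma>"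
    and A0: "AE t in lebesgue_on {0<..}. 0 \<le> A t \<and> A t \<le> A0"
    and D: "AE t in lebesgue_on {0<..}. ennreal (\<gamma> * A t) \<le> D t"
    and ddt: "ddt_le_minus A D"
  shows "AE t in lebesgue_on {0<..}. A t \<le> A0 * exp (- \<gamma> * t)"
proof -
  let ?N = "lebesgue_on {0<..} :: real measure"
  have bound_int: "integrable ?N (\<lambda>t. A t * h t)" if h: "continuous_on UNIV h" "\<And>t. t \<notin> {a..b} \<Longrightarrow> h t = 0" for h :: "real \<Rightarrow> real" and a b
  proof -
    have "integrable lborel (\<lambda>t. indicator {a..b} t *\<^sub>R h t)"
      by (intro borel_integrable_compact continuous_on_subset[OF h(1)]) auto
    moreover have "(\<lambda>t. indicator {a..b} t *\<^sub>R h t) = h" using h(2) by (auto simp: fun_eq_iff indicator_def)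
    ultimately have hi: "integrable lborel h" by simp
    then have "integrable lebesgue h" by (subst integrable_completion) auto
    then have "integrable lebesgue (\<lambda>t. indicator {0<..} t *\<^sub>R h t)"
      by (intro integrable_mult_indicator) auto
    then have hN: "integrable ?N h" by (subst integrable_restrict_space) auto
    then have "integrable ?N (\<lambda>t. A0 * h t)" by simp
    then show ?thesis
    proof (rule Bochner_Integration.integrable_bound)
      show "(\<lambda>t. A t * h t) \<in> borel_measurable ?N" using Am borel_measurable_integrable[OF hN] by measurable
      show "AE t in ?N. norm (A t * h t) \<le> norm (A0 * h t)"
        using A0 by eventually_elim (auto simp: abs_mult intro!: mult_right_mono)
    qed
  qed
  have step1: "0 \<le> (LINT t|?N. A t * \<eta>' t) - \<gamma> * (LINT t|?N. A t * \<eta> t)"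
    if \<eta>: "test_function {0<..} \<eta>" "\<And>t. 0 \<le> \<eta> t" "\<And>t. DERIV \<eta> t :> \<eta>' t" "continuous_on UNIV \<eta>" "\<And>t. t \<notin> {a..b} \<Longrightarrow> \<eta> t = 0"
    for \<eta> \<eta>' a b
  proof -
    have d: "deriv \<eta> t = \<eta>' t" for t by (rule DERIV_imp_deriv[OF \<eta>(3)])
    have Ai: "integrable ?N (\<lambda>t. A t * \<eta> t)" by (rule bound_int[OF \<eta>(4,5)])
    have nn: "AE t in ?N. 0 \<le> \<gamma> * (A t * \<eta> t)" using A0 by eventually_elim (use \<gamma> \<eta>(2) in auto)
    have "ereal (- (LINT t|?N. A t * deriv \<eta> t)) \<le> - enn2ereal (\<integral>\<^sup>+t. D t * ennreal (\<eta> t) \<partial>?N)"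
      using ddt \<eta>(1,2) unfolding ddt_le_minus_def by blast
    also have "ennreal (\<gamma> * (LINT t|?N. A t * \<eta> t)) \<le> (\<integral>\<^sup>+t. D t * ennreal (\<eta> t) \<partial>?N)"
    proof -
      have "ennreal (\<gamma> * (LINT t|?N. A t * \<eta> t)) = ennreal (LINT t|?N. \<gamma> * (A t * \<eta> t))" by simp
      also have "\<dots> = (\<integral>\<^sup>+t. ennreal (\<gamma> * (A t * \<eta> t)) \<partial>?N)"
        using Ai nn by (intro nn_integral_eq_integral[symmetric]) auto
      also have "\<dots> \<le> (\<integral>\<^sup>+t. D t * ennreal (\<eta> t) \<partial>?N)"
      proof (rule nn_integral_mono_AE)
        show "AE t in ?N. ennreal (\<gamma> * (A t * \<eta> t)) \<le> D t * ennreal (\<eta> t)"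
          using D A0
        proof eventually_elim
          case (elim t)
          have "ennreal (\<gamma> * (A t * \<eta> t)) = ennreal (\<gamma> * A t) * ennreal (\<eta> t)"
            using elim \<gamma> \<eta>(2)[of t] by (simp add: ennreal_mult[symmetric] mult.assoc)
          also have "\<dots> \<le> D t * ennreal (\<eta> t)" using elim by (intro mult_right_mono) auto
          finally show ?case .
        qed
      qed
      finally show ?thesis .
    qed
    then have "- enn2ereal (\<integral>\<^sup>+t. D t * ennreal (\<eta> t) \<partial>?N) \<le> - enn2ereal (ennreal (\<gamma> * (LINT t|?N. A t * \<eta> t)))"
      by (simp add: less_eq_ennreal.rep_eq)
    also have "enn2ereal (ennreal (\<gamma> * (LINT t|?N. A t * \<eta> t))) = ereal (\<gamma> * (LINT t|?N. A t * \<eta> t))"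
    proof -
      have "0 \<le> (LINT t|?N. \<gamma> * (A t * \<eta> t))" using nn by (rule integral_nonneg_AE)
      then show ?thesis by (simp add: enn2ereal_ennreal)
    qed
    finally show ?thesis unfolding d by simp
  qed
  define B where "B t = A t * exp (\<gamma> * t)" for t
  have A00: "0 \<le> A0"
  proof (rule ccontr)
    assume "\<not> 0 \<le> A0"
    then have neg: "A0 < 0" by simp
    have "AE t in ?N. False" using A0 by eventually_elim (use neg in linarith)
    then have "emeasure ?N {0<..} = 0"
      using AE_iff_measurable[of "{0<..}" ?N "\<lambda>_. False"]
      by (simp add: space_restrict_space greaterThan_def sets_restrict_space_iff)
    then have z: "emeasure lborel ({0<..} :: real set) = 0" by (simp add: emeasure_restrict_space)
    have "{0<..<1::real} \<subseteq> {0<..}" by auto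
    from emeasure_mono[OF this, of lborel] z show False by simp
  qed
  have step3: "(LINT t|?N. B t * moll r (t - t0)) \<le> A0 * exp (3 * \<gamma> * r)" if r: "0 < r" "2 * r \<le> t0" for r t0 :: real
  proof -
    \<comment> \<open>The support of \<open>moll r (t - s)\<close> has to stay in \<open>(0, \<infinity>)\<close>, and \<open>s\<close> has to vanish with \<open>r\<close>.\<close>
    define s where "s = 2 * r"
    have mc: "isCont (moll r) (x::real)" for x using moll_continuous[of r, where 'a=real] by (simp add: continuous_on_eq_continuous_at)
    obtain Fi where Fi: "\<And>x. DERIV Fi x :> moll r (x::real)"
    proof -
      have "\<exists>F. \<forall>x::real. -\<infinity> < ereal x \<longrightarrow> ereal x < \<infinity> \<longrightarrow> (F has_vector_derivative moll r x) (at x)"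
        by (rule einterval_antiderivative) (auto simp: mc)
      then show ?thesis using that by (auto simp: has_real_derivative_iff_has_vector_derivative)
    qed
    have mono: "Fi x \<le> Fi y" if "x \<le> y" for x y
      by (rule DERIV_nonneg_imp_nondecreasing[OF that]) (use Fi moll_nonneg[OF r(1), where 'a=real] in blast)
    have Fi_const: "Fi x = Fi y" if "(x \<le> - r \<and> y \<le> - r) \<or> (r \<le> x \<and> r \<le> y)" for x y
    proof -
      have *: "Fi u = Fi w" if uw: "u < w" "w \<le> - r \<or> r \<le> u" for u w
      proof -
        obtain z where z: "u < z" "z < w" "Fi w - Fi u = (w - u) * moll r z" using MVT2[of u w Fi "moll r"] uw(1) Fi by blast
        have "moll r z = 0" using z uw(2) r(1) by (intro moll_eq_0) auto
        then show ?thesis using z by simp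
      qed
      show ?thesis
      proof (cases x y rule: linorder_cases)
        case less then show ?thesis using * that by auto
      next
        case greater then show ?thesis using *[of y x] that by auto
      qed simp
    qed
    define \<zeta> where "\<zeta> t = Fi (t - s) - Fi (t - t0)" for t
    have \<zeta>0: "0 \<le> \<zeta> t" for t unfolding \<zeta>_def using mono[of "t - t0" "t - s"] r by (simp add: s_def)
    have \<zeta>z: "\<zeta> t = 0" if "t \<notin> {r..t0 + r}" for t
      unfolding \<zeta>_def using Fi_const[of "t - s" "t - t0"] that r by (auto simp: s_def)
    have d\<zeta>: "DERIV \<zeta> t :> moll r (t - s) - moll r (t - t0)" for t
    proof -
      have "DERIV (\<lambda>x. Fi (x - p)) t :> moll r (t - p)" for p
      proof -
        have "DERIV (\<lambda>x. x - p) t :> 1" by (auto intro!: derivative_eq_intros)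
        from DERIV_chain2[OF Fi this] show ?thesis by simp
      qed
      then show ?thesis unfolding \<zeta>_def by (intro DERIV_diff)
    qed
    have C\<zeta>: "Ck_upto k UNIV UNIV \<zeta>" for k
    proof -
      have "Ck_upto (Suc k) UNIV UNIV \<zeta>"
      proof (rule Ck_upto_real_SucI[OF d\<zeta>])
        have "Ck_upto k UNIV UNIV (\<lambda>t. moll r (t - s) + (- 1) * moll r (t - t0))"
          by (intro Ck_upto_real_add Ck_upto_real_mult Ck_upto_real_const moll_shift_Ck)
        then show "Ck_upto k UNIV UNIV (\<lambda>t. moll r (t - s) - moll r (t - t0))" by simp
      qed
      then show ?thesis by (rule Ck_upto_SucD)
    qed
    define \<eta> where "\<eta> t = exp (\<gamma> * t) * \<zeta> t" for t
    have C\<eta>: "Ck_upto k UNIV UNIV \<eta>" for k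
      unfolding \<eta>_def by (rule Ck_upto_real_mult[OF Ck_upto_real_exp C\<zeta>])
    have \<eta>z: "\<eta> t = 0" if "t \<notin> {r..t0 + r}" for t using \<zeta>z[OF that] by (simp add: \<eta>_def)
    have supp: "closure {t. \<eta> t \<noteq> 0} \<subseteq> {r..t0 + r}"
    proof (rule closure_minimal)
      show "{t. \<eta> t \<noteq> 0} \<subseteq> {r..t0 + r}" using \<eta>z by blast
    qed simp
    have test: "test_function {0<..} \<eta>"
      unfolding test_function_def
    proof (intro conjI allI C\<eta>)
      show "compact (closure {t. \<eta> t \<noteq> 0})"
        unfolding compact_eq_bounded_closed using bounded_subset[OF bounded_closed_interval supp] by simp
      show "closure {t. \<eta> t \<noteq> 0} \<subseteq> {0<..}" using supp r by force
    qed
    have d\<eta>: "DERIV \<eta> t :> \<gamma> * \<eta> t + exp (\<gamma> * t) * (moll r (t - s) - moll r (t - t0))" for t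
    proof -
      have "DERIV (\<lambda>t. exp (\<gamma> * t)) t :> \<gamma> * exp (\<gamma> * t)" by (auto intro!: derivative_eq_intros)
      have e: "\<eta> = (\<lambda>t. exp (\<gamma> * t) * \<zeta> t)" by (simp add: fun_eq_iff \<eta>_def)
      show ?thesis unfolding e using DERIV_mult[OF \<open>DERIV (\<lambda>t. exp (\<gamma> * t)) t :> \<gamma> * exp (\<gamma> * t)\<close> d\<zeta>]
        by (simp add: algebra_simps)
    qed
    have \<eta>c: "continuous_on UNIV \<eta>" using C\<eta>[of 0] by simp
    have s1: "0 \<le> (LINT t|?N. A t * (\<gamma> * \<eta> t + exp (\<gamma> * t) * (moll r (t - s) - moll r (t - t0)))) - \<gamma> * (LINT t|?N. A t * \<eta> t)"
      by (rule step1[OF test _ d\<eta> \<eta>c \<eta>z]) (use \<zeta>0 in \<open>auto simp: \<eta>_def\<close>)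
    have mI: "integrable ?N (\<lambda>t. B t * moll r (t - p))" for p
    proof -
      have "integrable ?N (\<lambda>t. A t * (exp (\<gamma> * t) * moll r (t - p)))"
      proof (rule bound_int[where a="p - r" and b="p + r"])
        show "continuous_on UNIV (\<lambda>t. exp (\<gamma> * t) * moll r (t - p))"
          by (intro continuous_intros continuous_on_compose2[OF moll_continuous[of r]]) auto
        show "exp (\<gamma> * t) * moll r (t - p) = 0" if "t \<notin> {p - r..p + r}" for t
          using that r(1) moll_eq_0[of r "t - p"] by (auto simp: abs_if)
      qed
      then show ?thesis by (simp add: B_def mult.assoc)
    qed
    have Ai: "integrable ?N (\<lambda>t. A t * \<eta> t)" by (rule bound_int[OF \<eta>c \<eta>z])
    have "(LINT t|?N. A t * (\<gamma> * \<eta> t + exp (\<gamma> * t) * (moll r (t - s) - moll r (t - t0))))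
       = (LINT t|?N. \<gamma> * (A t * \<eta> t) + (B t * moll r (t - s) - B t * moll r (t - t0)))"
      by (intro Bochner_Integration.integral_cong) (auto simp: B_def algebra_simps)
    also have "\<dots> = \<gamma> * (LINT t|?N. A t * \<eta> t) + ((LINT t|?N. B t * moll r (t - s)) - (LINT t|?N. B t * moll r (t - t0)))"
      using Ai mI[of s] mI[of t0] by simp
    finally have le: "(LINT t|?N. B t * moll r (t - t0)) \<le> (LINT t|?N. B t * moll r (t - s))" using s1 by simp
    have mN: "integrable ?N (\<lambda>t. moll r (t - s))" and mN1: "(LINT t|?N. moll r (t - s)) = 1"
    proof -
      have i: "integrable lborel (\<lambda>t. moll r (t - s))"
      proof -
        have "integrable lborel (\<lambda>t. moll r (s - t) *\<^sub>R indicator {s - r..s + r} t :: real)"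
          by (rule moll_scaleR_integrable) (use r in auto)
        moreover have "moll r (s - t) *\<^sub>R indicator {s - r..s + r} t = moll r (t - s)" for t
        proof (cases "t \<in> {s - r..s + r}")
          case True
          then show ?thesis using moll_minus[of r "t - s"] by simp
        next
          case False
          then have "r \<le> norm (t - s)" by (auto simp: abs_if)
          with False show ?thesis using moll_eq_0[of r "t - s"] r(1) by simp
        qed
        ultimately show ?thesis by simp
      qed
      have "indicator {0<..} t *\<^sub>R moll r (t - s) = moll r (t - s)" for t
        using moll_eq_0[of r "t - s"] r(1) by (auto simp: indicator_def s_def abs_if)
      then have z: "(\<lambda>t. indicator {0<..} t *\<^sub>R moll r (t - s)) = (\<lambda>t. moll r (t - s))" by (rule ext)
      have il: "integrable lebesgue (\<lambda>t. moll r (t - s))" using i by (subst integrable_completion) auto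
      show "integrable ?N (\<lambda>t. moll r (t - s))" 
        using il integrable_restrict_space[of "{0<..}" lebesgue "\<lambda>t. moll r (t - s)"] unfolding z by simp
      have "(LINT t|?N. moll r (t - s)) = (LINT t|lebesgue. moll r (t - s))"
        using integral_restrict_space[of "{0<..}" lebesgue "\<lambda>t. moll r (t - s)"] unfolding z by simp
      also have "\<dots> = (LINT t|lborel. moll r (t - s))" by (rule integral_completion) measurable
      also have "\<dots> = (LINT t|lborel. moll r (s - t))"
      proof (rule Bochner_Integration.integral_cong[OF refl])
        show "moll r (t - s) = moll r (s - t)" for t using moll_minus[of r "t - s"] by simp
      qed
      also have "\<dots> = (LINT t|lborel. moll r (t::real))" by (rule integral_lborel_reflect) auto
      also have "\<dots> = 1" by (rule moll_integral[OF r(1)])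
      finally show "(LINT t|?N. moll r (t - s)) = 1" .
    qed
    have "(LINT t|?N. B t * moll r (t - s)) \<le> (LINT t|?N. (A0 * exp (3 * \<gamma> * r)) * moll r (t - s))"
    proof (rule integral_mono_AE[OF mI])
      show "integrable ?N (\<lambda>t. (A0 * exp (3 * \<gamma> * r)) * moll r (t - s))" using mN by simp
      show "AE t in ?N. B t * moll r (t - s) \<le> (A0 * exp (3 * \<gamma> * r)) * moll r (t - s)"
        using A0
      proof eventually_elim
        case (elim t)
        show ?case
        proof (cases "t - s < r")
          case True
          have "\<gamma> * t \<le> 3 * \<gamma> * r" using True \<gamma> by (simp add: s_def)
          then have "B t \<le> A0 * exp (3 * \<gamma> * r)" unfolding B_def using elim A00 by (intro mult_mono) auto
          then show ?thesis using moll_nonneg[OF r(1), of "t - s"] by (rule mult_right_mono)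
        next
          case False
          then show ?thesis using moll_eq_0[of r "t - s"] r(1) by simp
        qed
      qed
    qed
    also have "\<dots> = A0 * exp (3 * \<gamma> * r)" using mN1 by simp
    finally show ?thesis using le by simp
  qed
  have onT: "AE t in lborel. 0 < t \<and> t < T \<longrightarrow> B t \<le> A0" for T :: real
  proof -
    define H where "H t = indicator {0<..<T} t *\<^sub>R B t" for t
    have Hl: "integrable lebesgue H"
    proof -
      have Bm: "(\<lambda>t. indicator {0<..} t *\<^sub>R B t) \<in> borel_measurable lebesgue"
      proof -
        have "(\<lambda>t. exp (\<gamma> * t)) \<in> borel_measurable ?N"
          by (intro measurable_restrict_space1 measurable_completion) measurable
        then have "B \<in> borel_measurable ?N" unfolding B_def using Am by measurable
        then show ?thesis by (subst (asm) borel_measurable_restrict_space_iff) auto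
      qed
      have Hm: "H \<in> borel_measurable lebesgue"
      proof -
        have "(\<lambda>t. indicator {0<..<T} t *\<^sub>R (indicator {0<..} t *\<^sub>R B t)) \<in> borel_measurable lebesgue"
          by (intro borel_measurable_scaleR Bm measurable_completion) simp
        moreover have "(\<lambda>t. indicator {0<..<T} t *\<^sub>R (indicator {0<..} t *\<^sub>R B t)) = H" by (auto simp: H_def fun_eq_iff indicator_def)
        ultimately show ?thesis by simp
      qed
      have "integrable lborel (\<lambda>t. indicator {0<..<T} t *\<^sub>R (A0 * exp (\<gamma> * T)))"
        by (cases "0 \<le> T") auto
      then have "integrable lebesgue (\<lambda>t. indicator {0<..<T} t *\<^sub>R (A0 * exp (\<gamma> * T)))"
        by (subst integrable_completion) auto
      then show ?thesis
      proof (rule Bochner_Integration.integrable_bound[OF _ Hm])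
        have "AE t in lebesgue. t \<in> {0<..} \<longrightarrow> 0 \<le> A t \<and> A t \<le> A0" using A0 by (subst (asm) AE_restrict_space_iff) auto
        then show "AE t in lebesgue. norm (H t) \<le> norm (indicator {0<..<T} t *\<^sub>R (A0 * exp (\<gamma> * T)))"
        proof eventually_elim
          case (elim t)
          show ?case
          proof (cases "t \<in> {0<..<T}")
            case True
            then have "A t * exp (\<gamma> * t) \<le> A0 * exp (\<gamma> * T)" using elim \<gamma> A00 by (intro mult_mono) auto
            then show ?thesis using True elim A00 by (simp add: H_def B_def abs_mult)
          qed (simp add: H_def)
        qed
      qed
    qed
    obtain H' where H': "H' \<in> borel_measurable lborel" "AE t in lborel. H t = H' t"
      using completion_ex_borel_measurable_real[OF borel_measurable_integrable[OF Hl]] by blast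
    have H'l: "H' \<in> borel_measurable lebesgue" using H'(1) by (rule measurable_completion)
    have H'i: "integrable lborel H'"
      using integrable_cong_AE[OF borel_measurable_integrable[OF Hl] H'l AE_completion[OF H'(2)]] Hl
        integrable_completion[OF H'(1)] by simp
    have mol: "mollify r H' t0 = (LINT t|?N. B t * moll r (t - t0))" if r: "0 < r" "r \<le> t0" "t0 + r \<le> T" for r t0
    proof -
      have [measurable]: "H' \<in> borel_measurable borel" using H' by simp
      have "mollify r H' t0 = (LINT t|lebesgue. moll r (t0 - t) *\<^sub>R H' t)"
        unfolding mollify_def by (rule integral_completion[symmetric]) measurable
      also have "\<dots> = (LINT t|lebesgue. indicator {0<..} t *\<^sub>R (B t * moll r (t - t0)))"
      proof (rule integral_cong_AE)
        have mm: "(\<lambda>t. moll r (t0 - t)) \<in> borel_measurable lebesgue" by (intro measurable_completion) measurable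
        show "(\<lambda>t. moll r (t0 - t) *\<^sub>R H' t) \<in> borel_measurable lebesgue" by (rule borel_measurable_scaleR[OF mm H'l])
        have e: "indicator {0<..} t *\<^sub>R (B t * moll r (t - t0)) = moll r (t0 - t) *\<^sub>R H t" for t
          using moll_minus[of r "t - t0"] moll_eq_0[of r "t - t0"] r by (auto simp: H_def indicator_def abs_if)
        show "(\<lambda>t. indicator {0<..} t *\<^sub>R (B t * moll r (t - t0))) \<in> borel_measurable lebesgue"
          unfolding e by (rule borel_measurable_scaleR[OF mm borel_measurable_integrable[OF Hl]])
        show "AE t in lebesgue. moll r (t0 - t) *\<^sub>R H' t = indicator {0<..} t *\<^sub>R (B t * moll r (t - t0))"
          unfolding e using AE_completion[OF H'(2)] by eventually_elim simp
      qed
      also have "\<dots> = (LINT t|?N. B t * moll r (t - t0))" by (rule integral_restrict_space[symmetric]) simp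
      finally show ?thesis .
    qed
    obtain r where r: "\<And>n. 0 < r n" "r \<longlonglongrightarrow> 0" "AE x in lborel. (\<lambda>n. mollify (r n) H' x) \<longlonglongrightarrow> H' x"
      by (rule mollify_AE_subsequence[OF H'i H'i zero_less_one], rule that) assumption+
    show ?thesis using r(3) H'(2)
    proof eventually_elim
      case (elim t)
      show ?case
      proof
        assume t: "0 < t \<and> t < T"
        have "\<forall>\<^sub>F n in sequentially. r n < min (t / 2) (T - t)" using t by (intro order_tendstoD(2)[OF r(2)]) auto
        then have "\<forall>\<^sub>F n in sequentially. mollify (r n) H' t \<le> A0 * exp (3 * \<gamma> * r n)"
        proof eventually_elim
          case (elim n)
          then have "mollify (r n) H' t = (LINT s|?N. B s * moll (r n) (s - t))" using r(1)[of n] t by (intro mol) auto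
          also have "\<dots> \<le> A0 * exp (3 * \<gamma> * r n)" using elim r(1)[of n] by (intro step3) auto
          finally show ?case .
        qed
        moreover have "(\<lambda>n. A0 * exp (3 * \<gamma> * r n)) \<longlonglongrightarrow> A0 * exp (3 * \<gamma> * 0)" by (intro tendsto_intros r(2))
        ultimately have "H' t \<le> A0 * exp (3 * \<gamma> * 0)"
          using elim(1) by (intro tendsto_le[OF sequentially_bot]) auto
        then show "B t \<le> A0" using elim(2) t by (simp add: H_def)
      qed
    qed
  qed
  have "AE t in lborel. \<forall>n::nat. 0 < t \<and> t < real n \<longrightarrow> B t \<le> A0" using onT by (intro AE_all_countable[THEN iffD2]) auto
  then have "AE t in lborel. 0 < t \<longrightarrow> B t \<le> A0"
  proof eventually_elim
    case (elim t)
    obtain n where "t < real n" using reals_Archimedean2 by blast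
    then show ?case using elim by blast
  qed
  from AE_completion[OF this] have "AE t in lebesgue. t \<in> {0<..} \<longrightarrow> A t \<le> A0 * exp (- \<gamma> * t)"
  proof eventually_elim
    case (elim t)
    show ?case
    proof
      assume "t \<in> {0<..}"
      then have "A t * exp (\<gamma> * t) * exp (- \<gamma> * t) \<le> A0 * exp (- \<gamma> * t)" using elim by (intro mult_right_mono) (auto simp: B_def)
      then show "A t \<le> A0 * exp (- \<gamma> * t)" by (simp add: mult.assoc flip: exp_add)
    qed
  qed
  then show ?thesis by (subst AE_restrict_space_iff) auto
qed

section \<open>Exponential decay\<close>

text \<open>
  Lebesgue measure on the product is the completion of the product measure; joint measurability
  passes to almost every slice by way of a Borel representative, which agrees with the function
  outside a Borel null set, to which Fubini's theorem applies.
\<close>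

lemma Linf_nonneg_slices:
  fixes \<Omega> :: "'a::euclidean_space set" and u :: "real \<Rightarrow> 'a \<Rightarrow> real"
  assumes \<Omega>: "open \<Omega>" and u: "Linf_nonneg (\<Omega> \<times> {0<..<T}) (\<lambda>(x, t). u t x)"
  shows "AE t in lebesgue_on {0<..<T}. u t \<in> borel_measurable (lebesgue_on \<Omega>) \<and> (AE x in lebesgue_on \<Omega>. 0 \<le> u t x)"
proof -
  let ?S = "\<Omega> \<times> {0<..<T}"
  let ?U = "\<lambda>(x, t). u t x"
  have "open ?S" by (intro open_Times \<Omega>) simp
  then have Sl: "?S \<in> sets lebesgue" by simp
  have m: "(\<lambda>z. indicator ?S z *\<^sub>R ?U z) \<in> borel_measurable lebesgue"
    using u Sl unfolding Linf_nonneg_def by (subst (asm) borel_measurable_restrict_space_iff) auto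
  obtain h where h: "h \<in> borel_measurable lborel" "AE z in lborel. indicator ?S z *\<^sub>R ?U z = h z"
    using completion_ex_borel_measurable_real[OF m] by blast
  have pos: "AE z in lborel. z \<in> ?S \<longrightarrow> 0 \<le> ?U z"
  proof -
    obtain c where "AE z in lebesgue_on ?S. 0 \<le> ?U z \<and> ?U z \<le> c" using u unfolding Linf_nonneg_def by blast
    then have "AE z in lebesgue. z \<in> ?S \<longrightarrow> 0 \<le> ?U z \<and> ?U z \<le> c" using Sl by (subst (asm) AE_restrict_space_iff) auto
    then have "AE z in lebesgue. z \<in> ?S \<longrightarrow> 0 \<le> ?U z" by eventually_elim blast
    then show ?thesis by (simp only: AE_completion_iff)
  qed
  have "AE z in lborel. indicator ?S z *\<^sub>R ?U z = h z \<and> (z \<in> ?S \<longrightarrow> 0 \<le> ?U z)"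
    using h(2) pos by eventually_elim blast
  then obtain N where N: "{z \<in> space lborel. \<not> (indicator ?S z *\<^sub>R ?U z = h z \<and> (z \<in> ?S \<longrightarrow> 0 \<le> ?U z))} \<subseteq> N"
      "emeasure lborel N = 0" "N \<in> sets lborel" by (rule AE_E)
  have q: "indicator ?S z *\<^sub>R ?U z = h z \<and> (z \<in> ?S \<longrightarrow> 0 \<le> ?U z)" if "z \<notin> N" for z
    using N(1) that by auto
  have "AE z in (lborel \<Otimes>\<^sub>M lborel :: ('a \<times> real) measure). z \<notin> N"
    unfolding lborel_prod using N(2,3) by (intro AE_not_in) auto
  then have "AE x in (lborel :: 'a measure). AE t in (lborel :: real measure). (x, t) \<notin> N"
    by (rule lborel_pair.AE_pair)
  moreover have "{z \<in> space (lborel \<Otimes>\<^sub>M lborel). (fst z, snd z) \<notin> N} \<in> sets (lborel \<Otimes>\<^sub>M lborel :: ('a \<times> real) measure)"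
  proof -
    have "{z \<in> space (lborel \<Otimes>\<^sub>M lborel). (fst z, snd z) \<notin> N} = - N" by (auto simp: space_pair_measure)
    moreover have "- N \<in> sets lborel" using sets.compl_sets[OF N(3)] by (simp add: Compl_eq_Diff_UNIV)
    ultimately show ?thesis by (simp only: lborel_prod)
  qed
  ultimately have ae: "AE t in (lborel :: real measure). AE x in (lborel :: 'a measure). (x, t) \<notin> N"
    using lborel_pair.AE_commute[of "\<lambda>x t. (x, t) \<notin> N"] by blast
  have "AE t in lebesgue. t \<in> {0<..<T} \<longrightarrow> u t \<in> borel_measurable (lebesgue_on \<Omega>) \<and> (AE x in lebesgue_on \<Omega>. 0 \<le> u t x)"
    using AE_completion[OF ae]
  proof eventually_elim
    case (elim t)
    show ?case
    proof (intro impI conjI)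
      assume t: "t \<in> {0<..<T}"
      note e = AE_completion[OF elim]
      have hb: "h \<in> borel_measurable borel" using h(1) by simp
      have "(\<lambda>x. h (x, t)) \<in> borel_measurable borel"
        by (rule measurable_compose[OF _ hb]) measurable
      then have hm: "(\<lambda>x. h (x, t)) \<in> borel_measurable lebesgue" by (intro measurable_completion) simp
      have "AE x in lebesgue. h (x, t) = indicator \<Omega> x *\<^sub>R u t x"
        using e
      proof eventually_elim
        case (elim x)
        have "indicator ?S (x, t) = (indicator \<Omega> x :: real)" using t by (simp add: indicator_def)
        then show ?case using q[OF elim] by simp
      qed
      from borel_measurable_AE[OF hm this] show "u t \<in> borel_measurable (lebesgue_on \<Omega>)"
        using \<Omega> by (subst borel_measurable_restrict_space_iff) auto
      have "AE x in lebesgue. x \<in> \<Omega> \<longrightarrow> 0 \<le> u t x"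
        using e
      proof eventually_elim
        case (elim x)
        show ?case using q[OF elim] t by simp
      qed
      then show "AE x in lebesgue_on \<Omega>. 0 \<le> u t x" using \<Omega> by (subst AE_restrict_space_iff) auto
    qed
  qed
  then show ?thesis by (subst AE_restrict_space_iff) auto
qed

lemma weak_solution_slices:
  fixes \<Omega> :: "'a::euclidean_space set"
  assumes \<Omega>: "open \<Omega>" and u: "weak_solution f \<Omega> u0 u"
  shows "AE t in lebesgue_on {0<..}. u t \<in> borel_measurable (lebesgue_on \<Omega>) \<and> (AE x in lebesgue_on \<Omega>. 0 \<le> u t x) \<and>
     (LINT x|lebesgue_on \<Omega>. u t x) = 1 \<and> (\<exists>G. H1_with_grad \<Omega> (\<lambda>x. Phi f x (u t x)) G)"
proof -
  let ?P = "\<lambda>t. u t \<in> borel_measurable (lebesgue_on \<Omega>) \<and> (AE x in lebesgue_on \<Omega>. 0 \<le> u t x) \<and>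
     (LINT x|lebesgue_on \<Omega>. u t x) = 1 \<and> (\<exists>G. H1_with_grad \<Omega> (\<lambda>x. Phi f x (u t x)) G)"
  have "AE t in lebesgue. t \<in> {0<..<real n + 1} \<longrightarrow> ?P t" for n :: nat
  proof -
    have w: "weak_solution_on (real n + 1) f \<Omega> u0 u" using u by (simp add: weak_solution_def)
    note w' = w[unfolded weak_solution_on_def]
    obtain G where G: "L2_H1_with_grad (real n + 1) \<Omega> (\<lambda>t x. Phi f x (u t x)) G"
      using w'[THEN conjunct2, THEN conjunct2] by - (erule exE, erule conjE, rule that)
    have 1: "AE t in lebesgue_on {0<..<real n + 1}. (LINT x|lebesgue_on \<Omega>. u t x) = 1"
      by (rule w'[THEN conjunct2, THEN conjunct1])
    have 2: "AE t in lebesgue_on {0<..<real n + 1}. H1_with_grad \<Omega> (\<lambda>x. Phi f x (u t x)) (G t)"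
      by (rule G[unfolded L2_H1_with_grad_def, THEN conjunct2, THEN conjunct2])
    have 3: "AE t in lebesgue_on {0<..<real n + 1}. u t \<in> borel_measurable (lebesgue_on \<Omega>) \<and> (AE x in lebesgue_on \<Omega>. 0 \<le> u t x)"
      by (rule Linf_nonneg_slices[OF \<Omega> w'[THEN conjunct1]])
    have "AE t in lebesgue_on {0<..<real n + 1}. ?P t"
      using 1 2 3 by eventually_elim blast
    then show ?thesis by (subst (asm) AE_restrict_space_iff) auto
  qed
  then have "AE t in lebesgue. \<forall>n::nat. t \<in> {0<..<real n + 1} \<longrightarrow> ?P t"
    by (intro AE_all_countable[THEN iffD2] allI)
  then have "AE t in lebesgue. t \<in> {0<..} \<longrightarrow> ?P t"
  proof eventually_elim
    case (elim t)
    obtain n where "t < real n" using reals_Archimedean2 by blast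
    then have "t \<in> {0<..} \<Longrightarrow> t \<in> {0<..<real n + 1}" by simp
    with elim show ?case by blast
  qed
  then show ?thesis by (subst AE_restrict_space_iff) auto
qed

theorem theorem3p9:
  fixes \<Omega> :: "'a::euclidean_space set"
    and f :: "'a \<Rightarrow> real \<Rightarrow> real"
    and m :: "'a \<Rightarrow> real"
  assumes "open \<Omega>" and "connected \<Omega>" and "bounded \<Omega>" and "Ck_boundary 2 \<Omega>"
    and "admissible \<Omega> f m"
  shows "\<forall>C>0. \<exists>\<gamma>>0. \<forall>(u0 :: 'a \<Rightarrow> real) (u :: real \<Rightarrow> 'a \<Rightarrow> real).
           Linf_nonneg \<Omega> u0 \<and> (LINT x|lebesgue_on \<Omega>. u0 x) = 1 \<and>
           weak_solution f \<Omega> u0 u \<and>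
           ddt_le_minus (\<lambda>t. entropy f m \<Omega> (u t)) (\<lambda>t. entropy_production f \<Omega> (u t)) \<and>
           esssup (lebesgue_on {0<..}) (\<lambda>t. ereal (entropy f m \<Omega> (u t))) \<le> ereal (entropy f m \<Omega> u0) \<and>
           entropy f m \<Omega> u0 \<le> C
           \<longrightarrow> (AE t in lebesgue_on {0<..}.
                  entropy f m \<Omega> (u t) \<le> entropy f m \<Omega> u0 * exp (- \<gamma> * t))"
proof (intro allI impI)
  fix C :: real assume C: "C > 0"
  interpret nonlinearity \<Omega> f m using assms by unfold_locales
  obtain \<gamma> where \<gamma>: "\<gamma> > 0" and ineq: "\<forall>v G \<mu>. v \<in> borel_measurable (lebesgue_on \<Omega>) \<and> (AE x in lebesgue_on \<Omega>. 0 \<le> v x) \<and>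
     (LINT x|lebesgue_on \<Omega>. v x) = 1 \<and> H1_with_grad \<Omega> (\<lambda>x. Phi f x (v x)) G \<and> entropy f m \<Omega> v \<le> C \<longrightarrow>
     ennreal (\<gamma> * entropy f m \<Omega> v) \<le>
       (\<integral>\<^sup>+x. ennreal (v x * (f x (v x) - \<mu>)\<^sup>2) \<partial>lebesgue_on \<Omega>) +
       (\<integral>\<^sup>+x. ennreal (1 / v x * (norm (flux f G v x))\<^sup>2) \<partial>lebesgue_on {x\<in>\<Omega>. v x > 0})"
    using entropy_production_inequality[OF assms(2,4) C] by - (erule exE, erule conjE, rule that)
  show "\<exists>\<gamma>>0. \<forall>(u0 :: 'a \<Rightarrow> real) (u :: real \<Rightarrow> 'a \<Rightarrow> real).
           Linf_nonneg \<Omega> u0 \<and> (LINT x|lebesgue_on \<Omega>. u0 x) = 1 \<and>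
           weak_solution f \<Omega> u0 u \<and>
           ddt_le_minus (\<lambda>t. entropy f m \<Omega> (u t)) (\<lambda>t. entropy_production f \<Omega> (u t)) \<and>
           esssup (lebesgue_on {0<..}) (\<lambda>t. ereal (entropy f m \<Omega> (u t))) \<le> ereal (entropy f m \<Omega> u0) \<and>
           entropy f m \<Omega> u0 \<le> C
           \<longrightarrow> (AE t in lebesgue_on {0<..}.
                  entropy f m \<Omega> (u t) \<le> entropy f m \<Omega> u0 * exp (- \<gamma> * t))"
  proof (intro exI[of _ \<gamma>] conjI \<gamma> allI impI)
    fix u0 :: "'a \<Rightarrow> real" and u :: "real \<Rightarrow> 'a \<Rightarrow> real"
    let ?A = "\<lambda>t. entropy f m \<Omega> (u t)" and ?init = "entropy f m \<Omega> u0"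
    assume *: "Linf_nonneg \<Omega> u0 \<and> (LINT x|lebesgue_on \<Omega>. u0 x) = 1 \<and>
           weak_solution f \<Omega> u0 u \<and> ddt_le_minus ?A (\<lambda>t. entropy_production f \<Omega> (u t)) \<and>
           esssup (lebesgue_on {0<..}) (\<lambda>t. ereal (?A t)) \<le> ereal ?init \<and> ?init \<le> C"
    then have ws: "weak_solution f \<Omega> u0 u" and ddt: "ddt_le_minus ?A (\<lambda>t. entropy_production f \<Omega> (u t))"
      and sup: "esssup (lebesgue_on {0<..}) (\<lambda>t. ereal (?A t)) \<le> ereal ?init" and A0C: "?init \<le> C" by auto
    \<comment> \<open>The essential supremum of a nonmeasurable function is \<open>top\<close>, so its bound entails measurability.\<close>
    have Am: "?A \<in> borel_measurable (lebesgue_on {0<..})"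
    proof (rule ccontr)
      assume "?A \<notin> borel_measurable (lebesgue_on {0<..})"
      then have "esssup (lebesgue_on {0<..}) (\<lambda>t. ereal (?A t)) = top"
        by (intro esssup_non_measurable) (simp add: borel_measurable_ereal_iff)
      then show False using sup by (simp add: top_ereal_def)
    qed
    have le: "AE t in lebesgue_on {0<..}. ?A t \<le> ?init"
    proof -
      have "AE t in lebesgue_on {0<..}. ereal (?A t) \<le> esssup (lebesgue_on {0<..}) (\<lambda>t. ereal (?A t))"
        by (rule esssup_AE)
      then show ?thesis
      proof eventually_elim
      case (elim t)
      from order_trans[OF elim sup] show ?case by simp
      qed
    qed
    note slices = weak_solution_slices[OF assms(1) ws]
    have nonneg: "AE t in lebesgue_on {0<..}. 0 \<le> ?A t"
      using slices
    proof eventually_elim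
      case (elim t)
      have inO: "AE x in lebesgue_on \<Omega>. x \<in> \<Omega>" by (rule AE_I2) (simp add: space_restrict_space)
      have "AE x in lebesgue_on \<Omega>. 0 \<le> u t x" using elim by blast
      then have "AE x in lebesgue_on \<Omega>. 0 \<le> E_density f m x (u t x)"
        using inO
      proof eventually_elim
        case (elim x)
        show ?case by (rule E_nonneg[OF subsetD[OF closure_subset elim(2)] elim(1)])
      qed
      then show ?case unfolding entropy_def by (rule integral_nonneg_AE)
    qed
    have D: "AE t in lebesgue_on {0<..}. ennreal (\<gamma> * ?A t) \<le> entropy_production f \<Omega> (u t)"
      using slices le
    proof eventually_elim
      case (elim t)
      have "\<exists>G. H1_with_grad \<Omega> (\<lambda>x. Phi f x (u t x)) G" using elim(1) by blast
      then have H: "H1_with_grad \<Omega> (\<lambda>x. Phi f x (u t x)) (weak_grad \<Omega> (\<lambda>x. Phi f x (u t x)))"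
        unfolding weak_grad_def by (rule someI_ex)
      have "?A t \<le> C" using elim(2) A0C by simp
      with elim(1) H show ?case
        unfolding entropy_production_def
        by (intro ineq[THEN spec, THEN spec, THEN spec, THEN mp]) blast
    qed
    show "AE t in lebesgue_on {0<..}. ?A t \<le> ?init * exp (- \<gamma> * t)"
    proof (rule distributional_Gronwall[OF Am \<gamma> _ D ddt])
      show "AE t in lebesgue_on {0<..}. 0 \<le> ?A t \<and> ?A t \<le> ?init"
        using nonneg le by eventually_elim blast
    qed
  qed
qed

end
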